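(* Let $m\ge1$ and $\theta\in\{-1,1\}$. If $\theta=1$, let $\mu>0$ be arbitrary; if $\theta=-1$, let $\mu$ be sufficiently large, i.e. $\mu\ge\mu_0$ where $\mu_0>0$ is a threshold depending on $m$, $C_\sigma$ and $A$ but not on $h$ (so, for $\theta=-1$, the assertion is that such a threshold $\mu_0$ exists for which the following holds for every $\mu\ge\mu_0$). Then there exists a constant $C>0$, independent of the mesh size $h$, such that $$\kappa(A_{m,\theta})\le C\,\overline{\Lambda}_m^{2}\,h^{-2}.$$
   Context: **Mesh.** $\Omega\subset\mathbb{R}^d$ ($d=2,3$) is a bounded convex polygonal (polyhedral) domain, and $\mathcal{T}_h$ is a triangulation of $\Omega$ into simplices. $\mathcal{E}_h^I$ and $\mathcal{E}_h^B$ are the sets of interior and boundary $(d-1)$-dimensional faces, and $\mathcal{E}_h=\mathcal{E}_h^I\cup\mathcal{E}_h^B$. Put $h_K=\mathrm{diam}(K)$, $h_e=\mathrm{diam}(e)$, let $\rho_K$ be the radius of the largest ball inscribed in $K$, and set $h=\max_Kh_K$, $\rho=\min_K\rho_K$. The mesh is quasi-uniform: $h\le C_\sigma\rho$ with a fixed constant $C_\sigma>0$. Let $n_e$ be the number of elements, enumerated $K_1,\dots,K_{n_e}$, and let $\boldsymbol{x}_K$ be the barycenter of $K$. $\mathbb{P}_m(D)$ is the space of polynomials of total degree at most $m$ on $D$. **Patches.** Fix an integer threshold $\#S$. For $K\in\mathcal{T}_h$ let $\Delta(K)=\{K'\in\mathcal{T}_h:\overline K\cap\overline{K'}\ne\varnothing\}$,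 $S_0(K)=\{K\}$, $S_t(K)=\bigcup_{K'\in S_{t-1}(K)}\Delta(K')$ for $t\ge1$, and let $S(K)=S_t(K)$ for the first $t$ such that the number of elements of $S_t(K)$ is at least $\#S$. $S(K)$ also denotes the region covered by its elements, and $\#S(K)$ is its number of elements. Let $I(K)=\{\boldsymbol{x}_{K'}:K'\in S(K)\}$. Standing assumption: for every $K\in\mathcal{T}_h$, if $p\in\mathbb{P}_m(S(K))$ vanishes at all points of $I(K)$, then $p=0$. **Reconstruction.** $U_h^0$ is the space of functions constant on each element of $\mathcal{T}_h$. For $v_h\in U_h^0$ and $K\in\mathcal{T}_h$, $\mathcal{R}_K^mv_h\in\mathbb{P}_m(S(K))$ is the unique minimizer of $\sum_{\boldsymbol{x}\in I(K)}(p(\boldsymbol{x})-v_h(\boldsymbol{x}))^2$ over $p\in\mathbb{P}_m(S(K))$ subject to $p(\boldsymbol{x}_K)=v_h(\boldsymbol{x}_K)$. The linear operator $\mathcal{R}^m$ is given by $(\mathcal{R}^mv_h)|_K=(\mathcal{R}_K^mv_h)|_K$ for all $K$, and $U_h^m=\mathcal{R}^mU_h^0$. Let $e_j\in U_h^0$ be the indicator function of $K_j$ and $\lambda_j=\mathcal{R}^me_j$; the $\lambda_j$ form a basis of $U_h^m$. Define $$\Lambda(m,K)=\max_{0\ne p\in\mathbb{P}_m(S(K))}\frac{\max_{\boldsymbol{x}\in S(K)}|p(\boldsymbol{x})|}{\max_{\boldsymbol{x}\in I(K)}|p(\boldsymbol{x})|},\quad \Lambda_m=\max_{K\in\mathcal{T}_h}\Lambda(m,K),\quad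 \overline{\Lambda}_m=\max_{K\in\mathcal{T}_h}\big(1+\Lambda_m\sqrt{\#S(K)}\big).$$ **Trace operators.** On an interior face $e$ shared by $K^\pm$ with unit outward normals $\boldsymbol{n}^\pm$: $[\![v]\!]=v^+\boldsymbol{n}^++v^-\boldsymbol{n}^-$ for scalar $v$ and $\{\boldsymbol\tau\}=\frac12(\boldsymbol\tau^++\boldsymbol\tau^-)$ for vector $\boldsymbol\tau$. On a boundary face with unit outward normal $\boldsymbol{n}$: $[\![v]\!]=v\boldsymbol{n}$ and $\{\boldsymbol\tau\}=\boldsymbol\tau$. **Matrix.** $A\in\mathbb{R}^{d\times d}$ is a symmetric positive definite matrix, $\mu$ is the penalty parameter, and gradients are taken elementwise: $$a_{h,\theta}(u,v)=\sum_{K\in\mathcal{T}_h}\int_KA\nabla u\cdot\nabla v\,d\boldsymbol{x}-\sum_{e\in\mathcal{E}_h}\int_e\{A\nabla u\}\cdot[\![v]\!]\,ds+\theta\sum_{e\in\mathcal{E}_h}\int_e\{A\nabla v\}\cdot[\![u]\!]\,ds+\sum_{e\in\mathcal{E}_h}\int_e\mu h_e^{-1}[\![u]\!]\cdot[\![v]\!]\,ds.$$ $A_{m,\theta}=(a_{h,\theta}(\lambda_i,\lambda_j))_{i,j=1}^{n_e}\in\mathbb{R}^{n_e\times n_e}$. Here $\kappa(B)=\|B\|_2\|B^{-1}\|_2$ is the spectral (Euclidean operator norm) condition number. **Constants.** The data $\Omega,d,m,\#S,C_\sigma,A,\theta,\mu$ are fixed. The constant $C$ may depend on them but is the same for all triangulations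 $\mathcal{T}_h$ of $\Omega$ into simplices that are quasi-uniform with $h\le C_\sigma\rho$ and whose patches $S(K)$, built with threshold $\#S$, satisfy the standing assumption that, for every $K\in\mathcal{T}_h$, any $p\in\mathbb{P}_m(S(K))$ vanishing at all points of $I(K)$ is $0$; in particular $C$ is independent of $h$. *)

theory Defs
  imports "HOL-Analysis.Analysis" "Jordan_Normal_Form.Gauss_Jordan_Elimination"
begin

no_notation vec_index (infixl "$" 100)
no_notation scalar_prod (infix "\<bullet>" 70)

section \<open>Domain and mesh\<close>

definition convex_polyhedral_domain :: "(real^'d) set \<Rightarrow> bool" where
  "convex_polyhedral_domain \<Omega> \<longleftrightarrow>
     open \<Omega> \<and> \<Omega> \<noteq> {} \<and> bounded \<Omega> \<and> convex \<Omega> \<and> polytope (closure \<Omega>)"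

text \<open>Elements are closed, nondegenerate simplices; the library's \<^const>\<open>triangulation\<close> makes the
  mesh finite and conforming (any two elements meet in a common, possibly empty, face).\<close>

definition simplicial_mesh :: "(real^'d) set \<Rightarrow> (real^'d) set set \<Rightarrow> bool" where
  "simplicial_mesh \<Omega> \<T> \<longleftrightarrow>
     triangulation \<T> \<and> (\<forall>K\<in>\<T>. int CARD('d) simplex K) \<and> \<Union>\<T> = closure \<Omega>"

definition inradius :: "(real^'d) set \<Rightarrow> real" where
  "inradius K = Sup {r. 0 \<le> r \<and> (\<exists>x. cball x r \<subseteq> K)}"

definition mesh_size :: "(real^'d) set set \<Rightarrow> real" where
  "mesh_size \<T> = Max (diameter ` \<T>)"

definition mesh_inradius :: "(real^'d) set set \<Rightarrow> real" where
  "mesh_inradius \<T> = Min (inradius ` \<T>)"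

text \<open>The extreme points of a simplex are its vertices.\<close>

definition barycenter :: "(real^'d) set \<Rightarrow> real^'d" where
  "barycenter K =
     (let V = {v. v extreme_point_of K} in (1 / real (card V)) *\<^sub>R (\<Sum>v\<in>V. v))"

definition interior_faces :: "(real^'d) set set \<Rightarrow> (real^'d) set set" where
  "interior_faces \<T> = {e. \<exists>K\<in>\<T>. \<exists>K'\<in>\<T>. K \<noteq> K' \<and> e facet_of K \<and> e facet_of K'}"

definition boundary_faces :: "(real^'d) set \<Rightarrow> (real^'d) set set \<Rightarrow> (real^'d) set set" where
  "boundary_faces \<Omega> \<T> = {e. e \<subseteq> frontier \<Omega> \<and> (\<exists>K\<in>\<T>. e facet_of K)}"

definition mesh_faces :: "(real^'d) set \<Rightarrow> (real^'d) set set \<Rightarrow> (real^'d) set set" where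
  "mesh_faces \<Omega> \<T> = interior_faces \<T> \<union> boundary_faces \<Omega> \<T>"


section \<open>Polynomials\<close>

text \<open>Polynomials of total degree at most \<^term>\<open>m\<close> are functions on the whole space; \<^term>\<open>\<alpha>\<close>
  ranges over multi-indices. On a set with nonempty interior, such as a patch of elements, such a
  function is determined by its restriction.\<close>

definition poly_space :: "nat \<Rightarrow> (real^'d \<Rightarrow> real) set" where
  "poly_space m =
     {p. \<exists>c :: ('d \<Rightarrow> nat) \<Rightarrow> real.
           p = (\<lambda>x. \<Sum>\<alpha> | sum \<alpha> UNIV \<le> m. c \<alpha> * (\<Prod>i\<in>UNIV. (x $ i) ^ \<alpha> i))}"

lemma finite_multi_indices: "finite {\<alpha> :: 'd::finite \<Rightarrow> nat. sum \<alpha> UNIV \<le> m}"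
proof (rule finite_subset)
  show "{\<alpha> :: 'd \<Rightarrow> nat. sum \<alpha> UNIV \<le> m} \<subseteq> (UNIV :: 'd set) \<rightarrow>\<^sub>E {..m}"
  proof
    fix \<alpha> :: "'d \<Rightarrow> nat"
    assume "\<alpha> \<in> {\<alpha>. sum \<alpha> UNIV \<le> m}"
    moreover have "\<alpha> i \<le> sum \<alpha> UNIV" for i
      by (rule member_le_sum) simp_all
    ultimately have "\<alpha> i \<in> {..m}" for i
      using le_trans by blast
    then show "\<alpha> \<in> (UNIV :: 'd set) \<rightarrow>\<^sub>E {..m}"
      by (simp add: PiE_def extensional_def Pi_def)
  qed
  show "finite ((UNIV :: 'd set) \<rightarrow>\<^sub>E {..m})"
    by (rule finite_PiE) simp_all
qed


section \<open>Patches\<close>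

definition neighbours :: "(real^'d) set set \<Rightarrow> (real^'d) set \<Rightarrow> (real^'d) set set" where
  "neighbours \<T> K = {K' \<in> \<T>. K \<inter> K' \<noteq> {}}"

fun patch_layer :: "(real^'d) set set \<Rightarrow> nat \<Rightarrow> (real^'d) set \<Rightarrow> (real^'d) set set" where
  "patch_layer \<T> 0 K = {K}"
| "patch_layer \<T> (Suc t) K = (\<Union>K' \<in> patch_layer \<T> t K. neighbours \<T> K')"

text \<open>In \<open>patch\<close> and below, \<^term>\<open>s\<close> is the size threshold. The patches exist only if the
  threshold is eventually reached (which excludes meshes with fewer than \<^term>\<open>s\<close> elements).\<close>

definition patches_exist :: "nat \<Rightarrow> (real^'d) set set \<Rightarrow> bool" where
  "patches_exist s \<T> \<longleftrightarrow> (\<forall>K\<in>\<T>. \<exists>t. s \<le> card (patch_layer \<T> t K))"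

definition patch :: "nat \<Rightarrow> (real^'d) set set \<Rightarrow> (real^'d) set \<Rightarrow> (real^'d) set set" where
  "patch s \<T> K = patch_layer \<T> (LEAST t. s \<le> card (patch_layer \<T> t K)) K"

definition sampling_points :: "nat \<Rightarrow> (real^'d) set set \<Rightarrow> (real^'d) set \<Rightarrow> (real^'d) set" where
  "sampling_points s \<T> K = barycenter ` patch s \<T> K"

definition unisolvent :: "nat \<Rightarrow> nat \<Rightarrow> (real^'d) set set \<Rightarrow> bool" where
  "unisolvent m s \<T> \<longleftrightarrow>
     (\<forall>K\<in>\<T>. \<forall>p\<in>poly_space m.
        (\<forall>x\<in>sampling_points s \<T> K. p x = 0) \<longrightarrow> (\<forall>x\<in>\<Union>(patch s \<T> K). p x = 0))"

definition admissible_mesh ::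
    "nat \<Rightarrow> nat \<Rightarrow> real \<Rightarrow> (real^'d) set \<Rightarrow> (real^'d) set set \<Rightarrow> bool" where
  "admissible_mesh m s C\<sigma> \<Omega> \<T> \<longleftrightarrow>
     simplicial_mesh \<Omega> \<T> \<and> mesh_size \<T> \<le> C\<sigma> * mesh_inradius \<T> \<and>
     patches_exist s \<T> \<and> unisolvent m s \<T>"


section \<open>Reconstruction\<close>

definition local_reconstruction ::
    "nat \<Rightarrow> nat \<Rightarrow> (real^'d) set set \<Rightarrow> (real^'d) set \<Rightarrow> (real^'d \<Rightarrow> real) \<Rightarrow> (real^'d \<Rightarrow> real)" where
  "local_reconstruction m s \<T> K v =
     (THE p. is_arg_min (\<lambda>p. \<Sum>x\<in>sampling_points s \<T> K. (p x - v x)\<^sup>2)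
               (\<lambda>p. p \<in> poly_space m \<and> p (barycenter K) = v (barycenter K)) p)"

text \<open>A piecewise polynomial function on the mesh is represented by the family of its restrictions to
  the elements, each one given by its polynomial; thus \<open>w K x\<close> for \<^term>\<open>x\<close> on a face of \<^term>\<open>K\<close> is
  the trace from within \<^term>\<open>K\<close>. The piecewise constant argument \<open>v\<close> of the reconstruction is an
  ordinary function, of which only the values at barycenters (interior points of the elements)
  matter.\<close>

type_synonym 'd broken_fun = "(real^'d) set \<Rightarrow> real^'d \<Rightarrow> real"

definition reconstruction ::
    "nat \<Rightarrow> nat \<Rightarrow> (real^'d) set set \<Rightarrow> (real^'d \<Rightarrow> real) \<Rightarrow> 'd broken_fun" where
  "reconstruction m s \<T> v = (\<lambda>K. local_reconstruction m s \<T> K v)"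

definition basis_fun :: "nat \<Rightarrow> nat \<Rightarrow> (real^'d) set set \<Rightarrow> (real^'d) set \<Rightarrow> 'd broken_fun" where
  "basis_fun m s \<T> K = reconstruction m s \<T> (indicat_real K)"

definition Lambda_local :: "nat \<Rightarrow> nat \<Rightarrow> (real^'d) set set \<Rightarrow> (real^'d) set \<Rightarrow> real" where
  "Lambda_local m s \<T> K =
     (SUP p\<in>{p \<in> poly_space m. \<exists>x\<in>\<Union>(patch s \<T> K). p x \<noteq> 0}.
        (SUP x\<in>\<Union>(patch s \<T> K). \<bar>p x\<bar>) / (MAX x\<in>sampling_points s \<T> K. \<bar>p x\<bar>))"

definition Lambda_mesh :: "nat \<Rightarrow> nat \<Rightarrow> (real^'d) set set \<Rightarrow> real" where
  "Lambda_mesh m s \<T> = (MAX K\<in>\<T>. Lambda_local m s \<T> K)"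

definition Lambda_bar :: "nat \<Rightarrow> nat \<Rightarrow> (real^'d) set set \<Rightarrow> real" where
  "Lambda_bar m s \<T> = (MAX K\<in>\<T>. 1 + Lambda_mesh m s \<T> * sqrt (real (card (patch s \<T> K))))"


section \<open>Integration over faces\<close>

text \<open>Surface (that is, \<open>(d - 1)\<close>-dimensional Lebesgue) measure on a hyperplane \<^term>\<open>H\<close>: by Fubini,
  the area of \<open>E \<subseteq> H\<close> is the volume of the right cylinder over \<open>E\<close> consisting of the points whose
  orthogonal projection lies in \<open>E\<close> and whose distance from \<^term>\<open>H\<close> is at most \<open>1/2\<close>, because
  the cylinder has height 1.\<close>

definition hyperplane_measure :: "'a::euclidean_space set \<Rightarrow> 'a measure" where
  "hyperplane_measure H =
     distr (restrict_space lborel {z. infdist z H \<le> 1 / 2}) borel (closest_point H)"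

definition face_integral :: "(real^'d) set \<Rightarrow> (real^'d \<Rightarrow> real) \<Rightarrow> real" where
  "face_integral e f = (LINT x:e|hyperplane_measure (affine hull e). f x)"


section \<open>Trace operators and the bilinear form\<close>

definition grad :: "(real^'d \<Rightarrow> real) \<Rightarrow> real^'d \<Rightarrow> real^'d" where
  "grad f x = (THE D. GDERIV f x :> D)"

definition outward_normal :: "(real^'d) set \<Rightarrow> (real^'d) set \<Rightarrow> real^'d" where
  "outward_normal K e =
     (THE n. norm n = 1 \<and> (\<exists>b. e \<subseteq> {x. n \<bullet> x = b} \<and> K \<subseteq> {x. n \<bullet> x \<le> b}))"

text \<open>The sums below have two terms on an interior face and one on a boundary face.\<close>

definition jump :: "(real^'d) set set \<Rightarrow> 'd broken_fun \<Rightarrow> (real^'d) set \<Rightarrow> real^'d \<Rightarrow> real^'d" where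
  "jump \<T> v e x = (\<Sum>K | K \<in> \<T> \<and> e facet_of K. v K x *\<^sub>R outward_normal K e)"

definition average ::
    "(real^'d) set set \<Rightarrow> ((real^'d) set \<Rightarrow> real^'d \<Rightarrow> real^'d) \<Rightarrow> (real^'d) set \<Rightarrow> real^'d \<Rightarrow> real^'d"
  where
  "average \<T> \<tau> e x =
     (if e \<in> interior_faces \<T> then 1 / 2 else 1) *\<^sub>R (\<Sum>K | K \<in> \<T> \<and> e facet_of K. \<tau> K x)"

definition flux :: "real^'d^'d \<Rightarrow> 'd broken_fun \<Rightarrow> (real^'d) set \<Rightarrow> real^'d \<Rightarrow> real^'d" where
  "flux A u K x = A *v grad (u K) x"

definition dg_form ::
    "real^'d^'d \<Rightarrow> real \<Rightarrow> real \<Rightarrow> (real^'d) set \<Rightarrow> (real^'d) set set \<Rightarrow>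
     'd broken_fun \<Rightarrow> 'd broken_fun \<Rightarrow> real" where
  "dg_form A \<theta> \<mu> \<Omega> \<T> u v =
     (\<Sum>K\<in>\<T>. LINT x:K|lborel. flux A u K x \<bullet> grad (v K) x)
   - (\<Sum>e\<in>mesh_faces \<Omega> \<T>. face_integral e (\<lambda>x. average \<T> (flux A u) e x \<bullet> jump \<T> v e x))
   + \<theta> * (\<Sum>e\<in>mesh_faces \<Omega> \<T>. face_integral e (\<lambda>x. average \<T> (flux A v) e x \<bullet> jump \<T> u e x))
   + (\<Sum>e\<in>mesh_faces \<Omega> \<T>.
        face_integral e (\<lambda>x. \<mu> / diameter e * (jump \<T> u e x \<bullet> jump \<T> v e x)))"

definition spd_matrix :: "real^'d^'d \<Rightarrow> bool" where
  "spd_matrix A \<longleftrightarrow> Finite_Cartesian_Product.transpose A = A \<and> (\<forall>x. x \<noteq> 0 \<longrightarrow> 0 < x \<bullet> (A *v x))"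


section \<open>Stiffness matrix and condition number\<close>

text \<open>\<open>Ks\<close> enumerates the elements, starting from index 0.\<close>

definition stiffness_matrix ::
    "nat \<Rightarrow> nat \<Rightarrow> real^'d^'d \<Rightarrow> real \<Rightarrow> real \<Rightarrow> (real^'d) set \<Rightarrow> (real^'d) set set \<Rightarrow>
     (nat \<Rightarrow> (real^'d) set) \<Rightarrow> real mat" where
  "stiffness_matrix m s A \<theta> \<mu> \<Omega> \<T> Ks =
     Matrix.mat (card \<T>) (card \<T>)
       (\<lambda>(i, j). dg_form A \<theta> \<mu> \<Omega> \<T> (basis_fun m s \<T> (Ks i)) (basis_fun m s \<T> (Ks j)))"

definition vec_norm2 :: "real Matrix.vec \<Rightarrow> real" where
  "vec_norm2 x = sqrt (scalar_prod x x)"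

definition mat_norm2 :: "real mat \<Rightarrow> real" where
  "mat_norm2 B = Sup {vec_norm2 (B *\<^sub>v x) |x. x \<in> carrier_vec (dim_col B) \<and> vec_norm2 x = 1}"

text \<open>Meaningful only for invertible \<^term>\<open>B\<close>, which is when \<^const>\<open>mat_inverse\<close> returns the inverse.\<close>

definition condition_number :: "real mat \<Rightarrow> real" where
  "condition_number B = mat_norm2 B * mat_norm2 (the (mat_inverse B))"

end

theory Submission
  imports Defs "Jordan_Normal_Form.Determinant"
begin

text \<open>
  Write \<open>w = \<Sum> x\<^sub>i \<lambda>\<^sub>i\<close> for the reconstruction of the piecewise constant function with values \<open>x\<^sub>i\<close>.
  Then \<open>x \<bullet> A y = a(w\<^sub>x, w\<^sub>y)\<close>, and the condition number is at most \<open>\<beta> / \<alpha>\<close> as soon as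
  \<open>\<bar>a(w\<^sub>x, w\<^sub>y)\<bar> \<le> \<beta> \<bar>x\<bar> \<bar>y\<bar>\<close> and \<open>\<alpha> \<bar>x\<bar>\<^sup>2 \<le> a(w\<^sub>x, w\<^sub>x)\<close> (\<open>condition_number_le\<close>). It
  suffices to take \<open>\<beta>\<close> of order \<open>\<Lambda>\<^sup>2 h\<^sup>d\<^sup>-\<^sup>2\<close>, where \<open>\<Lambda>\<close> is \<open>Lambda_bar\<close>, and \<open>\<alpha>\<close> of order \<open>h\<^sup>d\<close>.

  For the upper bound, a basis function \<open>\<lambda>\<^sub>i\<close> vanishes on every element whose patch does not contain
  \<open>K\<^sub>i\<close>, and elsewhere it is bounded by \<open>2 \<Lambda>\<close>, because the constant with the prescribed central value
  competes in the least-squares problem (\<open>basis_bounded\<close>). Disjoint inscribed balls bound the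
  size of the patches and the number of patches that contain a given element
  (\<open>card_elements_in_ball\<close>). An inverse estimate for
  polynomials, with one factor \<open>1 / h\<close> for each gradient, and the size of the face areas turn these
  bounds on maxima into a bound on the form (\<open>dg_form_continuous\<close>).

  For the lower bound, the form controls the gradient energy plus the jump energy
  (\<open>dg_form_coercive_energy\<close>): for \<open>\<theta> = 1\<close> the consistency terms cancel, and for \<open>\<theta> = -1\<close> a large
  penalty absorbs them. Since \<open>w\<close> takes the value \<open>x\<^sub>i\<close> at the barycenter of \<open>K\<^sub>i\<close>, what is left is
  to bound \<open>h\<^sup>d \<bar>x\<bar>\<^sup>2\<close> by this energy. Inverse estimates reduce that to a Poincare inequality for the
  numbers \<open>x\<^sub>i\<close> themselves (\<open>discrete_poincare\<close>), in which jumps over faces replace derivatives.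
  It is a discrete version of integrating the divergence of \<open>w\<^sup>2 y\<close> over the domain, where \<open>y\<close>
  denotes the position. The volume of a simplex is the sum of the signed volumes of the
  cones that join its facets to the origin (\<open>signed_cone_volumes\<close>), so the sum of \<open>vol(K\<^sub>i) x\<^sub>i\<^sup>2\<close> is a
  sum over faces in which the two sides of an interior face enter with opposite signs. Only the
  differences \<open>x\<^sub>+\<^sup>2 - x\<^sub>-\<^sup>2 = (x\<^sub>+ - x\<^sub>-) (x\<^sub>+ + x\<^sub>-)\<close> remain, and \<open>x\<^sup>2\<close> on boundary faces; the second factor
  is absorbed on the left.

  Two geometric facts support this. The area of a facet is a constant times the volume of the
  simplex divided by the height (\<open>facet_area_eq\<close>), which shearing a right cylinder over the facet into
  an oblique one shows for a surface measure defined by cylinders; and every facet of an element is either shared with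
  exactly one other element, which lies on the opposite side, or part of the boundary
  (\<open>facet_in_faces\<close>, \<open>face_elements_cases\<close>).
\<close>

section \<open>Multivariate polynomials\<close>

definition monomial_fun :: "('d::finite \<Rightarrow> nat) \<Rightarrow> real^'d \<Rightarrow> real" where
  "monomial_fun \<alpha> x = (\<Prod>i\<in>UNIV. (x $ i) ^ \<alpha> i)"

definition multi_indices :: "nat \<Rightarrow> ('d::finite \<Rightarrow> nat) set" where
  "multi_indices m = {\<alpha>. sum \<alpha> UNIV \<le> m}"

lemma finite_multi_indices_set [simp]: "finite (multi_indices m)"
  unfolding multi_indices_def by (rule finite_multi_indices)

lemma poly_space_iff:
  "p \<in> poly_space m \<longleftrightarrow> (\<exists>c. p = (\<lambda>x. \<Sum>\<alpha>\<in>multi_indices m. c \<alpha> * monomial_fun \<alpha> x))"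
  by (simp add: poly_space_def multi_indices_def monomial_fun_def)

lemma poly_space_monomial: "\<alpha> \<in> multi_indices m \<Longrightarrow> monomial_fun \<alpha> \<in> poly_space m"
  unfolding poly_space_iff
  by (rule exI[of _ "\<lambda>\<beta>. if \<beta> = \<alpha> then 1 else 0"])
     (simp add: if_distrib[of "\<lambda>c. c * _"] cong: if_cong)

lemma poly_space_scale: "p \<in> poly_space m \<Longrightarrow> (\<lambda>x. a * p x) \<in> poly_space m"
  unfolding poly_space_iff
proof (elim exE)
  fix c assume "p = (\<lambda>x. \<Sum>\<alpha>\<in>multi_indices m. c \<alpha> * monomial_fun \<alpha> x)"
  then show "\<exists>c. (\<lambda>x. a * p x) = (\<lambda>x. \<Sum>\<alpha>\<in>multi_indices m. c \<alpha> * monomial_fun \<alpha> x)"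
    by (intro exI[of _ "\<lambda>\<alpha>. a * c \<alpha>"]) (simp add: sum_distrib_left mult.assoc)
qed

lemma poly_space_add: "p \<in> poly_space m \<Longrightarrow> q \<in> poly_space m \<Longrightarrow> (\<lambda>x. p x + q x) \<in> poly_space m"
  unfolding poly_space_iff
proof (elim exE)
  fix c d assume "p = (\<lambda>x. \<Sum>\<alpha>\<in>multi_indices m. c \<alpha> * monomial_fun \<alpha> x)"
    "q = (\<lambda>x. \<Sum>\<alpha>\<in>multi_indices m. d \<alpha> * monomial_fun \<alpha> x)"
  then show "\<exists>c. (\<lambda>x. p x + q x) = (\<lambda>x. \<Sum>\<alpha>\<in>multi_indices m. c \<alpha> * monomial_fun \<alpha> x)"
    by (intro exI[of _ "\<lambda>\<alpha>. c \<alpha> + d \<alpha>"]) (simp add: sum.distrib distrib_right)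
qed

lemma poly_space_const: "(\<lambda>x. a) \<in> poly_space m"
proof -
  have "(\<lambda>_. 0) \<in> multi_indices m" by (simp add: multi_indices_def)
  then have "(\<lambda>x. a * monomial_fun (\<lambda>_. 0) x) \<in> poly_space m"
    by (intro poly_space_scale poly_space_monomial)
  then show ?thesis by (simp add: monomial_fun_def)
qed

lemma poly_space_sum:
  assumes "\<And>i. i \<in> I \<Longrightarrow> f i \<in> poly_space m"
  shows "(\<lambda>x. \<Sum>i\<in>I. f i x) \<in> poly_space m"
  using assms
  by (induction I rule: infinite_finite_induct) (auto intro: poly_space_const poly_space_add)

lemma poly_space_diff: "p \<in> poly_space m \<Longrightarrow> q \<in> poly_space m \<Longrightarrow> (\<lambda>x. p x - q x) \<in> poly_space m"
  using poly_space_add[of p m "\<lambda>x. -1 * q x"] poly_space_scale[of q m "-1"] by simp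

lemma poly_space_mono: "a \<le> b \<Longrightarrow> poly_space a \<subseteq> poly_space b"
proof
  fix p :: "real^'d \<Rightarrow> real" assume "a \<le> b" "p \<in> poly_space a"
  then obtain c where p: "p = (\<lambda>x. \<Sum>\<alpha>\<in>multi_indices a. c \<alpha> * monomial_fun \<alpha> x)"
    by (auto simp: poly_space_iff)
  show "p \<in> poly_space b" unfolding p using \<open>a \<le> b\<close>
    by (intro poly_space_sum poly_space_scale poly_space_monomial) (auto simp: multi_indices_def)
qed

lemma poly_space_mult:
  assumes "p \<in> poly_space a" "q \<in> poly_space b"
  shows "(\<lambda>x. p x * q x) \<in> poly_space (a + b)"
proof -
  obtain c where p: "p = (\<lambda>x. \<Sum>\<alpha>\<in>multi_indices a. c \<alpha> * monomial_fun \<alpha> x)"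
    using assms by (auto simp: poly_space_iff)
  obtain d where q: "q = (\<lambda>x. \<Sum>\<beta>\<in>multi_indices b. d \<beta> * monomial_fun \<beta> x)"
    using assms by (auto simp: poly_space_iff)
  have "(\<lambda>x. p x * q x)
      = (\<lambda>x. \<Sum>\<alpha>\<in>multi_indices a. \<Sum>\<beta>\<in>multi_indices b. (c \<alpha> * d \<beta>) * monomial_fun (\<lambda>i. \<alpha> i + \<beta> i) x)"
    unfolding p q sum_product
    by (intro ext sum.cong refl) (simp add: monomial_fun_def power_add prod.distrib)
  also have "\<dots> \<in> poly_space (a + b)"
    by (intro poly_space_sum poly_space_scale poly_space_monomial)
       (auto simp: multi_indices_def sum.distrib add_mono)
  finally show ?thesis .
qed

lemma poly_space_power:
  assumes "p \<in> poly_space a" shows "(\<lambda>x. p x ^ k) \<in> poly_space (k * a)"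
proof (induction k)
  case 0 show ?case by (simp add: poly_space_const)
next
  case (Suc k) then show ?case using poly_space_mult[OF assms Suc] by simp
qed

lemma poly_space_prod:
  assumes "finite I" "\<And>i. i \<in> I \<Longrightarrow> f i \<in> poly_space (n i)"
  shows "(\<lambda>x. \<Prod>i\<in>I. f i x) \<in> poly_space (sum n I)"
  using assms
proof (induction I rule: finite_induct)
  case (insert i I) then show ?case using poly_space_mult[of "f i" "n i"] by simp
qed (simp add: poly_space_const)

lemma poly_space_affine_component: "(\<lambda>x. a $ i + r * x $ i) \<in> poly_space 1"
proof -
  let ?\<alpha> = "\<lambda>j. if j = i then 1 else (0::nat)"
  have "monomial_fun ?\<alpha> = (\<lambda>x. x $ i)"
  proof
    fix x :: "real^'a"
    have "monomial_fun ?\<alpha> x = (\<Prod>j\<in>UNIV. if j = i then x $ j else 1)"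
      unfolding monomial_fun_def by (intro prod.cong) auto
    then show "monomial_fun ?\<alpha> x = x $ i" by simp
  qed
  moreover have "monomial_fun ?\<alpha> \<in> poly_space 1"
    by (rule poly_space_monomial) (simp add: multi_indices_def)
  ultimately show ?thesis
    using poly_space_add[OF poly_space_const poly_space_scale] by metis
qed

lemma poly_space_affine_rescale:
  assumes "p \<in> poly_space m" shows "(\<lambda>x. p (a + r *\<^sub>R x)) \<in> poly_space m"
proof -
  obtain c where p: "p = (\<lambda>x. \<Sum>\<alpha>\<in>multi_indices m. c \<alpha> * monomial_fun \<alpha> x)"
    using assms by (auto simp: poly_space_iff)
  have "(\<lambda>x. monomial_fun \<alpha> (a + r *\<^sub>R x)) \<in> poly_space m" if "\<alpha> \<in> multi_indices m" for \<alpha>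
  proof -
    have "(\<lambda>x. \<Prod>i\<in>UNIV. (a $ i + r * x $ i) ^ \<alpha> i) \<in> poly_space (\<Sum>i\<in>UNIV. \<alpha> i * 1)"
      by (intro poly_space_prod poly_space_power poly_space_affine_component) simp
    then show ?thesis using that poly_space_mono[of "sum \<alpha> UNIV" m]
      by (auto simp: monomial_fun_def multi_indices_def)
  qed
  then show ?thesis unfolding p by (intro poly_space_sum poly_space_scale)
qed

text \<open>Fixing all variables but one leaves a univariate polynomial with infinitely many zeros; its
  coefficients are polynomials in the remaining variables and vanish on the smaller grid.\<close>

lemma monomials_independent_on_grid:
  fixes c :: "('d \<Rightarrow> nat) \<Rightarrow> real"
  assumes "finite V" "finite F" "\<And>\<alpha> i. \<alpha> \<in> F \<Longrightarrow> i \<notin> V \<Longrightarrow> \<alpha> i = 0"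
    and B: "\<And>i. infinite (B i)"
    and "\<And>x. (\<And>i. x i \<in> B i) \<Longrightarrow> (\<Sum>\<alpha>\<in>F. c \<alpha> * (\<Prod>i\<in>V. x i ^ \<alpha> i)) = 0"
    and "\<alpha> \<in> F"
  shows "c \<alpha> = 0"
  using assms(1,2,3,5,6)
proof (induction V arbitrary: F c \<alpha> rule: finite_induct)
  case empty
  have "\<And>\<beta>. \<beta> \<in> F \<Longrightarrow> \<beta> = \<alpha>" using empty.prems(2,4) by (intro ext) (metis empty_iff)
  then have "F = {\<alpha>}" using empty.prems(4) by blast
  moreover have "\<exists>x. \<forall>i. x i \<in> B i" by (intro choice allI) (metis B finite.emptyI all_not_in_conv)
  ultimately show ?case using empty.prems(3) by auto
next
  case (insert j V)
  define N where "N = Max ((\<lambda>\<alpha>. \<alpha> j) ` F)"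
  define k where "k = \<alpha> j"
  define G where "G l = {\<beta>\<in>F. \<beta> j = l}" for l
  have N: "\<beta> j \<le> N" if "\<beta> \<in> F" for \<beta>
    unfolding N_def using that insert.prems(1) by auto
  have coeff: "(\<Sum>\<beta>\<in>G k. c \<beta> * (\<Prod>i\<in>V. x i ^ \<beta> i)) = 0" if x: "\<And>i. x i \<in> B i" for x
  proof -
    have "(\<Sum>l\<le>N. (\<Sum>\<beta>\<in>G l. c \<beta> * (\<Prod>i\<in>V. x i ^ \<beta> i)) * y ^ l) = 0" if y: "y \<in> B j" for y
    proof -
      have "(\<Sum>\<beta>\<in>F. c \<beta> * (\<Prod>i\<in>insert j V. (x(j := y)) i ^ \<beta> i)) = 0"
        by (rule insert.prems(3)) (use x y in auto)
      also have "(\<Sum>\<beta>\<in>F. c \<beta> * (\<Prod>i\<in>insert j V. (x(j := y)) i ^ \<beta> i))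
          = (\<Sum>\<beta>\<in>F. c \<beta> * (\<Prod>i\<in>V. x i ^ \<beta> i) * y ^ \<beta> j)"
      proof (intro sum.cong refl)
        fix \<beta>
        have "(\<Prod>i\<in>V. (x(j := y)) i ^ \<beta> i) = (\<Prod>i\<in>V. x i ^ \<beta> i)"
          by (intro prod.cong) (use insert.hyps in auto)
        then show "c \<beta> * (\<Prod>i\<in>insert j V. (x(j := y)) i ^ \<beta> i) = c \<beta> * (\<Prod>i\<in>V. x i ^ \<beta> i) * y ^ \<beta> j"
          using insert.hyps by simp
      qed
      also have "\<dots> = (\<Sum>l\<le>N. \<Sum>\<beta>\<in>{\<beta>\<in>F. \<beta> j = l}. c \<beta> * (\<Prod>i\<in>V. x i ^ \<beta> i) * y ^ \<beta> j)"
        by (rule sum.group[symmetric]) (use insert.prems(1) N in auto)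
      also have "\<dots> = (\<Sum>l\<le>N. (\<Sum>\<beta>\<in>G l. c \<beta> * (\<Prod>i\<in>V. x i ^ \<beta> i)) * y ^ l)"
        unfolding sum_distrib_right G_def by (intro sum.cong) auto
      finally show ?thesis by simp
    qed
    then have "B j \<subseteq> {y. (\<Sum>l\<le>N. (\<Sum>\<beta>\<in>G l. c \<beta> * (\<Prod>i\<in>V. x i ^ \<beta> i)) * y ^ l) = 0}" by auto
    then have "infinite {y. (\<Sum>l\<le>N. (\<Sum>\<beta>\<in>G l. c \<beta> * (\<Prod>i\<in>V. x i ^ \<beta> i)) * y ^ l) = 0}"
      using B infinite_super by blast
    then have "\<forall>l\<le>N. (\<Sum>\<beta>\<in>G l. c \<beta> * (\<Prod>i\<in>V. x i ^ \<beta> i)) = 0"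
      using polyfun_finite_roots[of "\<lambda>l. \<Sum>\<beta>\<in>G l. c \<beta> * (\<Prod>i\<in>V. x i ^ \<beta> i)" N] by simp
    then show ?thesis using N[OF insert.prems(4)] k_def by blast
  qed
  \<comment> \<open>Within \<open>G k\<close> the exponent of \<open>x\<^sub>j\<close> is \<open>k\<close>, so nothing is lost by resetting it to \<open>0\<close>.\<close>
  have inj: "inj_on (\<lambda>\<beta>. \<beta>(j := 0)) (G k)"
  proof (rule inj_onI)
    fix \<beta> \<gamma> assume "\<beta> \<in> G k" "\<gamma> \<in> G k" and eq: "\<beta>(j := 0) = \<gamma>(j := (0::nat))"
    then have "\<beta> j = \<gamma> j" by (simp add: G_def)
    moreover have "\<beta> i = \<gamma> i" if "i \<noteq> j" for i using fun_cong[OF eq, of i] that by simp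
    ultimately show "\<beta> = \<gamma>" by (metis ext)
  qed
  have restore: "\<beta>(j := 0, j := k) = \<beta>" if "\<beta> \<in> G k" for \<beta> using that by (auto simp: G_def)
  have "c ((\<alpha>(j := 0))(j := k)) = 0"
  proof (rule insert.IH[of "(\<lambda>\<beta>. \<beta>(j := 0)) ` G k" "\<lambda>\<beta>. c (\<beta>(j := k))"])
    show "finite ((\<lambda>\<beta>. \<beta>(j := 0)) ` G k)" using insert.prems(1) by (simp add: G_def)
    show "\<beta> i = 0" if "\<beta> \<in> (\<lambda>\<beta>. \<beta>(j := 0)) ` G k" "i \<notin> V" for \<beta> i
      using that insert.prems(2) by (auto simp: G_def)
    show "\<alpha>(j := 0) \<in> (\<lambda>\<beta>. \<beta>(j := 0)) ` G k" using insert.prems(4) by (auto simp: G_def k_def)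
    fix x assume x: "\<And>i. x i \<in> B i"
    have "(\<Sum>\<beta>\<in>(\<lambda>\<beta>. \<beta>(j := 0)) ` G k. c (\<beta>(j := k)) * (\<Prod>i\<in>V. x i ^ \<beta> i))
        = (\<Sum>\<beta>\<in>G k. c \<beta> * (\<Prod>i\<in>V. x i ^ \<beta> i))"
      unfolding sum.reindex[OF inj] o_def
    proof (intro sum.cong refl arg_cong2[of _ _ _ _ "(*)"])
      fix \<beta> assume "\<beta> \<in> G k"
      then show "c (\<beta>(j := 0, j := k)) = c \<beta>" by (simp only: restore)
      show "(\<Prod>i\<in>V. x i ^ (\<beta>(j := 0)) i) = (\<Prod>i\<in>V. x i ^ \<beta> i)"
        by (intro prod.cong) (use insert.hyps in auto)
    qed
    then show "(\<Sum>\<beta>\<in>(\<lambda>\<beta>. \<beta>(j := 0)) ` G k. c (\<beta>(j := k)) * (\<Prod>i\<in>V. x i ^ \<beta> i)) = 0"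
      using coeff[OF x] by simp
  qed
  then show ?case by (simp add: k_def)
qed

lemma poly_vanishing_on_open_coeffs:
  fixes U :: "(real^'d) set"
  assumes "open U" "U \<noteq> {}" and zero: "\<And>x. x \<in> U \<Longrightarrow> (\<Sum>\<alpha>\<in>multi_indices m. c \<alpha> * monomial_fun \<alpha> x) = 0"
    and "\<alpha> \<in> multi_indices m"
  shows "c \<alpha> = 0"
proof -
  obtain a where "a \<in> U" using assms by auto
  then obtain e where e: "e > 0" "ball a e \<subseteq> U" using assms open_contains_ball by blast
  define \<epsilon> where "\<epsilon> = e / real CARD('d)"
  have "\<epsilon> > 0" using e by (simp add: \<epsilon>_def)
  show ?thesis
  proof (rule monomials_independent_on_grid[of UNIV "multi_indices m" "\<lambda>i. {a $ i - \<epsilon> <..< a $ i + \<epsilon>}" c])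
    fix x assume x: "\<And>i. x i \<in> {a $ i - \<epsilon> <..< a $ i + \<epsilon>}"
    let ?y = "\<chi> i. x i"
    have "norm (?y - a) \<le> (\<Sum>i\<in>UNIV. \<bar>(?y - a) $ i\<bar>)" by (rule norm_le_l1_cart)
    also have "\<dots> < (\<Sum>i\<in>(UNIV::'d set). \<epsilon>)"
      by (rule sum_strict_mono) (use x in \<open>auto simp: abs_less_iff algebra_simps\<close>)
    also have "\<dots> = e" by (simp add: \<epsilon>_def)
    finally have "?y \<in> U" using e by (auto simp: dist_norm norm_minus_commute)
    then show "(\<Sum>\<alpha>\<in>multi_indices m. c \<alpha> * (\<Prod>i\<in>UNIV. x i ^ \<alpha> i)) = 0"
      using zero[of ?y] by (simp add: monomial_fun_def)
  qed (use assms \<open>\<epsilon> > 0\<close> in \<open>auto simp: infinite_Ioo\<close>)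
qed

lemma poly_eq_on_open:
  assumes "p \<in> poly_space m" "q \<in> poly_space m" "open U" "U \<noteq> {}" "\<And>x. x \<in> U \<Longrightarrow> p x = q x"
  shows "p = q"
proof -
  obtain c where c: "(\<lambda>x. p x - q x) = (\<lambda>x. \<Sum>\<alpha>\<in>multi_indices m. c \<alpha> * monomial_fun \<alpha> x)"
    using poly_space_diff[OF assms(1,2)] by (auto simp: poly_space_iff)
  have "c \<alpha> = 0" if "\<alpha> \<in> multi_indices m" for \<alpha>
  proof (rule poly_vanishing_on_open_coeffs[OF assms(3,4) _ that])
    show "(\<Sum>\<alpha>\<in>multi_indices m. c \<alpha> * monomial_fun \<alpha> x) = 0" if "x \<in> U" for x
      using fun_cong[OF c, of x] assms(5)[OF that] by simp
  qed
  then have "(\<lambda>x. p x - q x) = (\<lambda>x. 0)" unfolding c by simp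
  then show ?thesis by (metis eq_iff_diff_eq_0 ext)
qed

section \<open>Gradients of polynomials\<close>

lemma grad_eqI: "GDERIV f x :> D \<Longrightarrow> grad f x = D"
proof -
  assume D: "GDERIV f x :> D"
  have "E = D" if "GDERIV f x :> E" for E
  proof -
    have "(\<lambda>h. h \<bullet> E) = (\<lambda>h. h \<bullet> D)"
      using that D unfolding gderiv_def by (rule has_derivative_unique)
    then have "(E - D) \<bullet> E = (E - D) \<bullet> D" by meson
    then have "(E - D) \<bullet> (E - D) = 0" by (simp add: inner_diff_right)
    then show ?thesis by simp
  qed
  then show ?thesis unfolding grad_def using D by blast
qed

text \<open>As \<^const>\<open>grad\<close> is a definite description, it has a meaning only where a gradient exists. The
  predicate records that this is so everywhere, together with the continuity that makes all
  integrands below integrable.\<close>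

definition smooth_fun :: "(real^'d \<Rightarrow> real) \<Rightarrow> bool" where
  "smooth_fun f \<longleftrightarrow> (\<forall>x. GDERIV f x :> grad f x) \<and> continuous_on UNIV (grad f)"

lemma smooth_funI:
  assumes "\<And>x. GDERIV f x :> g x" "continuous_on UNIV g"
  shows "smooth_fun f"
proof -
  have "grad f = g" using assms(1) grad_eqI by blast
  with assms show ?thesis by (simp add: smooth_fun_def)
qed

lemma smooth_fun_gderiv: "smooth_fun f \<Longrightarrow> GDERIV f x :> grad f x"
  by (simp add: smooth_fun_def)

lemma smooth_fun_continuous: "smooth_fun f \<Longrightarrow> continuous_on S f"
  unfolding smooth_fun_def gderiv_def
  by (meson continuous_at_imp_continuous_on has_derivative_continuous)

lemma smooth_fun_continuous_grad: "smooth_fun f \<Longrightarrow> continuous_on S (grad f)"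
  unfolding smooth_fun_def using continuous_on_subset by blast

lemma smooth_fun_const: "smooth_fun (\<lambda>x. a)"
  by (rule smooth_funI[OF GDERIV_const]) auto

lemma grad_add: "smooth_fun f \<Longrightarrow> smooth_fun g \<Longrightarrow> grad (\<lambda>x. f x + g x) x = grad f x + grad g x"
  by (intro grad_eqI GDERIV_add smooth_fun_gderiv)

lemma grad_scale: "smooth_fun f \<Longrightarrow> grad (\<lambda>x. a * f x) x = a *\<^sub>R grad f x"
  using GDERIV_mult[OF GDERIV_const smooth_fun_gderiv, of f a x] by (intro grad_eqI) simp

lemma smooth_fun_mult: "smooth_fun f \<Longrightarrow> smooth_fun g \<Longrightarrow> smooth_fun (\<lambda>x. f x * g x)"
  by (rule smooth_funI[OF GDERIV_mult[OF smooth_fun_gderiv smooth_fun_gderiv]])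
     (auto intro!: continuous_intros smooth_fun_continuous smooth_fun_continuous_grad)

lemma smooth_fun_add: "smooth_fun f \<Longrightarrow> smooth_fun g \<Longrightarrow> smooth_fun (\<lambda>x. f x + g x)"
  by (rule smooth_funI[OF GDERIV_add[OF smooth_fun_gderiv smooth_fun_gderiv]])
     (auto intro!: continuous_intros smooth_fun_continuous_grad)

lemma smooth_fun_component: "smooth_fun (\<lambda>x. x $ i)"
proof (rule smooth_funI)
  show "GDERIV (\<lambda>x. x $ i) x :> axis i 1" for x
    unfolding gderiv_def inner_axis
    by (auto intro!: bounded_linear_imp_has_derivative bounded_linear_vec_nth)
qed auto

lemma smooth_fun_monomial: "smooth_fun (monomial_fun \<alpha>)"
proof -
  have pow: "smooth_fun (\<lambda>x. (x $ i) ^ k)" for i :: 'a and k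
    by (induction k) (auto intro: smooth_fun_const smooth_fun_mult smooth_fun_component)
  have "smooth_fun (\<lambda>x. \<Prod>i\<in>I. (x $ i) ^ \<alpha> i)" for I :: "'a set"
    by (induction I rule: infinite_finite_induct)
       (auto intro: smooth_fun_const smooth_fun_mult pow)
  then show ?thesis unfolding monomial_fun_def[abs_def] .
qed

lemma smooth_fun_sum:
  "(\<And>i. i \<in> I \<Longrightarrow> smooth_fun (f i)) \<Longrightarrow> smooth_fun (\<lambda>x. \<Sum>i\<in>I. f i x)"
  by (induction I rule: infinite_finite_induct) (auto intro: smooth_fun_const smooth_fun_add)

lemma smooth_fun_poly: "p \<in> poly_space m \<Longrightarrow> smooth_fun p"
  by (auto simp: poly_space_iff intro!: smooth_fun_sum smooth_fun_mult smooth_fun_const smooth_fun_monomial)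

lemma grad_const: "grad (\<lambda>x. a) x = 0"
  by (rule grad_eqI[OF GDERIV_const])

lemma grad_sum:
  "(\<And>i. i \<in> I \<Longrightarrow> smooth_fun (f i)) \<Longrightarrow> grad (\<lambda>x. \<Sum>i\<in>I. f i x) x = (\<Sum>i\<in>I. grad (f i) x)"
  by (induction I rule: infinite_finite_induct) (auto simp: grad_const grad_add smooth_fun_sum)

lemma grad_poly:
  "grad (\<lambda>x. \<Sum>\<alpha>\<in>F. c \<alpha> * monomial_fun \<alpha> x) x = (\<Sum>\<alpha>\<in>F. c \<alpha> *\<^sub>R grad (monomial_fun \<alpha>) x)"
  by (subst grad_sum) (auto intro: smooth_fun_mult smooth_fun_const smooth_fun_monomial
      simp: grad_scale smooth_fun_monomial)

lemma grad_affine_rescale: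
  assumes "smooth_fun f"
  shows "grad (\<lambda>y. f (a + r *\<^sub>R y)) y = r *\<^sub>R grad f (a + r *\<^sub>R y)"
proof (rule grad_eqI)
  have "((\<lambda>y. f (a + r *\<^sub>R y)) has_derivative (\<lambda>h. (r *\<^sub>R h) \<bullet> grad f (a + r *\<^sub>R y))) (at y)"
  proof (rule has_derivative_compose[of _ _ y UNIV f, simplified])
    show "((\<lambda>y. a + r *\<^sub>R y) has_derivative (\<lambda>h. r *\<^sub>R h)) (at y)"
      by (auto intro!: derivative_eq_intros)
    show "(f has_derivative (\<lambda>h. h \<bullet> grad f (a + r *\<^sub>R y))) (at (a + r *\<^sub>R y))"
      using smooth_fun_gderiv[OF assms] by (simp add: gderiv_def)
  qed
  then show "GDERIV (\<lambda>y. f (a + r *\<^sub>R y)) y :> r *\<^sub>R grad f (a + r *\<^sub>R y)"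
    by (simp add: gderiv_def)
qed

lemma grad_bound_imp_Lipschitz:
  assumes "smooth_fun f" "convex S" "\<And>x. x \<in> S \<Longrightarrow> norm (grad f x) \<le> G" "x \<in> S" "y \<in> S"
  shows "\<bar>f x - f y\<bar> \<le> G * dist x y"
proof -
  have "norm (f x - f y) \<le> G * norm (x - y)"
  proof (rule differentiable_bound[OF assms(2)])
    fix z assume z: "z \<in> S"
    show "(f has_derivative (\<lambda>h. h \<bullet> grad f z)) (at z within S)"
      using smooth_fun_gderiv[OF assms(1), of z] has_derivative_at_withinI by (auto simp: gderiv_def)
    show "onorm (\<lambda>h. h \<bullet> grad f z) \<le> G"
    proof (rule onorm_le)
      fix h
      have "norm (h \<bullet> grad f z) \<le> norm h * norm (grad f z)" using Cauchy_Schwarz_ineq2 by auto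
      also have "\<dots> \<le> norm h * G" using assms(3)[OF z] by (intro mult_left_mono) auto
      finally show "norm (h \<bullet> grad f z) \<le> G * norm h" by (simp add: mult.commute)
    qed
  qed (use assms in auto)
  then show ?thesis by (simp add: dist_norm)
qed

section \<open>Inverse estimates\<close>

lemma compact_coefficient_box:
  "compact {c :: 'i \<Rightarrow> real. \<forall>i. c i \<in> (if i \<in> I then {-R..R} else {0})}"
proof -
  have "compactin (product_topology (\<lambda>i::'i. euclidean) UNIV)
          (PiE UNIV (\<lambda>i. if i \<in> I then {-R..R::real} else {0}))"
    unfolding compactin_PiE by auto
  then show ?thesis by (simp add: euclidean_product_topology PiE_def Pi_def)
qed

text \<open>The form has a positive minimum over the coefficient families of maximum norm one, which form
  a compact set; the rest is homogeneity.\<close>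

lemma quadratic_form_lower_bound:
  fixes G :: "'i \<Rightarrow> 'i \<Rightarrow> real"
  assumes I: "finite I"
    and pos: "\<And>c. \<exists>i\<in>I. c i \<noteq> 0 \<Longrightarrow> 0 < (\<Sum>i\<in>I. \<Sum>j\<in>I. c i * c j * G i j)"
  shows "\<exists>\<delta>>0. \<forall>c. \<forall>i\<in>I. \<delta> * (c i)\<^sup>2 \<le> (\<Sum>i\<in>I. \<Sum>j\<in>I. c i * c j * G i j)"
proof (cases "I = {}")
  case True then show ?thesis by (auto intro: exI[of _ 1])
next
  case False
  define N where "N c = (\<Sum>i\<in>I. \<Sum>j\<in>I. c i * c j * G i j)" for c
  define S where "S = {c. \<forall>i. c i \<in> (if i \<in> I then {-1..1} else {0})} \<inter> (\<Union>i\<in>I. {c :: 'i \<Rightarrow> real. \<bar>c i\<bar> = 1})"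
  have "compact S" unfolding S_def
    by (intro compact_Int_closed compact_coefficient_box closed_UN I ballI closed_Collect_eq continuous_intros
        continuous_on_product_coordinates)
  moreover have "continuous_on S N" unfolding N_def
    by (intro continuous_intros continuous_on_subset[OF continuous_on_product_coordinates]) auto
  moreover have "S \<noteq> {}"
  proof -
    obtain i where "i \<in> I" using False by auto
    then have "(\<lambda>j. if j = i then 1 else 0) \<in> S" by (auto simp: S_def)
    then show ?thesis by auto
  qed
  ultimately obtain a where a: "a \<in> S" "\<And>c. c \<in> S \<Longrightarrow> N a \<le> N c"
    using continuous_attains_inf[of S N] by auto
  have "\<exists>i\<in>I. a i \<noteq> 0" using a(1) by (auto simp: S_def intro!: bexI)
  then have "N a > 0" unfolding N_def by (rule pos)
  moreover have "N a * (c i)\<^sup>2 \<le> N c" if "i \<in> I" for c i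
  proof (cases "\<exists>i\<in>I. c i \<noteq> 0")
    case True
    define M where "M = Max ((\<lambda>i. \<bar>c i\<bar>) ` I)"
    have M: "\<bar>c j\<bar> \<le> M" if "j \<in> I" for j unfolding M_def using that I by auto
    have "M \<in> (\<lambda>i. \<bar>c i\<bar>) ` I" unfolding M_def using I False by (intro Max_in) auto
    then obtain k where k: "k \<in> I" "M = \<bar>c k\<bar>" by auto
    have "M > 0" using True M by force
    define b where "b j = (if j \<in> I then c j / M else 0)" for j
    have "b \<in> S" unfolding S_def b_def using M k \<open>M > 0\<close>
      by (auto simp: abs_le_iff field_simps intro!: bexI[of _ k] split: if_splits)
         (metis M abs_le_iff mult.commute neg_le_iff_le minus_le_iff)+
    then have "N a \<le> N b" by (rule a(2))
    also have "N b = N c / M\<^sup>2" unfolding N_def b_def sum_divide_distrib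
      by (intro sum.cong refl) (simp add: power2_eq_square)
    finally have "N a * M\<^sup>2 \<le> N c" using \<open>M > 0\<close> by (simp add: field_simps)
    moreover have "(c i)\<^sup>2 \<le> M\<^sup>2" using M[OF that] abs_le_square_iff[of "c i" M] \<open>M > 0\<close> by simp
    ultimately show ?thesis using \<open>N a > 0\<close> by (meson mult_left_mono less_imp_le order_trans)
  next
    case False
    then have "N c = 0" unfolding N_def by simp
    then show ?thesis using False that by simp
  qed
  ultimately show ?thesis unfolding N_def by (intro exI[of _ "N a"]) (auto simp: N_def)
qed

lemma set_integrable_continuous_on_compact:
  fixes f :: "real^'d \<Rightarrow> 'b::euclidean_space"
  assumes "compact S" "continuous_on S f"
  shows "set_integrable lborel S f"
  using borel_integrable_compact[OF assms] by (simp add: set_integrable_def indicator_scaleR_eq_if)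

lemma set_integral_finite_sum:
  fixes f :: "'i \<Rightarrow> 'a \<Rightarrow> real"
  assumes "\<And>i. i \<in> I \<Longrightarrow> set_integrable M S (f i)"
  shows "set_integrable M S (\<lambda>x. \<Sum>i\<in>I. f i x)"
    and "(LINT x:S|M. \<Sum>i\<in>I. f i x) = (\<Sum>i\<in>I. LINT x:S|M. f i x)"
  using assms unfolding set_integrable_def set_lebesgue_integral_def scaleR_sum_right
  by (auto intro: Bochner_Integration.integral_sum)

lemma set_integral_quadratic_form:
  fixes f :: "'i \<Rightarrow> 'i \<Rightarrow> 'a \<Rightarrow> real"
  assumes "\<And>i j. i \<in> I \<Longrightarrow> j \<in> I \<Longrightarrow> set_integrable M S (f i j)"
  shows "(LINT x:S|M. \<Sum>i\<in>I. \<Sum>j\<in>I. a i j * f i j x) = (\<Sum>i\<in>I. \<Sum>j\<in>I. a i j * (LINT x:S|M. f i j x))"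
proof -
  have "(LINT x:S|M. \<Sum>i\<in>I. \<Sum>j\<in>I. a i j * f i j x) = (\<Sum>i\<in>I. LINT x:S|M. \<Sum>j\<in>I. a i j * f i j x)"
    by (intro set_integral_finite_sum set_integrable_mult_right assms)
  also have "\<dots> = (\<Sum>i\<in>I. \<Sum>j\<in>I. LINT x:S|M. a i j * f i j x)"
    by (intro sum.cong refl set_integral_finite_sum set_integrable_mult_right assms)
  finally show ?thesis by simp
qed

lemma set_integral_mono_domain:
  fixes f :: "'a \<Rightarrow> real"
  assumes "set_integrable M A f" "set_integrable M B f" "A \<subseteq> B" "\<And>x. 0 \<le> f x"
  shows "(LINT x:A|M. f x) \<le> (LINT x:B|M. f x)"
  using assms unfolding set_integrable_def set_lebesgue_integral_def
  by (intro integral_mono) (auto simp: indicator_def)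

lemma set_integral_const_cball:
  "(LINT x:cball (a::real^'d) r|lborel. (k::real)) = measure lborel (cball a r) * k"
  using set_integral_const[of "cball a r" lborel k] emeasure_lborel_cball_finite[of a r] by simp

lemma set_integral_eq_0_imp_zero_on_ball:
  fixes f :: "real^'d \<Rightarrow> real"
  assumes "continuous_on UNIV f" "\<And>x. 0 \<le> f x" "(LINT x:cball 0 1|lborel. f x) = 0"
  shows "\<forall>x\<in>ball 0 1. f x = 0"
proof (rule ccontr)
  assume "\<not> ?thesis"
  then obtain a where a: "a \<in> ball 0 1" "f a > 0" using assms(2) by (metis less_eq_real_def)
  define U where "U = ball 0 1 \<inter> {x. f a / 2 < f x}"
  have "open U" unfolding U_def using assms(1) by (intro open_Int open_ball open_Collect_less) auto
  moreover have "a \<in> U" using a by (auto simp: U_def)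
  ultimately obtain e where e: "e > 0" "cball a e \<subseteq> U" using open_contains_cball by blast
  have int: "set_integrable lborel (cball a e) f" "set_integrable lborel (cball 0 1) f"
    by (intro set_integrable_continuous_on_compact compact_cball continuous_on_subset[OF assms(1)] subset_UNIV)+
  have "0 < f a / 2 * measure lborel (cball a e)" using a content_cball_pos[OF e(1), of a] by simp
  also have "\<dots> = (LINT x:cball a e|lborel. f a / 2)" by (simp add: set_integral_const_cball)
  also have "\<dots> \<le> (LINT x:cball a e|lborel. f x)"
    using int e(2) by (intro set_integral_mono) (auto simp: U_def set_integrable_continuous_on_compact)
  also have "\<dots> \<le> (LINT x:cball 0 1|lborel. f x)"
    using e(2) assms(2) by (intro set_integral_mono_domain int) (auto simp: U_def)
  finally show False using assms(3) by simp
qed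

lemma set_integral_cball_rescale:
  fixes f :: "real^'d \<Rightarrow> real"
  assumes "r > 0" "continuous_on UNIV f"
  shows "(LINT x:cball a r|lborel. f x) = r ^ CARD('d) * (LINT y:cball 0 1|lborel. f (a + r *\<^sub>R y))"
proof -
  let ?F = "\<lambda>x. indicat_real (cball a r) x *\<^sub>R f x"
  have [measurable]: "f \<in> borel_measurable borel" using assms(2) by (rule borel_measurable_continuous_onI)
  have "(LINT x|lborel. ?F x) = r ^ CARD('d) * (LINT y|lborel. ?F (a + r *\<^sub>R y))"
  proof -
    have [measurable]: "?F \<in> borel_measurable borel"
      by (intro borel_measurable_scaleR borel_measurable_indicator borel_closed closed_cball \<open>f \<in> borel_measurable borel\<close>)
    have "(LINT x|lborel. ?F x) = (LINT x|density (distr lborel borel (\<lambda>x. a + r *\<^sub>R x)) (\<lambda>_. \<bar>r\<bar> ^ DIM(real^'d)). ?F x)"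
      using lborel_affine[of r a] assms(1) by simp
    also have "\<dots> = (LINT x|distr lborel borel (\<lambda>x. a + r *\<^sub>R x). \<bar>r\<bar> ^ DIM(real^'d) *\<^sub>R ?F x)"
      using \<open>?F \<in> borel_measurable borel\<close> by (intro integral_density) auto
    also have "\<dots> = (LINT y|lborel. \<bar>r\<bar> ^ DIM(real^'d) *\<^sub>R ?F (a + r *\<^sub>R y))"
      using \<open>?F \<in> borel_measurable borel\<close> by (intro integral_distr) auto
    finally show ?thesis using assms(1) by simp
  qed
  also have "(\<lambda>y. ?F (a + r *\<^sub>R y)) = (\<lambda>y. indicat_real (cball 0 1) y *\<^sub>R f (a + r *\<^sub>R y))"
    using assms(1) by (intro ext) (auto simp: indicator_def dist_norm)
  finally show ?thesis by (simp add: set_lebesgue_integral_def)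
qed

text \<open>The squared \<open>L\<^sup>2\<close> norm over the unit ball is a quadratic form in the coefficients, and it is definite
  because a polynomial that vanishes on a ball has no nonzero coefficient. Any other norm can
  then be estimated coefficient by coefficient.\<close>

lemma coeffs_bounded_by_L2:
  "\<exists>\<delta>>0. \<forall>c. \<forall>\<alpha>\<in>multi_indices m. \<delta> * (c \<alpha>)\<^sup>2
      \<le> (LINT x:cball (0::real^'d) 1|lborel. (\<Sum>\<alpha>\<in>multi_indices m. c \<alpha> * monomial_fun \<alpha> x)\<^sup>2)"
proof -
  let ?G = "\<lambda>\<alpha> \<beta>. LINT x:cball (0::real^'d) 1|lborel. monomial_fun \<alpha> x * monomial_fun \<beta> x"
  have cont: "continuous_on S (monomial_fun \<alpha>)" for S :: "(real^'d) set" and \<alpha>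
    by (rule smooth_fun_continuous[OF smooth_fun_monomial])
  have N: "(LINT x:cball (0::real^'d) 1|lborel. (\<Sum>\<alpha>\<in>multi_indices m. c \<alpha> * monomial_fun \<alpha> x)\<^sup>2)
       = (\<Sum>\<alpha>\<in>multi_indices m. \<Sum>\<beta>\<in>multi_indices m. c \<alpha> * c \<beta> * ?G \<alpha> \<beta>)" for c
  proof -
    have "(LINT x:cball (0::real^'d) 1|lborel. (\<Sum>\<alpha>\<in>multi_indices m. c \<alpha> * monomial_fun \<alpha> x)\<^sup>2)
       = (LINT x:cball (0::real^'d) 1|lborel. \<Sum>\<alpha>\<in>multi_indices m. \<Sum>\<beta>\<in>multi_indices m.
            (c \<alpha> * c \<beta>) * (monomial_fun \<alpha> x * monomial_fun \<beta> x))"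
      by (simp add: power2_eq_square sum_product mult_ac)
    also have "\<dots> = (\<Sum>\<alpha>\<in>multi_indices m. \<Sum>\<beta>\<in>multi_indices m. c \<alpha> * c \<beta> * ?G \<alpha> \<beta>)"
      by (intro set_integral_quadratic_form set_integrable_continuous_on_compact continuous_intros cont compact_cball)
    finally show ?thesis .
  qed
  show ?thesis unfolding N
  proof (rule quadratic_form_lower_bound)
    fix c :: "('d \<Rightarrow> nat) \<Rightarrow> real" assume ex: "\<exists>\<alpha>\<in>multi_indices m. c \<alpha> \<noteq> 0"
    let ?q = "\<lambda>x. \<Sum>\<alpha>\<in>multi_indices m. c \<alpha> * monomial_fun \<alpha> x"
    have "0 \<le> (LINT x:cball (0::real^'d) 1|lborel. (?q x)\<^sup>2)"
      unfolding set_lebesgue_integral_def by (rule Bochner_Integration.integral_nonneg) simp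
    moreover have "(LINT x:cball (0::real^'d) 1|lborel. (?q x)\<^sup>2) \<noteq> 0"
    proof
      assume "(LINT x:cball (0::real^'d) 1|lborel. (?q x)\<^sup>2) = 0"
      then have "\<forall>x\<in>ball 0 1. (?q x)\<^sup>2 = 0"
        by (intro set_integral_eq_0_imp_zero_on_ball) (auto intro!: continuous_intros cont)
      then have "c \<alpha> = 0" if "\<alpha> \<in> multi_indices m" for \<alpha>
        using poly_vanishing_on_open_coeffs[OF open_ball _ _ that, of 0 1 c] by auto
      with ex show False by blast
    qed
    ultimately show "0 < (\<Sum>\<alpha>\<in>multi_indices m. \<Sum>\<beta>\<in>multi_indices m. c \<alpha> * c \<beta> * ?G \<alpha> \<beta>)"
      unfolding N[symmetric] by simp
  qed simp
qed

text \<open>A polynomial with vanishing gradient on the ball is constant there, so the form is definite once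
  the constant coefficient is left out.\<close>

lemma coeffs_bounded_by_gradient_L2:
  "\<exists>\<delta>>0. \<forall>c. \<forall>\<alpha>\<in>multi_indices m - {\<lambda>_. 0}. \<delta> * (c \<alpha>)\<^sup>2
      \<le> (LINT x:cball (0::real^'d) 1|lborel.
           (norm (\<Sum>\<alpha>\<in>multi_indices m - {\<lambda>_. 0}. c \<alpha> *\<^sub>R grad (monomial_fun \<alpha>) x))\<^sup>2)"
proof -
  let ?I = "multi_indices m - {\<lambda>_. 0} :: ('d \<Rightarrow> nat) set"
  let ?G = "\<lambda>\<alpha> \<beta>. LINT x:cball (0::real^'d) 1|lborel. grad (monomial_fun \<alpha>) x \<bullet> grad (monomial_fun \<beta>) x"
  have cont: "continuous_on S (grad (monomial_fun \<alpha>))" for S :: "(real^'d) set" and \<alpha>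
    by (rule smooth_fun_continuous_grad[OF smooth_fun_monomial])
  have N: "(LINT x:cball (0::real^'d) 1|lborel. (norm (\<Sum>\<alpha>\<in>?I. c \<alpha> *\<^sub>R grad (monomial_fun \<alpha>) x))\<^sup>2)
       = (\<Sum>\<alpha>\<in>?I. \<Sum>\<beta>\<in>?I. c \<alpha> * c \<beta> * ?G \<alpha> \<beta>)" for c
  proof -
    have "(LINT x:cball (0::real^'d) 1|lborel. (norm (\<Sum>\<alpha>\<in>?I. c \<alpha> *\<^sub>R grad (monomial_fun \<alpha>) x))\<^sup>2)
       = (LINT x:cball (0::real^'d) 1|lborel. \<Sum>\<alpha>\<in>?I. \<Sum>\<beta>\<in>?I.
            (c \<alpha> * c \<beta>) * (grad (monomial_fun \<alpha>) x \<bullet> grad (monomial_fun \<beta>) x))"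
      by (simp add: power2_norm_eq_inner inner_sum_left inner_sum_right sum_distrib_left mult_ac inner_commute)
    also have "\<dots> = (\<Sum>\<alpha>\<in>?I. \<Sum>\<beta>\<in>?I. c \<alpha> * c \<beta> * ?G \<alpha> \<beta>)"
      by (intro set_integral_quadratic_form set_integrable_continuous_on_compact continuous_intros cont compact_cball)
    finally show ?thesis .
  qed
  show ?thesis unfolding N
  proof (rule quadratic_form_lower_bound)
    fix c :: "('d \<Rightarrow> nat) \<Rightarrow> real" assume ex: "\<exists>\<alpha>\<in>?I. c \<alpha> \<noteq> 0"
    let ?q = "\<lambda>x. \<Sum>\<alpha>\<in>?I. c \<alpha> * monomial_fun \<alpha> x"
    have sm: "smooth_fun ?q" by (intro smooth_fun_sum smooth_fun_mult smooth_fun_const smooth_fun_monomial)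
    have gr: "grad ?q x = (\<Sum>\<alpha>\<in>?I. c \<alpha> *\<^sub>R grad (monomial_fun \<alpha>) x)" for x by (rule grad_poly)
    have "0 \<le> (LINT x:cball (0::real^'d) 1|lborel. (norm (grad ?q x))\<^sup>2)"
      unfolding set_lebesgue_integral_def by (rule Bochner_Integration.integral_nonneg) simp
    moreover have "(LINT x:cball (0::real^'d) 1|lborel. (norm (grad ?q x))\<^sup>2) \<noteq> 0"
    proof
      assume "(LINT x:cball (0::real^'d) 1|lborel. (norm (grad ?q x))\<^sup>2) = 0"
      then have g0: "\<forall>x\<in>ball 0 1. (norm (grad ?q x))\<^sup>2 = 0"
        by (intro set_integral_eq_0_imp_zero_on_ball)
           (auto intro!: continuous_intros smooth_fun_continuous_grad[OF sm])
      \<comment> \<open>the coefficients of \<open>?q - ?q 0\<close>, which vanishes on the ball\<close>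
      define d where "d \<alpha> = (if \<alpha> = (\<lambda>_. 0) then - ?q 0 else c \<alpha>)" for \<alpha>
      have "\<bar>?q x - ?q 0\<bar> \<le> 0 * dist x 0" if "x \<in> ball 0 1" for x
        by (rule grad_bound_imp_Lipschitz[OF sm convex_ball[of 0 1]]) (use g0 that in auto)
      then have "(\<Sum>\<alpha>\<in>multi_indices m. d \<alpha> * monomial_fun \<alpha> x) = 0" if "x \<in> ball 0 1" for x
      proof -
        have "(\<lambda>_. 0) \<in> (multi_indices m :: ('d \<Rightarrow> nat) set)" by (simp add: multi_indices_def)
        then have "(\<Sum>\<alpha>\<in>multi_indices m. d \<alpha> * monomial_fun \<alpha> x)
            = d (\<lambda>_. 0) * monomial_fun (\<lambda>_. 0) x + (\<Sum>\<alpha>\<in>?I. d \<alpha> * monomial_fun \<alpha> x)"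
          by (rule sum.remove[OF finite_multi_indices_set])
        also have "(\<Sum>\<alpha>\<in>?I. d \<alpha> * monomial_fun \<alpha> x) = ?q x" by (intro sum.cong) (auto simp: d_def)
        also have "d (\<lambda>_. 0) * monomial_fun (\<lambda>_. 0) x = - ?q 0" by (simp add: d_def monomial_fun_def)
        finally show ?thesis using \<open>x \<in> ball 0 1 \<Longrightarrow> \<bar>?q x - ?q 0\<bar> \<le> 0 * dist x 0\<close>[OF that] by simp
      qed
      then have "d \<alpha> = 0" if "\<alpha> \<in> multi_indices m" for \<alpha>
        using poly_vanishing_on_open_coeffs[OF open_ball _ _ that, of 0 1 d] by auto
      moreover obtain \<alpha> where "\<alpha> \<in> multi_indices m" "\<alpha> \<noteq> (\<lambda>_. 0)" "c \<alpha> \<noteq> 0" using ex by blast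
      ultimately show False unfolding d_def by metis
    qed
    ultimately show "0 < (\<Sum>\<alpha>\<in>?I. \<Sum>\<beta>\<in>?I. c \<alpha> * c \<beta> * ?G \<alpha> \<beta>)"
      unfolding N[symmetric] gr by simp
  qed simp
qed

lemma grad_monomials_bounded:
  "\<exists>B\<ge>0. \<forall>\<alpha>\<in>multi_indices m. \<forall>x\<in>cball (0::real^'d) \<kappa>. norm (grad (monomial_fun \<alpha>) x) \<le> B"
proof -
  have "bounded (\<Union>\<alpha>\<in>multi_indices m. grad (monomial_fun \<alpha>) ` cball (0::real^'d) \<kappa>)"
    by (intro bounded_UN ballI compact_imp_bounded compact_continuous_image compact_cball
        smooth_fun_continuous_grad[OF smooth_fun_monomial]) simp
  then obtain B where "\<forall>x\<in>(\<Union>\<alpha>\<in>multi_indices m. grad (monomial_fun \<alpha>) ` cball (0::real^'d) \<kappa>). norm x \<le> B"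
    by (auto simp: bounded_iff)
  then show ?thesis by (intro exI[of _ "max B 0"]) force
qed

text \<open>Both inverse estimates compare a ball inscribed in an element with a concentric ball that
  contains it; rescaling to the unit ball makes the constants depend on the shape ratio \<open>\<kappa>\<close> only.\<close>

lemma grad_le_sup_on_ball:
  "\<exists>C>0. \<forall>p\<in>poly_space m. \<forall>a r M. 0 < r \<longrightarrow> (\<forall>x\<in>cball a r. \<bar>p x\<bar> \<le> M) \<longrightarrow>
     (\<forall>x\<in>cball (a::real^'d) (\<kappa> * r). norm (grad p x) \<le> C * M / r)"
proof -
  obtain \<delta> where \<delta>: "\<delta> > 0" "\<And>c \<alpha>. \<alpha>\<in>multi_indices m \<Longrightarrow> \<delta> * (c \<alpha>)\<^sup>2
      \<le> (LINT x:cball (0::real^'d) 1|lborel. (\<Sum>\<alpha>\<in>multi_indices m. c \<alpha> * monomial_fun \<alpha> x)\<^sup>2)"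
    using coeffs_bounded_by_L2[where 'd='d and m=m] by blast
  obtain B where B: "B \<ge> 0" "\<And>\<alpha> x. \<alpha>\<in>multi_indices m \<Longrightarrow> x \<in> cball (0::real^'d) \<kappa> \<Longrightarrow> norm (grad (monomial_fun \<alpha>) x) \<le> B"
    using grad_monomials_bounded[where 'd='d and m=m and \<kappa>=\<kappa>] by blast
  define V where "V = measure lborel (cball (0::real^'d) 1)"
  define n where "n = real (card (multi_indices m :: ('d \<Rightarrow> nat) set))"
  have "V \<ge> 0" by (simp add: V_def)
  define C where "C = n * (sqrt (V / \<delta>) * B) + 1"
  have "C > 0" unfolding C_def n_def using \<open>V \<ge> 0\<close> \<delta> B by (intro add_nonneg_pos) auto
  moreover have "norm (grad p x) \<le> C * M / r"
    if p: "p \<in> poly_space m" and r: "0 < r" and M: "\<forall>x\<in>cball a r. \<bar>p x\<bar> \<le> M" and x: "x \<in> cball a (\<kappa> * r)"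
    for p :: "real^'d \<Rightarrow> real" and a r M x
  proof -
    define q where "q y = p (a + r *\<^sub>R y)" for y
    have "M \<ge> 0" using M r by (metis abs_ge_zero centre_in_cball less_imp_le order_trans)
    have "q \<in> poly_space m" unfolding q_def by (rule poly_space_affine_rescale[OF p])
    then obtain c where c: "q = (\<lambda>y. \<Sum>\<alpha>\<in>multi_indices m. c \<alpha> * monomial_fun \<alpha> y)" by (auto simp: poly_space_iff)
    have "(LINT y:cball (0::real^'d) 1|lborel. (q y)\<^sup>2) \<le> (LINT y:cball (0::real^'d) 1|lborel. M\<^sup>2)"
    proof (rule set_integral_mono)
      show "set_integrable lborel (cball 0 1) (\<lambda>y. (q y)\<^sup>2)"
        by (intro set_integrable_continuous_on_compact continuous_intros smooth_fun_continuous
            smooth_fun_poly[OF \<open>q \<in> poly_space m\<close>] compact_cball)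
      show "set_integrable lborel (cball (0::real^'d) 1) (\<lambda>y. M\<^sup>2)"
        by (intro set_integrable_continuous_on_compact continuous_intros compact_cball)
      show "(q y)\<^sup>2 \<le> M\<^sup>2" if "y \<in> cball 0 1" for y
      proof -
        have "a + r *\<^sub>R y \<in> cball a r" using that r by (simp add: dist_norm)
        then show ?thesis using M abs_le_square_iff[of "q y" M] \<open>M \<ge> 0\<close> by (auto simp: q_def)
      qed
    qed
    also have "\<dots> = M\<^sup>2 * V" by (simp add: set_integral_const_cball V_def)
    finally have qM: "(LINT y:cball (0::real^'d) 1|lborel. (q y)\<^sup>2) \<le> M\<^sup>2 * V" .
    have ca: "\<bar>c \<alpha>\<bar> \<le> sqrt (V / \<delta>) * M" if "\<alpha> \<in> multi_indices m" for \<alpha>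
    proof -
      have "\<delta> * (c \<alpha>)\<^sup>2 \<le> M\<^sup>2 * V" using \<delta>(2)[OF that, of c] qM unfolding c by linarith
      then have "(c \<alpha>)\<^sup>2 \<le> V / \<delta> * M\<^sup>2" using \<delta>(1) by (simp add: field_simps)
      then have "sqrt ((c \<alpha>)\<^sup>2) \<le> sqrt (V / \<delta> * M\<^sup>2)" by (rule real_sqrt_le_mono)
      also have "sqrt (V / \<delta> * M\<^sup>2) = sqrt (V / \<delta>) * M" using \<open>M \<ge> 0\<close> by (simp only: real_sqrt_mult real_sqrt_abs abs_of_nonneg)
      finally show ?thesis by simp
    qed
    define y where "y = (x - a) /\<^sub>R r"
    have xy: "x = a + r *\<^sub>R y" using r by (simp add: y_def)
    have "norm y = norm (x - a) / r" using r by (simp add: y_def divide_inverse mult.commute)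
    then have "y \<in> cball 0 \<kappa>" using x r by (simp add: dist_norm norm_minus_commute divide_le_eq)
    have "norm (grad q y) \<le> (\<Sum>\<alpha>\<in>(multi_indices m :: ('d \<Rightarrow> nat) set). sqrt (V / \<delta>) * M * B)"
      unfolding c grad_poly
    proof (rule sum_norm_le)
      fix \<alpha> :: "'d \<Rightarrow> nat" assume "\<alpha> \<in> multi_indices m"
      then show "norm (c \<alpha> *\<^sub>R grad (monomial_fun \<alpha>) y) \<le> sqrt (V / \<delta>) * M * B"
        using ca B(2)[OF _ \<open>y \<in> cball 0 \<kappa>\<close>] \<open>M \<ge> 0\<close> \<open>V \<ge> 0\<close> \<delta>(1) by (auto intro!: mult_mono)
    qed
    also have "\<dots> = n * (sqrt (V / \<delta>) * B) * M" by (simp add: n_def)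
    also have "\<dots> \<le> C * M" unfolding C_def using \<open>M \<ge> 0\<close> by (intro mult_right_mono) auto
    finally have "norm (grad q y) \<le> C * M" .
    moreover have "grad q y = r *\<^sub>R grad p x"
      unfolding q_def xy by (rule grad_affine_rescale[OF smooth_fun_poly[OF p]])
    ultimately show ?thesis using r by (simp add: field_simps)
  qed
  ultimately show ?thesis by blast
qed

lemma grad_le_L2_on_ball:
  "\<exists>C>0. \<forall>p\<in>poly_space m. \<forall>a r. 0 < r \<longrightarrow>
     (\<forall>x\<in>cball (a::real^'d) (\<kappa> * r).
        r ^ CARD('d) * (norm (grad p x))\<^sup>2 \<le> C * (LINT y:cball a r|lborel. (norm (grad p y))\<^sup>2))"
proof -
  let ?I = "multi_indices m - {\<lambda>_. 0} :: ('d \<Rightarrow> nat) set"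
  obtain \<delta> where \<delta>: "\<delta> > 0" "\<And>c \<alpha>. \<alpha>\<in>?I \<Longrightarrow> \<delta> * (c \<alpha>)\<^sup>2
      \<le> (LINT x:cball (0::real^'d) 1|lborel. (norm (\<Sum>\<alpha>\<in>?I. c \<alpha> *\<^sub>R grad (monomial_fun \<alpha>) x))\<^sup>2)"
    using coeffs_bounded_by_gradient_L2[where 'd='d and m=m] by blast
  obtain B where B: "B \<ge> 0" "\<And>\<alpha> x. \<alpha>\<in>multi_indices m \<Longrightarrow> x \<in> cball (0::real^'d) \<kappa> \<Longrightarrow> norm (grad (monomial_fun \<alpha>) x) \<le> B"
    using grad_monomials_bounded[where 'd='d and m=m and \<kappa>=\<kappa>] by blast
  define n where "n = real (card ?I)"
  define C where "C = (n * B)\<^sup>2 / \<delta> + 1"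
  have "C > 0" unfolding C_def using \<delta> by (intro add_nonneg_pos) auto
  moreover have "r ^ CARD('d) * (norm (grad p x))\<^sup>2 \<le> C * (LINT y:cball a r|lborel. (norm (grad p y))\<^sup>2)"
    if p: "p \<in> poly_space m" and r: "0 < r" and x: "x \<in> cball a (\<kappa> * r)" for p :: "real^'d \<Rightarrow> real" and a r x
  proof -
    define q where "q y = p (a + r *\<^sub>R y)" for y
    have smp: "smooth_fun p" by (rule smooth_fun_poly[OF p])
    have gq: "grad q y = r *\<^sub>R grad p (a + r *\<^sub>R y)" for y
      unfolding q_def by (rule grad_affine_rescale[OF smp])
    have "q \<in> poly_space m" unfolding q_def by (rule poly_space_affine_rescale[OF p])
    then obtain c where c: "q = (\<lambda>y. \<Sum>\<alpha>\<in>multi_indices m. c \<alpha> * monomial_fun \<alpha> y)" by (auto simp: poly_space_iff)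
    have m0: "monomial_fun (\<lambda>_. 0) = (\<lambda>x::real^'d. 1)" by (auto simp: monomial_fun_def)
    have gc: "grad q y = (\<Sum>\<alpha>\<in>?I. c \<alpha> *\<^sub>R grad (monomial_fun \<alpha>) y)" for y
      unfolding c grad_poly by (rule sum.mono_neutral_right) (auto simp: m0 grad_const)
    define E where "E = (LINT y:cball (0::real^'d) 1|lborel. (norm (grad q y))\<^sup>2)"
    have ca: "\<bar>c \<alpha>\<bar> \<le> sqrt (E / \<delta>)" if "\<alpha> \<in> ?I" for \<alpha>
    proof -
      have "(c \<alpha>)\<^sup>2 \<le> E / \<delta>" using \<delta>(2)[OF that, of c] \<delta>(1) unfolding E_def gc by (simp add: field_simps)
      then show ?thesis using real_le_rsqrt by fastforce
    qed
    have "E \<ge> 0" unfolding E_def set_lebesgue_integral_def by (rule Bochner_Integration.integral_nonneg) simp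
    define y where "y = (x - a) /\<^sub>R r"
    have xy: "x = a + r *\<^sub>R y" using r by (simp add: y_def)
    have "norm y = norm (x - a) / r" using r by (simp add: y_def divide_inverse mult.commute)
    then have "y \<in> cball 0 \<kappa>" using x r by (simp add: dist_norm norm_minus_commute divide_le_eq)
    have "norm (grad q y) \<le> (\<Sum>\<alpha>\<in>?I. sqrt (E / \<delta>) * B)"
      unfolding gc
    proof (rule sum_norm_le)
      fix \<alpha> :: "'d \<Rightarrow> nat" assume "\<alpha> \<in> ?I"
      then show "norm (c \<alpha> *\<^sub>R grad (monomial_fun \<alpha>) y) \<le> sqrt (E / \<delta>) * B"
        using ca[OF \<open>\<alpha> \<in> ?I\<close>] B(2)[OF _ \<open>y \<in> cball 0 \<kappa>\<close>, of \<alpha>] \<open>E \<ge> 0\<close> \<delta>(1) by (auto intro!: mult_mono)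
    qed
    also have "\<dots> = (n * B) * sqrt (E / \<delta>)" by (simp add: n_def)
    finally have "(norm (grad q y))\<^sup>2 \<le> ((n * B) * sqrt (E / \<delta>))\<^sup>2" by (rule power_mono) simp
    also have "\<dots> = (n * B)\<^sup>2 / \<delta> * E" using \<open>E \<ge> 0\<close> \<delta>(1) by (simp add: power_mult_distrib)
    also have "\<dots> \<le> C * E" unfolding C_def using \<open>E \<ge> 0\<close> by (intro mult_right_mono) auto
    finally have 1: "(norm (grad q y))\<^sup>2 \<le> C * E" .
    have "(norm (grad q y))\<^sup>2 = r\<^sup>2 * (norm (grad p x))\<^sup>2" using r by (simp add: gq xy[symmetric] power_mult_distrib)
    moreover have "E = r\<^sup>2 * (LINT y:cball (0::real^'d) 1|lborel. (norm (grad p (a + r *\<^sub>R y)))\<^sup>2)"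
      unfolding E_def gq using r by (simp add: power_mult_distrib)
    ultimately have "(norm (grad p x))\<^sup>2 \<le> C * (LINT y:cball (0::real^'d) 1|lborel. (norm (grad p (a + r *\<^sub>R y)))\<^sup>2)"
      using 1 r by (simp add: mult.left_commute)
    then have "r ^ CARD('d) * (norm (grad p x))\<^sup>2
        \<le> r ^ CARD('d) * (C * (LINT y:cball (0::real^'d) 1|lborel. (norm (grad p (a + r *\<^sub>R y)))\<^sup>2))"
      using r by (intro mult_left_mono) auto
    also have "\<dots> = C * (LINT y:cball a r|lborel. (norm (grad p y))\<^sup>2)"
      by (subst set_integral_cball_rescale[OF r])
         (auto intro!: continuous_intros smooth_fun_continuous_grad[OF smp])
    finally show ?thesis .
  qed
  ultimately show ?thesis by blast
qed

section \<open>Simplices and barycentric coordinates\<close>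

definition vertices :: "(real^'d) set \<Rightarrow> (real^'d) set" where
  "vertices K = {v. v extreme_point_of K}"

abbreviation full_simplex :: "(real^'d) set \<Rightarrow> bool" where
  "full_simplex K \<equiv> int CARD('d) simplex K"

lemma full_simplex_vertices:
  fixes K :: "(real^'d) set"
  assumes "full_simplex K"
  shows "finite (vertices K)" "\<not> affine_dependent (vertices K)" "card (vertices K) = CARD('d) + 1"
    "K = convex hull (vertices K)"
proof -
  obtain C where C: "\<not> affine_dependent C" "int (card C) = int CARD('d) + 1" "K = convex hull C"
    using assms by (auto simp: simplex_def)
  have "vertices K = C"
    unfolding vertices_def C(3) using extreme_point_of_convex_hull_affine_independent[OF C(1)] by auto
  then show "finite (vertices K)" "\<not> affine_dependent (vertices K)" "card (vertices K) = CARD('d) + 1"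
    "K = convex hull (vertices K)" using C aff_independent_finite by auto
qed

text \<open>The edges from a vertex \<open>w \<noteq> v\<close> are independent, so a linear functional can be prescribed on
  them: one on the edge to \<open>v\<close> and zero on the others.\<close>

lemma exists_barycentric_functional:
  fixes C :: "(real^'d) set"
  assumes "\<not> affine_dependent C" "v \<in> C"
  shows "\<exists>g t. \<forall>z\<in>C. g \<bullet> z + t = (if z = v then 1 else 0)"
proof (cases "C = {v}")
  case True then show ?thesis by (intro exI[of _ 0] exI[of _ 1]) auto
next
  case False
  then obtain w where w: "w \<in> C" "w \<noteq> v" using assms by auto
  let ?B = "(\<lambda>x. - w + x) ` (C - {w})"
  have "independent ?B" using assms(1) affine_dependent_iff_dependent2[OF w(1)] by simp
  then obtain f :: "real^'d \<Rightarrow> real" where f: "linear f" "\<forall>x\<in>?B. f x = (if x = - w + v then 1 else 0)"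
    using linear_independent_extend[of ?B "\<lambda>x. if x = - w + v then 1 else 0"] by blast
  obtain g where g: "\<And>x. f x = g \<bullet> x"
    using f(1) by (metis adjoint_works inner_commute inner_real_def mult.right_neutral)
  have "g \<bullet> z + - (g \<bullet> w) = (if z = v then 1 else 0)" if "z \<in> C" for z
  proof (cases "z = w")
    case True then show ?thesis using w by auto
  next
    case False
    then have "- w + z \<in> ?B" using that by auto
    then have "g \<bullet> (- w + z) = (if z = v then 1 else 0)" using f(2) unfolding g by fastforce
    then show ?thesis by (simp add: inner_diff_right split: if_splits)
  qed
  then show ?thesis by blast
qed

text \<open>The barycentric coordinate of \<open>v\<close> is the affine function that is one at \<open>v\<close> and zero at the other
  vertices. The norm of its gradient is the reciprocal of the height of the simplex over the facet
  opposite \<open>v\<close>, and its offset is its value at the origin.\<close>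

definition bary_grad :: "(real^'d) set \<Rightarrow> real^'d \<Rightarrow> real^'d" where
  "bary_grad K v = fst (SOME gt. \<forall>z\<in>vertices K. fst gt \<bullet> z + snd gt = (if z = v then 1 else (0::real)))"

definition bary_offset :: "(real^'d) set \<Rightarrow> real^'d \<Rightarrow> real" where
  "bary_offset K v = snd (SOME gt. \<forall>z\<in>vertices K. fst gt \<bullet> z + snd gt = (if z = v then 1 else (0::real)))"

definition bary_coord :: "(real^'d) set \<Rightarrow> real^'d \<Rightarrow> real^'d \<Rightarrow> real" where
  "bary_coord K v x = bary_grad K v \<bullet> x + bary_offset K v"

definition opposite_facet :: "(real^'d) set \<Rightarrow> real^'d \<Rightarrow> (real^'d) set" where
  "opposite_facet K v = convex hull (vertices K - {v})"

lemma bary_coord_vertex: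
  assumes "full_simplex K" "v \<in> vertices K" "z \<in> vertices K"
  shows "bary_coord K v z = (if z = v then 1 else 0)"
proof -
  let ?P = "\<lambda>gt. \<forall>z\<in>vertices K. fst gt \<bullet> z + snd gt = (if z = v then 1 else (0::real))"
  obtain g t where "?P (g, t)"
    using exists_barycentric_functional[OF full_simplex_vertices(2)[OF assms(1)] assms(2)] by auto
  then have "?P (SOME gt. ?P gt)" by (rule someI)
  then show ?thesis using assms(3) unfolding bary_coord_def bary_grad_def bary_offset_def by blast
qed

lemma affine_combination_of_vertices:
  fixes K :: "(real^'d) set"
  assumes "full_simplex K"
  shows "\<exists>u. sum u (vertices K) = 1 \<and> (\<Sum>v\<in>vertices K. u v *\<^sub>R v) = x"
proof -
  note V = full_simplex_vertices[OF assms]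
  have "aff_dim (vertices K) = int CARD('d)"
    using aff_dim_affine_independent[OF V(2)] V(3) by simp
  then have "affine hull (vertices K) = UNIV"
    by (simp add: aff_dim_eq_full[symmetric])
  then show ?thesis unfolding affine_hull_finite[OF V(1)] by blast
qed

lemma affine_functional_combination:
  fixes g :: "real^'d"
  assumes "sum u V = 1"
  shows "g \<bullet> (\<Sum>v\<in>V. u v *\<^sub>R v) + t = (\<Sum>v\<in>V. u v * (g \<bullet> v + t))"
  using assms by (simp add: inner_sum_right distrib_left sum.distrib flip: sum_distrib_right)

lemma affine_functional_determined_by_vertices:
  assumes "full_simplex K" "\<And>z. z \<in> vertices K \<Longrightarrow> g \<bullet> z + t = g' \<bullet> z + t'"
  shows "g = g'" "t = t'"
proof -
  have eq: "g \<bullet> x + t = g' \<bullet> x + t'" for x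
  proof -
    obtain u where u: "sum u (vertices K) = 1" "(\<Sum>v\<in>vertices K. u v *\<^sub>R v) = x"
      using affine_combination_of_vertices[OF assms(1)] by blast
    show ?thesis using affine_functional_combination[OF u(1)] u(2) assms(2) by (metis (mono_tags, lifting) sum.cong)
  qed
  from eq[of 0] show t: "t = t'" by simp
  have "(g - g') \<bullet> (g - g') = 0" using eq[of "g - g'"] t by (simp add: inner_diff_left)
  then show "g = g'" by simp
qed

lemma bary_coord_affine_combination:
  assumes "full_simplex K" "v \<in> vertices K" "sum u (vertices K) = 1"
  shows "bary_coord K v (\<Sum>z\<in>vertices K. u z *\<^sub>R z) = u v"
proof -
  have "bary_coord K v (\<Sum>z\<in>vertices K. u z *\<^sub>R z) = (\<Sum>z\<in>vertices K. u z * bary_coord K v z)"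
    unfolding bary_coord_def by (rule affine_functional_combination[OF assms(3)])
  also have "\<dots> = (\<Sum>z\<in>vertices K. if z = v then u z else 0)"
    using bary_coord_vertex[OF assms(1,2)] by (intro sum.cong) auto
  also have "\<dots> = u v" using assms(2) full_simplex_vertices(1)[OF assms(1)] by simp
  finally show ?thesis .
qed

lemma bary_coord_representation:
  assumes "full_simplex K"
  shows "(\<Sum>v\<in>vertices K. bary_coord K v x) = 1" "(\<Sum>v\<in>vertices K. bary_coord K v x *\<^sub>R v) = x"
proof -
  obtain u where u: "sum u (vertices K) = 1" "(\<Sum>v\<in>vertices K. u v *\<^sub>R v) = x"
    using affine_combination_of_vertices[OF assms(1)] by blast
  then have "bary_coord K v x = u v" if "v \<in> vertices K" for v
    using bary_coord_affine_combination[OF assms that u(1)] by simp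
  then show "(\<Sum>v\<in>vertices K. bary_coord K v x) = 1" "(\<Sum>v\<in>vertices K. bary_coord K v x *\<^sub>R v) = x"
    using u by (simp_all cong: sum.cong)
qed

lemma bary_offset_sum:
  "full_simplex K \<Longrightarrow> (\<Sum>v\<in>vertices K. bary_offset K v) = 1"
  using bary_coord_representation(1)[of K 0] by (simp add: bary_coord_def)

lemma mem_simplex_iff:
  assumes "full_simplex K"
  shows "x \<in> K \<longleftrightarrow> (\<forall>v\<in>vertices K. 0 \<le> bary_coord K v x)"
proof -
  note V = full_simplex_vertices[OF assms]
  have K: "x \<in> K \<longleftrightarrow> (\<exists>u. (\<forall>x\<in>vertices K. 0 \<le> u x) \<and> sum u (vertices K) = 1 \<and> (\<Sum>v\<in>vertices K. u v *\<^sub>R v) = x)"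
    by (subst V(4)) (simp add: convex_hull_finite[OF V(1)])
  show ?thesis
  proof
    assume "x \<in> K"
    then obtain u where u: "\<forall>x\<in>vertices K. 0 \<le> u x" "sum u (vertices K) = 1" "(\<Sum>v\<in>vertices K. u v *\<^sub>R v) = x"
      unfolding K by blast
    show "\<forall>v\<in>vertices K. 0 \<le> bary_coord K v x"
      using bary_coord_affine_combination[OF assms _ u(2)] u(1,3) by simp
  next
    assume "\<forall>v\<in>vertices K. 0 \<le> bary_coord K v x" then show "x \<in> K"
      unfolding K using bary_coord_representation[OF assms, of x] by (intro exI[of _ "\<lambda>v. bary_coord K v x"] conjI)
  qed
qed

lemma bary_coord_le_1:
  assumes "full_simplex K" "x \<in> K" "v \<in> vertices K"
  shows "bary_coord K v x \<le> 1"
proof -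
  have "bary_coord K v x \<le> (\<Sum>v\<in>vertices K. bary_coord K v x)"
    by (rule member_le_sum) (use assms full_simplex_vertices(1) mem_simplex_iff in auto)
  then show ?thesis using bary_coord_representation(1)[OF assms(1)] by simp
qed

lemma continuous_on_bary_coord: "continuous_on S (bary_coord K v)"
  unfolding bary_coord_def[abs_def] by (intro continuous_intros)

lemma open_bary_positive:
  assumes "finite V" shows "open {x. \<forall>v\<in>V. 0 < bary_coord K v x}"
proof -
  have "{x. \<forall>v\<in>V. 0 < bary_coord K v x} = (\<Inter>v\<in>V. {x. 0 < bary_coord K v x})" by auto
  then show ?thesis using assms
    by (auto intro!: open_INT open_Collect_less continuous_on_bary_coord continuous_intros)
qed

lemma bary_positive_imp_interior:
  assumes "full_simplex K" "\<And>v. v \<in> vertices K \<Longrightarrow> 0 < bary_coord K v x"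
  shows "x \<in> interior K"
proof (rule interiorI)
  show "open {x. \<forall>v\<in>vertices K. 0 < bary_coord K v x}"
    by (rule open_bary_positive[OF full_simplex_vertices(1)[OF assms(1)]])
  show "{x. \<forall>v\<in>vertices K. 0 < bary_coord K v x} \<subseteq> K"
    using mem_simplex_iff[OF assms(1)] by (auto intro: less_imp_le)
qed (use assms in auto)

lemma simplex_compact_convex:
  assumes "full_simplex K" shows "compact K" "convex K" "K \<noteq> {}" "closed K"
proof -
  note V = full_simplex_vertices[OF assms]
  show "compact K" by (subst V(4)) (rule finite_imp_compact_convex_hull[OF V(1)])
  then show "closed K" by (rule compact_imp_closed)
  show "convex K" by (subst V(4)) (rule convex_convex_hull)
  have "vertices K \<noteq> {}" using V(3) by auto
  then show "K \<noteq> {}" by (subst V(4)) simp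
qed

lemma vertices_subset: "full_simplex K \<Longrightarrow> vertices K \<subseteq> K"
  using full_simplex_vertices(4) hull_subset by metis

lemma barycenter_eq: "barycenter K = (\<Sum>v\<in>vertices K. (1 / real (card (vertices K))) *\<^sub>R v)"
  by (simp add: barycenter_def vertices_def scaleR_sum_right Let_def)

lemma barycenter_in_interior:
  fixes K :: "(real^'d) set"
  assumes "full_simplex K" shows "barycenter K \<in> interior K"
proof (rule bary_positive_imp_interior[OF assms])
  fix v assume v: "v \<in> vertices K"
  have "bary_coord K v (barycenter K) = 1 / real (card (vertices K))" unfolding barycenter_eq
    using full_simplex_vertices(3)[OF assms] by (intro bary_coord_affine_combination[OF assms v]) simp
  then show "0 < bary_coord K v (barycenter K)" using full_simplex_vertices(3)[OF assms] by simp
qed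

lemma barycenter_in_simplex: "full_simplex K \<Longrightarrow> barycenter K \<in> K"
  using barycenter_in_interior interior_subset by blast

lemma facet_of_simplex_iff:
  fixes K :: "(real^'d) set"
  assumes "full_simplex K"
  shows "e facet_of K \<longleftrightarrow> (\<exists>v\<in>vertices K. e = opposite_facet K v)"
proof -
  note V = full_simplex_vertices[OF assms]
  have ne: "opposite_facet K v \<noteq> {}" for v
  proof
    assume "opposite_facet K v = {}"
    then have "vertices K \<subseteq> {v}" by (auto simp: opposite_facet_def)
    then have "card (vertices K) \<le> 1" using card_mono[of "{v}" "vertices K"] by simp
    then show False using V(3) by simp
  qed
  have "e facet_of K \<longleftrightarrow> e \<noteq> {} \<and> (\<exists>v\<in>vertices K. e = opposite_facet K v)"
    by (subst V(4)) (auto simp: facet_of_convex_hull_affine_independent[OF V(2)] opposite_facet_def)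
  then show ?thesis using ne by blast
qed

lemma opposite_facet_vertices:
  assumes "full_simplex K"
  shows "{x. x extreme_point_of opposite_facet K v} = vertices K - {v}"
proof -
  have "\<not> affine_dependent (vertices K - {v})"
    using full_simplex_vertices(2)[OF assms] affine_independent_Diff by blast
  then show ?thesis unfolding opposite_facet_def
    by (auto simp: extreme_point_of_convex_hull_affine_independent)
qed

lemma opposite_facet_inj:
  assumes "full_simplex K" "v \<in> vertices K" "w \<in> vertices K" "opposite_facet K v = opposite_facet K w"
  shows "v = w"
  using opposite_facet_vertices[OF assms(1), of v] opposite_facet_vertices[OF assms(1), of w] assms by auto

lemma opposite_facet_eq:
  fixes K :: "(real^'d) set"
  assumes "full_simplex K" "v \<in> vertices K"
  shows "opposite_facet K v = {x \<in> K. bary_coord K v x = 0}"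
proof (rule subset_antisym; rule subsetI)
  note V = full_simplex_vertices[OF assms(1)]
  fix x assume "x \<in> opposite_facet K v"
  then obtain u where u: "\<And>z. z\<in>vertices K - {v} \<Longrightarrow> 0 \<le> u z" "sum u (vertices K - {v}) = 1"
    "(\<Sum>z\<in>vertices K - {v}. u z *\<^sub>R z) = x"
    unfolding opposite_facet_def using V(1) by (auto simp: convex_hull_finite)
  define w where "w z = (if z = v then 0 else u z)" for z
  have "sum w (vertices K - {v}) = sum u (vertices K - {v})"
    "(\<Sum>z\<in>vertices K - {v}. w z *\<^sub>R z) = (\<Sum>z\<in>vertices K - {v}. u z *\<^sub>R z)"
    by (auto simp: w_def intro!: sum.cong)
  then have w: "sum w (vertices K) = 1" "(\<Sum>z\<in>vertices K. w z *\<^sub>R z) = x"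
    using u(2,3) sum.remove[OF V(1) assms(2), of w] sum.remove[OF V(1) assms(2), of "\<lambda>z. w z *\<^sub>R z"]
    by (auto simp: w_def)
  have "bary_coord K z x = w z" if "z \<in> vertices K" for z
    using bary_coord_affine_combination[OF assms(1) that w(1)] w(2) by simp
  then show "x \<in> {x \<in> K. bary_coord K v x = 0}"
    using u(1) assms(2) by (auto simp: mem_simplex_iff[OF assms(1)] w_def)
next
  note V = full_simplex_vertices[OF assms(1)]
  fix x assume x: "x \<in> {x \<in> K. bary_coord K v x = 0}"
  note R = bary_coord_representation[OF assms(1), of x]
  have "sum (\<lambda>z. bary_coord K z x) (vertices K - {v}) = 1"
    "(\<Sum>z\<in>vertices K - {v}. bary_coord K z x *\<^sub>R z) = x"
    using R sum.remove[OF V(1) assms(2), of "\<lambda>z. bary_coord K z x"]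
      sum.remove[OF V(1) assms(2), of "\<lambda>z. bary_coord K z x *\<^sub>R z"] x by auto
  then show "x \<in> opposite_facet K v" unfolding opposite_facet_def
    using V(1) x mem_simplex_iff[OF assms(1)] by (auto simp: convex_hull_finite intro!: exI[of _ "\<lambda>z. bary_coord K z x"])
qed

lemma affine_hull_opposite_facet:
  fixes K :: "(real^'d) set"
  assumes "full_simplex K" "v \<in> vertices K"
  shows "affine hull (opposite_facet K v) = {x. bary_coord K v x = 0}"
proof -
  note V = full_simplex_vertices[OF assms(1)]
  have "affine hull (opposite_facet K v) = affine hull (vertices K - {v})"
    unfolding opposite_facet_def by (rule affine_hull_convex_hull)
  also have "\<dots> = {x. bary_coord K v x = 0}"
  proof (rule antisym)
    have eq: "{x. bary_coord K v x = 0} = {x. bary_grad K v \<bullet> x = - bary_offset K v}"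
      by (auto simp: bary_coord_def)
    have "vertices K - {v} \<subseteq> {x. bary_coord K v x = 0}"
      using bary_coord_vertex[OF assms] by auto
    then show "affine hull (vertices K - {v}) \<subseteq> {x. bary_coord K v x = 0}"
      unfolding eq by (rule hull_minimal) (rule affine_hyperplane)
    show "{x. bary_coord K v x = 0} \<subseteq> affine hull (vertices K - {v})"
    proof
      fix x assume x: "x \<in> {x. bary_coord K v x = 0}"
      note R = bary_coord_representation[OF assms(1), of x]
      have "sum (\<lambda>z. bary_coord K z x) (vertices K - {v}) = 1"
        "(\<Sum>z\<in>vertices K - {v}. bary_coord K z x *\<^sub>R z) = x"
        using R sum.remove[OF V(1) assms(2), of "\<lambda>z. bary_coord K z x"]
          sum.remove[OF V(1) assms(2), of "\<lambda>z. bary_coord K z x *\<^sub>R z"] x by auto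
      then show "x \<in> affine hull (vertices K - {v})"
        using V(1) by (auto simp: affine_hull_finite)
    qed
  qed
  finally show ?thesis .
qed

lemma other_vertex:
  fixes K :: "(real^'d) set"
  assumes "full_simplex K" "v \<in> vertices K"
  obtains z where "z \<in> vertices K" "z \<noteq> v"
proof -
  have "\<not> vertices K \<subseteq> {v}"
    using full_simplex_vertices(3)[OF assms(1)] card_mono[of "{v}" "vertices K"] by auto
  with that show ?thesis by blast
qed

lemma vertex_distance:
  assumes "full_simplex K" "v \<in> vertices K" "z \<in> vertices K" "z \<noteq> v"
  shows "1 \<le> norm (bary_grad K v) * dist v z"
proof -
  have "1 = bary_coord K v v - bary_coord K v z" using assms by (simp add: bary_coord_vertex)
  also have "\<dots> = bary_grad K v \<bullet> (v - z)" by (simp add: bary_coord_def inner_diff_right)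
  also have "\<dots> \<le> norm (bary_grad K v) * norm (v - z)" by (rule norm_cauchy_schwarz)
  finally show ?thesis by (simp add: dist_norm)
qed

lemma bary_grad_lower:
  assumes "full_simplex K" "v \<in> vertices K"
  shows "1 \<le> norm (bary_grad K v) * diameter K"
proof -
  obtain z where z: "z \<in> vertices K" "z \<noteq> v" using other_vertex[OF assms] .
  have "bounded K" using simplex_compact_convex[OF assms(1)] by (simp add: compact_imp_bounded)
  then have "dist v z \<le> diameter K"
    using vertices_subset[OF assms(1)] assms(2) z by (intro diameter_bounded_bound) auto
  then show ?thesis using vertex_distance[OF assms z] by (meson mult_left_mono norm_ge_zero order_trans)
qed

lemma bary_grad_nonzero: "full_simplex K \<Longrightarrow> v \<in> vertices K \<Longrightarrow> bary_grad K v \<noteq> 0"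
  using bary_grad_lower by fastforce

text \<open>Across the diameter of an inscribed ball in direction of the gradient, the coordinate changes by at
  most one.\<close>

lemma bary_grad_upper:
  assumes "full_simplex K" "v \<in> vertices K" "cball a r \<subseteq> K" "0 \<le> r"
  shows "2 * r * norm (bary_grad K v) \<le> 1"
proof -
  let ?g = "bary_grad K v"
  define n where "n = ?g /\<^sub>R norm ?g"
  have n: "norm n = 1" "?g \<bullet> n = norm ?g"
    using bary_grad_nonzero[OF assms(1,2)] by (simp_all add: n_def power2_norm_eq_inner[symmetric] power2_eq_square)
  have "a + r *\<^sub>R n \<in> K" "a - r *\<^sub>R n \<in> K"
    using assms(3,4) n(1) by (auto intro!: set_mp[OF assms(3)] simp: dist_norm)
  then have "bary_coord K v (a + r *\<^sub>R n) - bary_coord K v (a - r *\<^sub>R n) \<le> 1 - 0"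
    using assms mem_simplex_iff bary_coord_le_1 by (intro diff_mono) blast+
  then show ?thesis by (simp add: bary_coord_def inner_add_right inner_diff_right n(2))
qed

text \<open>The facet contains two vertices, and the coordinate of one of them changes by one between
  them.\<close>

lemma diameter_opposite_facet_ge:
  fixes K :: "(real^'d) set"
  assumes "full_simplex K" "v \<in> vertices K" "cball a r \<subseteq> K" "0 \<le> r" "2 \<le> CARD('d)"
  shows "2 * r \<le> diameter (opposite_facet K v)"
proof -
  note V = full_simplex_vertices[OF assms(1)]
  have "card (vertices K - {v}) \<ge> 2" using V assms by simp
  then obtain y z where yz: "y \<in> vertices K - {v}" "z \<in> vertices K - {v}" "y \<noteq> z"
    by (metis card_le_Suc0_iff_eq V(1) finite_Diff not_less_eq_eq numeral_2_eq_2)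
  have "2 * r * norm (bary_grad K y) \<le> norm (bary_grad K y) * dist y z"
    using bary_grad_upper[OF assms(1) _ assms(3,4), of y] vertex_distance[OF assms(1), of y z] yz by auto
  then have "2 * r \<le> dist y z" using bary_grad_nonzero[OF assms(1), of y] yz by (simp add: mult.commute)
  also have "\<dots> \<le> diameter (opposite_facet K v)"
  proof (rule diameter_bounded_bound)
    have "opposite_facet K v \<subseteq> K" using opposite_facet_eq[OF assms(1,2)] by auto
    then show "bounded (opposite_facet K v)"
      using simplex_compact_convex[OF assms(1)] compact_imp_bounded bounded_subset by blast
    show "y \<in> opposite_facet K v" "z \<in> opposite_facet K v"
      using yz by (auto simp: opposite_facet_def hull_inc)
  qed
  finally show ?thesis .
qed

text \<open>For uniqueness, let \<open>n \<bullet> x \<le> b\<close> describe any supporting half-space with equality on the facet. Then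
  \<open>b - n \<bullet> x\<close> vanishes at all vertices but \<open>v\<close>, so it is a nonnegative multiple of the barycentric
  coordinate of \<open>v\<close>.\<close>

lemma outward_normal_opposite_facet:
  fixes K :: "(real^'d) set"
  assumes "full_simplex K" "v \<in> vertices K"
  shows "outward_normal K (opposite_facet K v) = - (bary_grad K v /\<^sub>R norm (bary_grad K v))"
  unfolding outward_normal_def
proof (rule the_equality)
  let ?g = "bary_grad K v" and ?t = "bary_offset K v" and ?e = "opposite_facet K v"
  have g0: "norm ?g > 0" using bary_grad_nonzero[OF assms] by simp
  have ineq: "- (?g /\<^sub>R norm ?g) \<bullet> x = (?t - bary_coord K v x) / norm ?g" for x
    by (simp add: bary_coord_def divide_inverse mult.commute)
  show "norm (- (?g /\<^sub>R norm ?g)) = 1 \<and> (\<exists>b. ?e \<subseteq> {x. - (?g /\<^sub>R norm ?g) \<bullet> x = b} \<and> K \<subseteq> {x. - (?g /\<^sub>R norm ?g) \<bullet> x \<le> b})"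
    unfolding ineq using g0 assms
    by (intro conjI exI[of _ "?t / norm ?g"])
       (auto simp: opposite_facet_eq mem_simplex_iff intro!: divide_right_mono)
  fix n assume n: "norm n = 1 \<and> (\<exists>b. ?e \<subseteq> {x. n \<bullet> x = b} \<and> K \<subseteq> {x. n \<bullet> x \<le> b})"
  then obtain b where b: "?e \<subseteq> {x. n \<bullet> x = b}" "K \<subseteq> {x. n \<bullet> x \<le> b}" by blast
  define s where "s = b - n \<bullet> v"
  have "s \<ge> 0" using b(2) vertices_subset[OF assms(1)] assms(2) by (auto simp: s_def)
  have "(- n) \<bullet> z + b = (s *\<^sub>R ?g) \<bullet> z + s * ?t" if "z \<in> vertices K" for z
  proof -
    have "(s *\<^sub>R ?g) \<bullet> z + s * ?t = s * bary_coord K v z" by (simp add: bary_coord_def algebra_simps)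
    moreover have "n \<bullet> z = b" if "z \<noteq> v"
    proof -
      have "z \<in> ?e" using that \<open>z \<in> vertices K\<close> by (auto simp: opposite_facet_def hull_inc)
      then show ?thesis using b(1) by auto
    qed
    ultimately show ?thesis using bary_coord_vertex[OF assms that] by (auto simp: s_def)
  qed
  then have "- n = s *\<^sub>R ?g" by (rule affine_functional_determined_by_vertices(1)[OF assms(1)])
  moreover have "norm (- n) = 1" using n by simp
  ultimately have "s * norm ?g = 1" using \<open>s \<ge> 0\<close> by simp
  then have "s = inverse (norm ?g)" using g0 by (metis inverse_unique mult.commute)
  then show "n = - (?g /\<^sub>R norm ?g)" using \<open>- n = s *\<^sub>R ?g\<close> by (metis minus_minus)
qed

text \<open>Two simplices on the same side of a common facet would overlap near the centre of the facet.\<close>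

lemma shared_facet_opposite_sides:
  fixes K K' :: "(real^'d) set"
  assumes K: "full_simplex K" "v \<in> vertices K" and K': "full_simplex K'" "v' \<in> vertices K'"
    and e: "opposite_facet K v = opposite_facet K' v'" and disj: "interior K \<inter> K' = {}"
  obtains s where "s < 0" "bary_grad K' v' = s *\<^sub>R bary_grad K v" "bary_offset K' v' = s * bary_offset K v"
proof -
  note V = full_simplex_vertices[OF K(1)]
  have VV: "vertices K - {v} = vertices K' - {v'}"
    using opposite_facet_vertices[OF K(1), of v] opposite_facet_vertices[OF K'(1), of v'] e by simp
  define s where "s = bary_coord K' v' v"
  \<comment> \<open>The coordinates of the two apexes vanish on the same hyperplane, hence are proportional.\<close>
  have agree: "bary_grad K' v' \<bullet> z + bary_offset K' v' = (s *\<^sub>R bary_grad K v) \<bullet> z + s * bary_offset K v" if "z \<in> vertices K" for z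
  proof -
    have "(s *\<^sub>R bary_grad K v) \<bullet> z + s * bary_offset K v = s * bary_coord K v z" by (simp add: bary_coord_def algebra_simps)
    also have "\<dots> = bary_coord K' v' z"
    proof (cases "z = v")
      case True then show ?thesis using bary_coord_vertex[OF K that] by (simp add: s_def)
    next
      case False
      then have "z \<in> vertices K'" "z \<noteq> v'" using VV that by blast+
      then show ?thesis using bary_coord_vertex[OF K that] bary_coord_vertex[OF K', of z] False by simp
    qed
    finally show ?thesis by (simp add: bary_coord_def)
  qed
  note gt = affine_functional_determined_by_vertices[OF K(1) agree]
  have bc: "bary_coord K' v' x = s * bary_coord K v x" for x
    by (simp add: bary_coord_def gt algebra_simps)
  have "s \<noteq> 0" using gt(1) bary_grad_nonzero[OF K'] by auto
  moreover have "\<not> s > 0"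
  proof
    assume "s > 0"
    \<comment> \<open>Move from the centre \<open>y\<close> of the facet a small step towards the apex of \<open>K'\<close>: the point stays in \<open>K'\<close>
      and lies in the interior of \<open>K\<close>.\<close>
    define W where "W = vertices K - {v}"
    have W: "finite W" "card W = CARD('d)" using V K(2) by (auto simp: W_def)
    define y where "y = (\<Sum>z\<in>W. (1 / real (card W)) *\<^sub>R z)"
    have yu: "sum (\<lambda>z. if z = v then 0 else 1 / real (card W)) (vertices K) = 1"
      "(\<Sum>z\<in>vertices K. (if z = v then 0 else 1 / real (card W)) *\<^sub>R z) = y"
    proof -
      have "(\<Sum>z\<in>W. if z = v then 0 else 1 / real (card W)) = (\<Sum>z\<in>W. 1 / real (card W))"
        "(\<Sum>z\<in>W. (if z = v then 0 else 1 / real (card W)) *\<^sub>R z) = y"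
        unfolding y_def by (auto simp: W_def intro!: sum.cong)
      moreover have "(\<Sum>z\<in>W. 1 / real (card W)) = 1" using W by simp
      ultimately show "sum (\<lambda>z. if z = v then 0 else 1 / real (card W)) (vertices K) = 1"
        "(\<Sum>z\<in>vertices K. (if z = v then 0 else 1 / real (card W)) *\<^sub>R z) = y"
        using sum.remove[OF V(1) K(2), of "\<lambda>z. if z = v then 0 else 1 / real (card W)"]
          sum.remove[OF V(1) K(2), of "\<lambda>z. (if z = v then 0 else 1 / real (card W)) *\<^sub>R z"] by (auto simp: W_def)
    qed
    have bary_y: "bary_coord K z y = (if z = v then 0 else 1 / real (card W))" if "z \<in> vertices K" for z
      using bary_coord_affine_combination[OF K(1) that yu(1)] yu(2) by simp
    define U where "U = {x. \<forall>z\<in>W. 0 < bary_coord K z x}"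
    have "open U" unfolding U_def by (rule open_bary_positive[OF W(1)])
    moreover have "y \<in> U" unfolding U_def using bary_y W by (auto simp: W_def)
    ultimately obtain \<delta> where \<delta>: "\<delta> > 0" "ball y \<delta> \<subseteq> U" using open_contains_ball by blast
    define \<epsilon> where "\<epsilon> = min 1 (\<delta> / (2 * (1 + dist y v')))"
    have d0: "1 + dist y v' > 0" by (simp add: add_pos_nonneg)
    have \<epsilon>: "0 < \<epsilon>" "\<epsilon> \<le> 1" using \<delta> d0 by (auto simp: \<epsilon>_def)
    define p where "p = (1 - \<epsilon>) *\<^sub>R y + \<epsilon> *\<^sub>R v'"
    have "y \<in> convex hull W" unfolding y_def using W by (intro convex_sum) (auto simp: hull_inc)
    then have "y \<in> K'" using opposite_facet_eq[OF K'] e by (auto simp: opposite_facet_def W_def)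
    then have "p \<in> K'" unfolding p_def
      using simplex_compact_convex(2)[OF K'(1)] vertices_subset[OF K'(1)] K'(2) \<epsilon> by (intro convexD) auto
    moreover have "p \<in> interior K"
    proof (rule bary_positive_imp_interior[OF K(1)])
      fix z assume z: "z \<in> vertices K"
      show "0 < bary_coord K z p"
      proof (cases "z = v")
        case True
        have "s * bary_coord K v v' = 1" using bc[of v'] bary_coord_vertex[OF K' K'(2)] by simp
        then have "bary_coord K v v' > 0" using \<open>s > 0\<close> zero_less_mult_pos[of s "bary_coord K v v'"] by simp
        moreover have "bary_coord K v p = (1 - \<epsilon>) * bary_coord K v y + \<epsilon> * bary_coord K v v'"
          unfolding p_def bary_coord_def by (simp add: inner_add_right algebra_simps)
        ultimately show ?thesis using True bary_y[OF K(2)] \<epsilon> by simp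
      next
        case False
        have "dist y p = norm (\<epsilon> *\<^sub>R (y - v'))" unfolding p_def dist_norm by (simp add: algebra_simps)
        also have "\<dots> = \<epsilon> * dist y v'" using \<epsilon> by (simp add: dist_norm)
        also have "\<dots> \<le> \<delta> / (2 * (1 + dist y v')) * dist y v'" by (intro mult_right_mono) (auto simp: \<epsilon>_def)
        also have "\<dots> < \<delta>" using \<delta>(1) d0 by (simp add: divide_simps)
        finally show ?thesis using \<delta>(2) False z by (auto simp: U_def W_def)
      qed
    qed
    ultimately show False using disj by blast
  qed
  ultimately have "s < 0" by simp
  with that gt show ?thesis by blast
qed

section \<open>Linear images and Lebesgue measure\<close>

definition reindex_vec :: "('n \<Rightarrow> 'd) \<Rightarrow> real^'d \<Rightarrow> real^'n" where
  "reindex_vec b x = (\<chi> j. x $ b j)"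

lemma linear_reindex_vec: "linear (reindex_vec b)"
  by (rule linearI) (simp_all add: reindex_vec_def Finite_Cartesian_Product.vec_eq_iff)

lemma continuous_on_reindex_vec: "continuous_on S (reindex_vec b)"
  by (rule linear_continuous_on) (simp add: linear_conv_bounded_linear[symmetric] linear_reindex_vec)

lemma prod_Basis_cart: "(\<Prod>b\<in>(Basis :: (real^'n) set). f b) = (\<Prod>i\<in>UNIV. f (axis i 1))"
proof -
  have B: "(Basis :: (real^'n) set) = range (\<lambda>i. axis i 1)" by (auto simp: Basis_vec_def)
  show ?thesis unfolding B by (subst prod.reindex) (auto simp: inj_on_def axis_eq_axis)
qed

lemma measure_reindex_vec:
  fixes S :: "(real^'d) set" and b :: "'n::finite \<Rightarrow> 'd"
  assumes b: "bij b" and S: "compact S"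
  shows "measure lborel (reindex_vec b ` S) = measure lborel S"
proof -
  let ?J = "reindex_vec b :: real^'d \<Rightarrow> real^'n" and ?J' = "reindex_vec (inv_into UNIV b) :: real^'n \<Rightarrow> real^'d"
  have inv: "?J' (?J x) = x" "?J (?J' y) = y" for x y
    using b by (simp_all add: reindex_vec_def bij_is_surj bij_is_inj surj_f_inv_f)
  have [measurable]: "?J' \<in> borel_measurable borel"
    by (rule borel_measurable_continuous_onI[OF continuous_on_reindex_vec])
  have distr: "lborel = distr lborel borel ?J'"
  proof (rule lborel_eqI)
    fix l u :: "real^'d" assume lu: "\<And>c. c \<in> Basis \<Longrightarrow> l \<bullet> c \<le> u \<bullet> c"
    then have le: "l $ i \<le> u $ i" for i using lu[of "axis i 1"] by (simp add: inner_axis)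
    have "emeasure (distr lborel borel ?J') (box l u) = emeasure lborel (?J' -` box l u \<inter> space lborel)"
      by (rule emeasure_distr) auto
    also have "?J' -` box l u \<inter> space lborel = box (?J l) (?J u)"
    proof -
      have "(\<forall>i. P (inv_into UNIV b i) (i::'d)) \<longleftrightarrow> (\<forall>j. P j (b j))" for P
        using b by (metis bij_inv_eq_iff)
      note this[of "\<lambda>j i. l $ i < y $ j \<and> y $ j < u $ i" for y :: "real^'n"]
      then show ?thesis by (auto simp: mem_box_cart reindex_vec_def)
    qed
    also have "emeasure lborel (box (?J l) (?J u)) = (\<Prod>c\<in>Basis. (?J u - ?J l) \<bullet> c)"
      using le by (intro emeasure_lborel_box) (auto simp: Basis_vec_def inner_axis reindex_vec_def)
    also have "(\<Prod>c\<in>Basis. (?J u - ?J l) \<bullet> c) = (\<Prod>j\<in>UNIV. (u - l) $ b j)"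
      by (simp add: prod_Basis_cart inner_axis reindex_vec_def)
    also have "\<dots> = (\<Prod>i\<in>UNIV. (u - l) $ i)"
      by (rule prod.reindex_bij_betw[OF b])
    also have "\<dots> = (\<Prod>c\<in>Basis. (u - l) \<bullet> c)" by (simp add: prod_Basis_cart inner_axis)
    finally show "emeasure (distr lborel borel ?J') (box l u) = (\<Prod>c\<in>Basis. (u - l) \<bullet> c)" .
  qed simp
  have "measure lborel S = measure (distr lborel borel ?J') S" using distr by simp
  also have "\<dots> = measure lborel (?J' -` S \<inter> space lborel)"
    using S by (intro measure_distr) (auto intro: borel_compact)
  also have "?J' -` S \<inter> space lborel = ?J ` S"
  proof -
    have "y \<in> ?J ` S" if "?J' y \<in> S" for y using inv(2)[of y] that by (metis imageI)
    then show ?thesis by (auto simp: inv)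
  qed
  finally show ?thesis ..
qed

text \<open>Renaming coordinates preserves Lebesgue measure, so a linear map may be conjugated to one over a
  well-ordered index type, where the factor is the absolute value of the determinant.\<close>

lemma linear_image_volume_factor_ordered:
  fixes f :: "real^'d \<Rightarrow> real^'d"
  assumes f: "linear f" and b: "bij (b :: 'n::{finite,wellorder} \<Rightarrow> 'd)"
  shows "\<exists>k. \<forall>S. compact S \<longrightarrow> measure lborel (f ` S) = k * measure lborel S"
proof -
  let ?J = "reindex_vec b" and ?J' = "reindex_vec (inv_into UNIV b)"
  have inv: "?J' (?J x) = x" for x
    using b by (simp add: reindex_vec_def bij_is_surj surj_f_inv_f)
  define F where "F = ?J \<circ> f \<circ> ?J'"
  have F: "linear F" unfolding F_def by (intro linear_compose linear_reindex_vec f)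
  have "measure lborel (f ` S) = \<bar>Determinants.det (matrix F)\<bar> * measure lborel S" if S: "compact S" for S
  proof -
    have JS: "compact (?J ` S)" using S continuous_on_reindex_vec compact_continuous_image by blast
    have fS: "compact (f ` S)" using S f by (intro compact_continuous_image linear_continuous_on)
        (simp_all add: linear_conv_bounded_linear[symmetric])
    have FS: "F ` ?J ` S = ?J ` f ` S" by (auto simp: F_def inv image_iff)
    have "measure lborel (f ` S) = measure lborel (F ` ?J ` S)"
      unfolding FS by (rule measure_reindex_vec[OF b fS, symmetric])
    also have "\<dots> = measure lebesgue (F ` ?J ` S)"
      using fS unfolding FS
      by (intro measure_completion[symmetric]) (auto intro: borel_compact compact_continuous_image continuous_on_reindex_vec)
    also have "\<dots> = \<bar>Determinants.det (matrix F)\<bar> * measure lebesgue (?J ` S)"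
      by (rule measure_linear_image[OF F lmeasurable_compact[OF JS]])
    also have "measure lebesgue (?J ` S) = measure lborel (?J ` S)"
      using JS by (intro measure_completion) (auto intro: borel_compact)
    also have "\<dots> = measure lborel S" by (rule measure_reindex_vec[OF b S])
    finally show ?thesis .
  qed
  then show ?thesis by blast
qed

lemma bij_of_card_eq:
  assumes "CARD('n::finite) = CARD('d::finite)"
  shows "\<exists>b :: 'n \<Rightarrow> 'd. bij b"
proof -
  obtain h where "bij_betw h (UNIV :: 'n set) (UNIV :: 'd set)"
    using finite_same_card_bij[OF finite finite assms] by blast
  then show ?thesis by auto
qed

lemma linear_image_volume_factor:
  fixes f :: "real^'d \<Rightarrow> real^'d"
  assumes "CARD('d) = 2 \<or> CARD('d) = 3" "linear f"
  shows "\<exists>k. \<forall>S. compact S \<longrightarrow> measure lborel (f ` S) = k * measure lborel S"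
  using assms(1)
proof
  assume "CARD('d) = 2"
  then have "CARD(2) = CARD('d)" by simp
  then obtain b :: "2 \<Rightarrow> 'd" where "bij b" using bij_of_card_eq by blast
  then show ?thesis by (rule linear_image_volume_factor_ordered[OF assms(2)])
next
  assume "CARD('d) = 3"
  then have "CARD(3) = CARD('d)" by simp
  then obtain b :: "3 \<Rightarrow> 'd" where "bij b" using bij_of_card_eq by blast
  then show ?thesis by (rule linear_image_volume_factor_ordered[OF assms(2)])
qed

text \<open>The factor by which a linear map scales volumes, read off from its effect on the unit ball. It is
  multiplicative under composition, and it is the absolute value of the determinant.\<close>

definition volume_factor :: "(real^'d \<Rightarrow> real^'d) \<Rightarrow> real" where
  "volume_factor f = measure lborel (f ` cball 0 1) / measure lborel (cball (0::real^'d) 1)"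

lemma measure_cball_pos: "0 < r \<Longrightarrow> 0 < measure lborel (cball (a::real^'d) r)"
  by (rule content_cball_pos)

locale planar_or_spatial =
  fixes dim_witness :: "'d::finite itself"
  assumes dim: "CARD('d) = 2 \<or> CARD('d) = 3"
begin

lemma measure_linear_image_factor:
  fixes f :: "real^'d \<Rightarrow> real^'d"
  assumes "linear f" "compact S"
  shows "measure lborel (f ` S) = volume_factor f * measure lborel S"
proof -
  obtain k where k: "\<forall>S. compact S \<longrightarrow> measure lborel (f ` S) = k * measure lborel S"
    using linear_image_volume_factor[OF dim assms(1)] by blast
  then have "k = volume_factor f" unfolding volume_factor_def
    using measure_cball_pos[of 1 "0::real^'d"] by (simp add: field_simps)
  then show ?thesis using k assms(2) by simp
qed

lemma measure_affine_image_factor: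
  fixes f :: "real^'d \<Rightarrow> real^'d"
  assumes "linear f" "compact S"
  shows "measure lborel ((\<lambda>x. a + f x) ` S) = volume_factor f * measure lborel S"
proof -
  have c: "compact (f ` S)"
    using assms by (intro compact_continuous_image linear_continuous_on) (simp_all add: linear_conv_bounded_linear[symmetric])
  have eq: "(\<lambda>x. a + f x) ` S = (+) a ` f ` S" by auto
  have "measure lborel ((+) a ` f ` S) = measure lebesgue ((+) a ` f ` S)"
    using compact_translation[OF c] by (intro measure_completion[symmetric]) (auto intro: borel_compact)
  also have "\<dots> = measure lebesgue (f ` S)" by (rule measure_translation)
  also have "\<dots> = measure lborel (f ` S)" using c by (intro measure_completion) (auto intro: borel_compact)
  finally show ?thesis unfolding eq using measure_linear_image_factor[OF assms] by simp
qed

lemma volume_factor_nonneg: "0 \<le> volume_factor (f :: real^'d \<Rightarrow> real^'d)"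
  by (simp add: volume_factor_def)

lemma volume_factor_compose:
  fixes f g :: "real^'d \<Rightarrow> real^'d"
  assumes "linear f" "linear g"
  shows "volume_factor (\<lambda>x. f (g x)) = volume_factor f * volume_factor g"
proof -
  have c: "compact (g ` cball 0 1)"
    using assms by (intro compact_continuous_image linear_continuous_on) (simp_all add: linear_conv_bounded_linear[symmetric])
  have "measure lborel ((\<lambda>x. f (g x)) ` cball 0 1) = measure lborel (f ` g ` cball 0 1)" by (simp add: image_image)
  also have "\<dots> = volume_factor f * (volume_factor g * measure lborel (cball (0::real^'d) 1))"
    using measure_linear_image_factor[OF assms(1) c] measure_linear_image_factor[OF assms(2) compact_cball] by simp
  finally show ?thesis using measure_cball_pos[of 1 "0::real^'d"]
    unfolding volume_factor_def[of "\<lambda>x. f (g x)"] by simp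
qed

lemma volume_factor_orthogonal:
  fixes f :: "real^'d \<Rightarrow> real^'d"
  assumes "orthogonal_transformation f" shows "volume_factor f = 1"
proof -
  have "f 0 = 0" using assms by (simp add: orthogonal_transformation_def linear_0)
  then show ?thesis using measure_cball_pos[of 1 "0::real^'d"]
    unfolding volume_factor_def image_orthogonal_transformation_cball[OF assms] by simp
qed

lemma linear_rank_one_update: "linear (\<lambda>x. x + (n \<bullet> x) *\<^sub>R (q::real^'d))"
  by (rule linearI) (simp_all add: inner_add_right scaleR_add_left scaleR_add_right)

text \<open>Conjugation with the reflection in the hyperplane orthogonal to \<open>n\<close> turns a shear into its
  inverse, so both have the same volume factor.\<close>

lemma volume_factor_shear:
  fixes n q :: "real^'d"
  assumes "norm n = 1" "n \<bullet> q = 0"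
  shows "volume_factor (\<lambda>x. x + (n \<bullet> x) *\<^sub>R q) = 1"
proof -
  let ?T = "\<lambda>x. x + (n \<bullet> x) *\<^sub>R q" and ?R = "\<lambda>x. x + (n \<bullet> x) *\<^sub>R (-2 *\<^sub>R n)"
  have nn: "n \<bullet> n = 1" using assms(1) by (simp add: norm_eq_1)
  have R: "orthogonal_transformation ?R" unfolding orthogonal_transformation_def
  proof (intro conjI allI)
    show "linear ?R" by (rule linear_rank_one_update)
    show "?R x \<bullet> ?R y = x \<bullet> y" for x y
      by (simp add: inner_add_left inner_add_right inner_diff_left inner_diff_right nn algebra_simps inner_commute)
  qed
  have lT: "linear ?T" and lR: "linear ?R" by (rule linear_rank_one_update)+
  have lRT: "linear (\<lambda>x. ?R (?T x))" using linear_compose[OF lT lR] by (simp add: o_def)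
  have lTR: "linear (\<lambda>x. ?T (?R x))" using linear_compose[OF lR lT] by (simp add: o_def)
  have "(\<lambda>x. ?R (?T (?R (?T x)))) = (\<lambda>x. x)"
    by (intro ext) (simp add: inner_add_right nn assms(2) algebra_simps)
  then have "volume_factor (\<lambda>x. ?R (?T (?R (?T x)))) = volume_factor (\<lambda>x::real^'d. x)" by simp
  also have "\<dots> = 1" by (rule volume_factor_orthogonal) simp
  also have "volume_factor (\<lambda>x. ?R (?T (?R (?T x)))) = volume_factor (\<lambda>x. ?R (?T x)) * volume_factor (\<lambda>x. ?R (?T x))"
    by (rule volume_factor_compose[OF lRT lRT])
  also have "volume_factor (\<lambda>x. ?R (?T x)) = volume_factor ?T"
    using volume_factor_compose[OF lR lT] volume_factor_orthogonal[OF R] by simp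
  finally have "(volume_factor ?T)\<^sup>2 = 1" by (simp add: power2_eq_square)
  then show ?thesis using volume_factor_nonneg[of ?T] by (simp add: power2_eq_1_iff)
qed

lemma volume_factor_stretch_axis:
  fixes k :: 'd
  shows "volume_factor (\<lambda>x :: real^'d. x + (axis k 1 \<bullet> x) *\<^sub>R (\<alpha> *\<^sub>R axis k 1)) = \<bar>1 + \<alpha>\<bar>"
proof -
  let ?D = "\<lambda>x :: real^'d. x + (axis k 1 \<bullet> x) *\<^sub>R (\<alpha> *\<^sub>R axis k 1)"
  let ?m = "\<lambda>b :: real^'d. if b = axis k 1 then 1 + \<alpha> else 1"
  have D: "?D x = (\<Sum>b\<in>Basis. (?m b * (x \<bullet> b)) *\<^sub>R b)" for x
  proof -
    have "(\<Sum>b\<in>Basis. (?m b * (x \<bullet> b)) *\<^sub>R b)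
        = (\<Sum>b\<in>Basis. (x \<bullet> b) *\<^sub>R b + (if b = axis k 1 then (\<alpha> * (x \<bullet> b)) *\<^sub>R b else 0))"
      by (intro sum.cong) (auto simp: algebra_simps)
    also have "\<dots> = x + (\<alpha> * (x \<bullet> axis k 1)) *\<^sub>R axis k 1"
      by (simp add: sum.distrib euclidean_representation)
    finally show ?thesis by (simp add: inner_commute mult.commute)
  qed
  have "volume_factor ?D * measure lborel (cbox 0 1 :: (real^'d) set) = measure lborel (?D ` cbox 0 1)"
    by (rule measure_linear_image_factor[OF linear_rank_one_update, symmetric]) simp
  also have "\<dots> = \<bar>\<Prod>b\<in>Basis. ?m b\<bar> * measure lborel (cbox 0 1 :: (real^'d) set)"
    unfolding D by (rule content_image_stretch_interval)
  also have "(\<Prod>b\<in>Basis. ?m b) = 1 + \<alpha>" by simp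
  finally show ?thesis
    by (simp add: content_cbox_cart interval_eq_empty_cart)
qed

text \<open>A rotation takes \<open>n\<close> to a coordinate axis.\<close>

lemma volume_factor_stretch:
  fixes n :: "real^'d"
  assumes "norm n = 1"
  shows "volume_factor (\<lambda>x. x + (n \<bullet> x) *\<^sub>R (\<alpha> *\<^sub>R n)) = \<bar>1 + \<alpha>\<bar>"
proof -
  define k where "k = (undefined :: 'd)"
  let ?a = "axis k 1 :: real^'d"
  obtain f where f: "orthogonal_transformation f" "f ?a = n"
    using orthogonal_transformation_exists_1[of ?a n] assms by (auto simp: norm_axis_1)
  let ?D = "\<lambda>x. x + (n \<bullet> x) *\<^sub>R (\<alpha> *\<^sub>R n)" and ?A = "\<lambda>x. x + (?a \<bullet> x) *\<^sub>R (\<alpha> *\<^sub>R ?a)"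
  have lf: "linear f" using f(1) by (simp add: orthogonal_transformation_def)
  have "(\<lambda>x. ?D (f x)) = (\<lambda>x. f (?A x))"
  proof
    fix x
    have "n \<bullet> f x = ?a \<bullet> x" using f by (metis orthogonal_transformation_def)
    then show "?D (f x) = f (?A x)" using f(2) by (simp add: linear_add[OF lf] linear_cmul[OF lf])
  qed
  then have "volume_factor (\<lambda>x. ?D (f x)) = volume_factor (\<lambda>x. f (?A x))" by simp
  then have "volume_factor ?D * volume_factor f = volume_factor f * volume_factor ?A"
    unfolding volume_factor_compose[OF linear_rank_one_update lf] volume_factor_compose[OF lf linear_rank_one_update] .
  then show ?thesis using volume_factor_orthogonal[OF f(1)] volume_factor_stretch_axis[of k \<alpha>] by simp
qed

text \<open>The map is a stretch along \<open>n\<close> followed by a shear.\<close>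

lemma volume_factor_rank_one_update:
  fixes n q :: "real^'d"
  assumes n: "norm n = 1" and nz: "1 + n \<bullet> q \<noteq> 0"
  shows "volume_factor (\<lambda>x. x + (n \<bullet> x) *\<^sub>R q) = \<bar>1 + n \<bullet> q\<bar>"
proof -
  let ?\<alpha> = "n \<bullet> q"
  let ?q = "(1 / (1 + ?\<alpha>)) *\<^sub>R (q - ?\<alpha> *\<^sub>R n)"
  let ?S = "\<lambda>x. x + (n \<bullet> x) *\<^sub>R ?q" and ?D = "\<lambda>x. x + (n \<bullet> x) *\<^sub>R (?\<alpha> *\<^sub>R n)"
  have nn: "n \<bullet> n = 1" using n by (simp add: norm_eq_1)
  have "(\<lambda>x. x + (n \<bullet> x) *\<^sub>R q) = (\<lambda>x. ?S (?D x))"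
  proof
    fix x
    have "n \<bullet> ?D x = (1 + ?\<alpha>) * (n \<bullet> x)" by (simp add: inner_add_right nn algebra_simps)
    then have "?S (?D x) = x + (n \<bullet> x) *\<^sub>R (?\<alpha> *\<^sub>R n) + (n \<bullet> x) *\<^sub>R (q - ?\<alpha> *\<^sub>R n)" using nz by simp
    then show "x + (n \<bullet> x) *\<^sub>R q = ?S (?D x)" by (simp add: algebra_simps)
  qed
  then have "volume_factor (\<lambda>x. x + (n \<bullet> x) *\<^sub>R q) = volume_factor (\<lambda>x. ?S (?D x))" by (simp only:)
  also have "\<dots> = volume_factor ?S * volume_factor ?D"
    by (rule volume_factor_compose[OF linear_rank_one_update linear_rank_one_update])
  also have "volume_factor ?S = 1" by (rule volume_factor_shear[OF n]) (simp add: inner_diff_right nn)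
  also have "volume_factor ?D = \<bar>1 + ?\<alpha>\<bar>" by (rule volume_factor_stretch[OF n])
  finally show ?thesis by simp
qed

end

section \<open>Surface measure of facets\<close>

lemma hyperplane_projection:
  fixes n :: "real^'d"
  assumes n: "norm n = 1" and H: "H = {x. n \<bullet> x = b}"
  shows "closest_point H z = z - (n \<bullet> z - b) *\<^sub>R n" "infdist z H = \<bar>n \<bullet> z - b\<bar>"
proof -
  have nn: "n \<bullet> n = 1" using n by (simp add: norm_eq_1)
  let ?p = "z - (n \<bullet> z - b) *\<^sub>R n"
  have p: "?p \<in> H" by (simp add: H inner_diff_right nn)
  have c: "closed H" "convex H" unfolding H by (rule closed_hyperplane, rule convex_hyperplane)
  have dp: "dist z ?p = \<bar>n \<bullet> z - b\<bar>" by (simp add: dist_norm n)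
  have "dist z ?p \<le> dist z y" if "y \<in> H" for y
  proof -
    have "n \<bullet> z - b = n \<bullet> (z - y)" using that by (simp add: H inner_diff_right)
    also have "\<bar>\<dots>\<bar> \<le> norm n * norm (z - y)" by (rule Cauchy_Schwarz_ineq2)
    finally show ?thesis using n dp by (simp add: dist_norm)
  qed
  then show *: "closest_point H z = ?p"
    using closest_point_unique[OF c(2,1) p] by auto
  have "infdist z H = dist z (closest_point H z)"
    unfolding infdist_eq_setdist using c p by (intro setdist_closest_point) auto
  then show "infdist z H = \<bar>n \<bullet> z - b\<bar>" using * dp by simp
qed

text \<open>With the unit normal as direction \<open>p\<close> this is the cylinder whose volume defines the area of \<open>e\<close>.
  Other directions give oblique cylinders, which unlike right ones are preserved by affine maps.\<close>

definition facet_cylinder :: "(real^'d) set \<Rightarrow> real^'d \<Rightarrow> (real^'d) set" where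
  "facet_cylinder e p = (\<lambda>(y, s). y + s *\<^sub>R p) ` (e \<times> {-1/2..1/2})"

lemma compact_facet_cylinder: "compact e \<Longrightarrow> compact (facet_cylinder e p)"
  unfolding facet_cylinder_def
  by (intro compact_continuous_image compact_Times) (auto intro!: continuous_intros simp: case_prod_beta)

lemma sets_hyperplane_measure [measurable_cong, simp]: "sets (hyperplane_measure H) = sets borel"
  by (simp add: hyperplane_measure_def)

lemma emeasure_hyperplane_measure:
  fixes n :: "real^'d"
  assumes n: "norm n = 1" and H: "H = {x. n \<bullet> x = b}" and e: "compact e" "e \<subseteq> H"
  shows "emeasure (hyperplane_measure H) e = emeasure lborel (facet_cylinder e n)"
proof -
  have nn: "n \<bullet> n = 1" using n by (simp add: norm_eq_1)
  note proj = hyperplane_projection[OF n H]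
  let ?\<Omega> = "{z. infdist z H \<le> 1 / 2}"
  have \<Omega>: "?\<Omega> \<in> sets borel" unfolding proj
    by (intro borel_closed closed_Collect_le continuous_intros)
  have cp [measurable]: "closest_point H \<in> borel_measurable borel"
    unfolding proj(1)[abs_def] by (intro borel_measurable_continuous_onI continuous_intros)
  have cyl: "closest_point H -` e \<inter> ?\<Omega> = facet_cylinder e n"
  proof (rule subset_antisym; rule subsetI)
    fix z assume "z \<in> closest_point H -` e \<inter> ?\<Omega>"
    then have "z - (n \<bullet> z - b) *\<^sub>R n \<in> e" "\<bar>n \<bullet> z - b\<bar> \<le> 1/2" by (simp_all add: proj)
    moreover from this have "n \<bullet> z - b \<in> {-1/2..1/2}" by (auto simp only: abs_le_iff atLeastAtMost_iff)
    ultimately have "z - (n \<bullet> z - b) *\<^sub>R n \<in> e" "n \<bullet> z - b \<in> {-1/2..1/2}" by blast+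
    then show "z \<in> facet_cylinder e n" unfolding facet_cylinder_def
      by (intro image_eqI[of _ _ "(z - (n \<bullet> z - b) *\<^sub>R n, n \<bullet> z - b)"]) auto
  next
    fix z assume "z \<in> facet_cylinder e n"
    then obtain y s where ys: "y \<in> e" "s \<in> {-1/2..1/2}" "z = y + s *\<^sub>R n" by (auto simp: facet_cylinder_def)
    have "n \<bullet> y = b" using ys e(2) H by auto
    then have "n \<bullet> z - b = s" using ys by (simp add: inner_add_right nn)
    then show "z \<in> closest_point H -` e \<inter> ?\<Omega>" using ys by (auto simp: proj abs_le_iff)
  qed
  have "emeasure (hyperplane_measure H) e
      = emeasure (restrict_space lborel ?\<Omega>) (closest_point H -` e \<inter> space (restrict_space lborel ?\<Omega>))"
    unfolding hyperplane_measure_def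
  proof (rule emeasure_distr)
    show "closest_point H \<in> restrict_space lborel ?\<Omega> \<rightarrow>\<^sub>M borel"
      by (rule measurable_restrict_space1) simp
    show "e \<in> sets borel" using e(1) by (rule borel_compact)
  qed
  also have "\<dots> = emeasure (restrict_space lborel ?\<Omega>) (facet_cylinder e n)"
  proof -
    have "space (restrict_space lborel ?\<Omega>) = ?\<Omega>" by (simp add: space_restrict_space)
    then show ?thesis by (simp only: cyl)
  qed
  also have "\<dots> = emeasure lborel (facet_cylinder e n)"
    using \<Omega> by (intro emeasure_restrict_space) (auto simp flip: cyl)
  finally show ?thesis .
qed

definition facet_area :: "(real^'d) set \<Rightarrow> real" where
  "facet_area e = measure (hyperplane_measure (affine hull e)) e"

lemma facet_hyperplane:
  fixes K :: "(real^'d) set"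
  assumes "full_simplex K" "v \<in> vertices K"
  shows "affine hull (opposite_facet K v)
           = {x. (- (bary_grad K v /\<^sub>R norm (bary_grad K v))) \<bullet> x = bary_offset K v / norm (bary_grad K v)}"
  using bary_grad_nonzero[OF assms]
  by (auto simp: affine_hull_opposite_facet[OF assms] bary_coord_def field_simps)

lemma compact_opposite_facet: "full_simplex K \<Longrightarrow> compact (opposite_facet K v)"
  unfolding opposite_facet_def using full_simplex_vertices(1)
  by (intro finite_imp_compact_convex_hull) auto

lemma emeasure_facet:
  fixes K :: "(real^'d) set"
  assumes "full_simplex K" "v \<in> vertices K"
  shows "emeasure (hyperplane_measure (affine hull (opposite_facet K v))) (opposite_facet K v)
    = emeasure lborel (facet_cylinder (opposite_facet K v) (- (bary_grad K v /\<^sub>R norm (bary_grad K v))))"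
  using bary_grad_nonzero[OF assms]
  by (intro emeasure_hyperplane_measure[OF _ facet_hyperplane[OF assms]])
     (auto intro: compact_opposite_facet[OF assms(1)] hull_inc)

text \<open>The value of \<open>area * height / volume\<close>, which is \<open>d\<close> for every facet of every \<open>d\<close>-simplex, expressed
  through the simplex with apex \<open>0\<close> over the facet spanned by the unit vectors. The cylinder has the
  direction of the edge at \<open>0\<close> that belongs to an arbitrary coordinate.\<close>

definition facet_constant :: "'d::finite itself \<Rightarrow> real" where
  "facet_constant _ = measure lborel (facet_cylinder (convex hull (Basis :: (real^'d) set)) (axis undefined 1))
     / measure lborel (convex hull (insert 0 Basis :: (real^'d) set))"

context planar_or_spatial begin

text \<open>Both the simplex and the right cylinder over its facet are affine images of reference bodies:
  the simplex and an oblique cylinder over the facet are images under one affine map, and shearing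
  and stretching the oblique cylinder to a right one multiplies its volume by the height.\<close>

lemma facet_area_eq:
  fixes K :: "(real^'d) set"
  assumes K: "full_simplex K" and v: "v \<in> vertices K"
  shows "facet_area (opposite_facet K v) = facet_constant TYPE('d) * measure lborel K * norm (bary_grad K v)"
proof -
  note V = full_simplex_vertices[OF K]
  let ?e = "opposite_facet K v" and ?g = "bary_grad K v" and ?t = "bary_offset K v"
  let ?k = "undefined :: 'd"
  let ?B = "Basis :: (real^'d) set"
  define n where "n = - (?g /\<^sub>R norm ?g)"
  define b where "b = ?t / norm ?g"
  have g0: "norm ?g > 0" using bary_grad_nonzero[OF K v] by simp
  then have n1: "norm n = 1" by (simp add: n_def)
  then have nn: "n \<bullet> n = 1" by (simp add: norm_eq_1)
  have ce: "compact ?e" by (rule compact_opposite_facet[OF K])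
  have card: "card ?B = card (vertices K - {v})" using V(3) v by (simp add: V(1))
  obtain w where w: "bij_betw w ?B (vertices K - {v})"
    using finite_same_card_bij[OF finite_Basis _ card] V(1) by auto
  define f where "f x = (\<Sum>i\<in>?B. (x \<bullet> i) *\<^sub>R (w i - v))" for x :: "real^'d"
  have lf: "linear f" unfolding f_def
    by (rule linearI) (simp_all add: inner_add_left scaleR_add_left sum.distrib scaleR_sum_right)
  have f_Basis: "v + f i = w i" if "i \<in> ?B" for i
  proof -
    have "f i = (\<Sum>j\<in>?B. if j = i then w j - v else 0)"
      unfolding f_def using that by (intro sum.cong) (auto simp: inner_Basis)
    then show ?thesis using that by simp
  qed
  let ?\<phi> = "\<lambda>x. v + f x"
  have hull: "?\<phi> ` (convex hull X) = convex hull (?\<phi> ` X)" for X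
  proof -
    have "?\<phi> ` (convex hull X) = (+) v ` f ` (convex hull X)" by auto
    also have "\<dots> = (+) v ` (convex hull (f ` X))" by (simp add: convex_hull_linear_image[OF lf])
    also have "\<dots> = convex hull ((+) v ` f ` X)" by (simp add: convex_hull_translation)
    finally show ?thesis by (simp add: image_image)
  qed
  have imgB: "?\<phi> ` ?B = vertices K - {v}" using w f_Basis by (auto simp: bij_betw_def)
  have "?\<phi> ` insert 0 ?B = vertices K" using imgB v linear_0[OF lf] by auto
  then have imgK: "?\<phi> ` (convex hull (insert 0 ?B)) = K" unfolding hull using V(4) by simp
  have imge: "?\<phi> ` (convex hull ?B) = ?e" unfolding hull imgB opposite_facet_def ..
  have volK: "measure lborel K = volume_factor f * measure lborel (convex hull (insert 0 ?B))"
    unfolding imgK[symmetric]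
    by (rule measure_affine_image_factor[OF lf]) (auto intro: finite_imp_compact_convex_hull)
  define p where "p = w (axis ?k 1) - v"
  have ax: "axis ?k 1 \<in> ?B" by (simp add: axis_in_Basis_iff)
  have fax: "f (axis ?k 1) = p" using f_Basis[OF ax] by (simp add: p_def algebra_simps)
  have "?\<phi> ` facet_cylinder (convex hull ?B) (axis ?k 1) = facet_cylinder (?\<phi> ` (convex hull ?B)) p"
    unfolding facet_cylinder_def fax[symmetric]
    by (force simp: linear_add[OF lf] linear_cmul[OF lf] image_iff add.assoc)
  then have imgP: "?\<phi> ` facet_cylinder (convex hull ?B) (axis ?k 1) = facet_cylinder ?e p" unfolding imge .
  have volP: "measure lborel (facet_cylinder ?e p)
      = volume_factor f * measure lborel (facet_cylinder (convex hull ?B) (axis ?k 1))"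
    unfolding imgP[symmetric]
    by (rule measure_affine_image_factor[OF lf]) (auto intro!: compact_facet_cylinder finite_imp_compact_convex_hull)
  have onH: "n \<bullet> y = b" if "y \<in> ?e" for y
  proof -
    have "bary_coord K v y = 0" using that opposite_facet_eq[OF K v] by auto
    then have "bary_offset K v = - (?g \<bullet> y)" by (simp add: bary_coord_def)
    then show ?thesis by (simp add: n_def b_def divide_inverse mult.commute)
  qed
  have np: "n \<bullet> p = 1 / norm ?g"
  proof -
    have "w (axis ?k 1) \<in> vertices K - {v}" using w ax by (auto simp: bij_betw_def)
    then have "bary_coord K v (w (axis ?k 1)) = 0" "bary_coord K v v = 1"
      using bary_coord_vertex[OF K v] v by auto
    then have "?g \<bullet> p = -1" by (simp add: p_def bary_coord_def inner_diff_right)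
    then show ?thesis by (simp add: n_def divide_inverse)
  qed
  \<comment> \<open>\<open>?T\<close> fixes the facet up to a translation and tilts the normal \<open>n\<close> to \<open>p\<close>.\<close>
  let ?T = "\<lambda>x. x + (n \<bullet> x) *\<^sub>R (p - n)"
  have shift: "facet_cylinder ?e p = (\<lambda>x. (- b) *\<^sub>R (p - n) + ?T x) ` facet_cylinder ?e n"
  proof -
    have "(- b) *\<^sub>R (p - n) + ?T (y + s *\<^sub>R n) = y + s *\<^sub>R p" if "y \<in> ?e" for y s
      using onH[OF that] by (simp add: inner_add_right nn algebra_simps)
    then show ?thesis unfolding facet_cylinder_def image_image
      by (intro image_cong) auto
  qed
  have "measure lborel (facet_cylinder ?e p) = volume_factor ?T * measure lborel (facet_cylinder ?e n)"
    unfolding shift by (rule measure_affine_image_factor[OF linear_rank_one_update compact_facet_cylinder[OF ce]])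
  also have "volume_factor ?T = 1 / norm ?g"
    using g0 np nn by (subst volume_factor_rank_one_update[OF n1]) (auto simp: inner_diff_right)
  finally have cyl: "measure lborel (facet_cylinder ?e n) = norm ?g * measure lborel (facet_cylinder ?e p)"
    using g0 by simp
  have "measure lborel (convex hull (insert 0 ?B)) > 0"
    by (subst measure_def, subst emeasure_std_simplex) simp
  then have "measure lborel (facet_cylinder ?e p) = facet_constant TYPE('d) * measure lborel K"
    unfolding volP volK facet_constant_def by simp
  then show ?thesis
    unfolding facet_area_def measure_def[of "hyperplane_measure _"] emeasure_facet[OF K v]
    using cyl by (simp add: measure_def n_def)
qed

text \<open>The part of the reference simplex where the coordinates add up to more than \<open>1/2\<close> has interior
  points and lies in the cylinder: a point of it reaches the facet by a step of length at most \<open>1/2\<close>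
  along a unit vector.\<close>

lemma facet_constant_pos: "0 < facet_constant TYPE('d)"
proof -
  let ?B = "Basis :: (real^'d) set" and ?k = "undefined :: 'd"
  let ?P = "facet_cylinder (convex hull ?B) (axis ?k 1) :: (real^'d) set"
  have cP: "compact ?P" by (intro compact_facet_cylinder finite_imp_compact_convex_hull) simp
  define U where "U = {x::real^'d. (\<forall>i\<in>?B. 0 < x \<bullet> i) \<and> 1/2 < (\<Sum>i\<in>?B. x \<bullet> i) \<and> (\<Sum>i\<in>?B. x \<bullet> i) < 1}"
  have "U = (\<Inter>i\<in>?B. {x. 0 < x \<bullet> i}) \<inter> {x. 1/2 < (\<Sum>i\<in>?B. x \<bullet> i)} \<inter> {x. (\<Sum>i\<in>?B. x \<bullet> i) < 1}"
    by (auto simp: U_def)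
  then have "open U" by (auto intro!: open_Int open_INT open_Collect_less continuous_intros)
  moreover have "(\<Sum>i\<in>?B. (3 / (4 * real (card ?B))) *\<^sub>R i) \<in> U"
    unfolding U_def by (auto simp: inner_sum_left inner_Basis if_distrib cong: if_cong)
  ultimately obtain a r where r: "r > 0" "cball a r \<subseteq> U" using open_contains_cball by blast
  have "U \<subseteq> ?P"
  proof
    fix x assume x: "x \<in> U"
    define s where "s = (\<Sum>i\<in>?B. x \<bullet> i) - 1"
    let ?y = "x - s *\<^sub>R axis ?k 1"
    have s: "-1/2 \<le> s" "s < 0" using x by (auto simp: U_def s_def)
    have ax: "axis ?k 1 \<in> ?B" by (simp add: axis_in_Basis_iff)
    have yi: "?y \<bullet> i = x \<bullet> i - (if i = axis ?k 1 then s else 0)" if "i \<in> ?B" for i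
      using that ax by (auto simp: inner_diff_left inner_Basis)
    have "(\<Sum>i\<in>?B. ?y \<bullet> i) = (\<Sum>i\<in>?B. x \<bullet> i - (if i = axis ?k 1 then s else 0))"
      by (rule sum.cong) (auto simp only: yi)
    also have "\<dots> = 1" using ax by (simp add: sum_subtractf s_def)
    finally have "(\<Sum>i\<in>?B. ?y \<bullet> i) = 1" .
    moreover have "\<forall>i\<in>?B. 0 \<le> ?y \<bullet> i"
    proof
      fix i assume i: "i \<in> ?B"
      then have "0 < x \<bullet> i" using x by (simp add: U_def)
      then show "0 \<le> ?y \<bullet> i" unfolding yi[OF i] using s by (cases "i = axis ?k 1") simp_all
    qed
    ultimately have "?y \<in> convex hull ?B"
      by (auto simp: convex_hull_finite euclidean_representation intro!: exI[of _ "\<lambda>i. ?y \<bullet> i"])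
    then show "x \<in> ?P" unfolding facet_cylinder_def using s
      by (intro image_eqI[of _ _ "(?y, s)"]) auto
  qed
  have "0 < measure lborel (cball a r)" by (rule measure_cball_pos[OF r(1)])
  also have "\<dots> \<le> measure lborel ?P"
    using r(2) \<open>U \<subseteq> ?P\<close> cP
    by (intro measure_mono_fmeasurable) (auto intro: fmeasurable_compact borel_compact)
  finally show ?thesis unfolding facet_constant_def
    by (intro divide_pos_pos) (simp_all add: measure_def emeasure_std_simplex)
qed

end

section \<open>Integrals of continuous functions over compact sets\<close>

lemma set_integrable_continuous:
  fixes f :: "real^'d \<Rightarrow> real"
  assumes "sets M = sets borel" "compact S" "emeasure M S < \<infinity>" "continuous_on UNIV f"
  shows "set_integrable M S f"
proof -
  have "compact (f ` S)" using assms by (intro compact_continuous_image) (auto intro: continuous_on_subset)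
  then obtain B where B: "\<forall>y\<in>f ` S. norm y \<le> B" using compact_imp_bounded bounded_iff by metis
  have "S \<in> sets M" unfolding assms(1) by (rule borel_compact[OF assms(2)])
  moreover have "f \<in> borel_measurable M"
    using borel_measurable_continuous_onI[OF assms(4)] measurable_cong_sets[OF assms(1) refl] by blast
  ultimately show ?thesis unfolding set_integrable_def
    using assms(3) B by (intro integrableI_bounded_set_indicator[where B=B]) auto
qed

lemma emeasure_facet_finite:
  fixes K :: "(real^'d) set"
  assumes "full_simplex K" "v \<in> vertices K"
  shows "emeasure (hyperplane_measure (affine hull (opposite_facet K v))) (opposite_facet K v) < \<infinity>"
  unfolding emeasure_facet[OF assms]
  by (rule emeasure_compact_finite) (intro compact_facet_cylinder compact_opposite_facet assms)

lemma set_integrable_facet: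
  fixes K :: "(real^'d) set" and f :: "real^'d \<Rightarrow> real"
  assumes "full_simplex K" "v \<in> vertices K" "continuous_on UNIV f"
  shows "set_integrable (hyperplane_measure (affine hull (opposite_facet K v))) (opposite_facet K v) f"
  by (rule set_integrable_continuous[OF sets_hyperplane_measure compact_opposite_facet[OF assms(1)]
        emeasure_facet_finite[OF assms(1,2)] assms(3)])

lemma set_integral_le_measure:
  fixes f :: "real^'d \<Rightarrow> real"
  assumes "sets M = sets borel" "compact S" "emeasure M S < \<infinity>" "continuous_on UNIV f"
    and "\<And>x. x \<in> S \<Longrightarrow> f x \<le> B"
  shows "(LINT x:S|M. f x) \<le> B * measure M S"
proof -
  have S: "S \<in> sets M" unfolding assms(1) by (rule borel_compact[OF assms(2)])
  have "(LINT x:S|M. f x) \<le> (LINT x:S|M. B)"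
    using assms by (intro set_integral_mono set_integrable_continuous) auto
  also have "\<dots> = B * measure M S" using assms(3) S by (simp add: set_integral_const)
  finally show ?thesis .
qed

lemma abs_set_integral_le_measure:
  fixes f :: "real^'d \<Rightarrow> real"
  assumes "sets M = sets borel" "compact S" "emeasure M S < \<infinity>" "continuous_on UNIV f"
    and "\<And>x. x \<in> S \<Longrightarrow> \<bar>f x\<bar> \<le> B"
  shows "\<bar>LINT x:S|M. f x\<bar> \<le> B * measure M S"
proof -
  have "(LINT x:S|M. f x) \<le> B * measure M S"
    by (intro set_integral_le_measure assms(1-4)) (use assms(5) in force)
  moreover have "(LINT x:S|M. - f x) \<le> B * measure M S"
    by (intro set_integral_le_measure assms(1-3) continuous_on_minus assms(4)) (use assms(5) in force)
  moreover have "(LINT x:S|M. - f x) = - (LINT x:S|M. f x)" by (simp add: set_lebesgue_integral_def)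
  ultimately show ?thesis by linarith
qed

section \<open>Quasi-uniform meshes\<close>

locale quasi_uniform_mesh = planar_or_spatial "TYPE('d::finite)" +
  fixes \<Omega> :: "(real^'d) set" and \<T> :: "(real^'d) set set" and C\<sigma> :: real
  assumes domain: "convex_polyhedral_domain \<Omega>"
    and mesh: "simplicial_mesh \<Omega> \<T>"
    and C\<sigma>_pos: "0 < C\<sigma>"
    and quasi_uniform: "mesh_size \<T> \<le> C\<sigma> * mesh_inradius \<T>"
begin

abbreviation h :: real where "h \<equiv> mesh_size \<T>"
abbreviation \<kappa> :: real where "\<kappa> \<equiv> 2 * C\<sigma>"

text \<open>Half the smallest inradius lies strictly below each of the suprema that define the inradii, so
  every element contains a ball of this radius.\<close>

definition ball_radius :: real where "ball_radius = mesh_inradius \<T> / 2"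

lemma finite_mesh: "finite \<T>"
  and element_simplex: "K \<in> \<T> \<Longrightarrow> full_simplex K"
  and mesh_cover: "\<Union>\<T> = closure \<Omega>"
  and intersection_face: "K \<in> \<T> \<Longrightarrow> K' \<in> \<T> \<Longrightarrow> (K \<inter> K') face_of K"
  using mesh unfolding simplicial_mesh_def triangulation_def by blast+

lemma mesh_nonempty: "\<T> \<noteq> {}"
proof
  assume "\<T> = {}"
  then have "closure \<Omega> = {}" using mesh_cover by simp
  then show False using domain by (simp add: convex_polyhedral_domain_def)
qed

lemma diameter_le_h: "K \<in> \<T> \<Longrightarrow> diameter K \<le> h"
  unfolding mesh_size_def using finite_mesh by (intro Max_ge) auto

lemma inradius_pos:
  fixes K :: "(real^'d) set"
  assumes "full_simplex K"
  shows "0 < inradius K" "\<And>r. r < inradius K \<Longrightarrow> 0 \<le> r \<Longrightarrow> \<exists>a. cball a r \<subseteq> K"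
proof -
  let ?R = "{r. 0 \<le> r \<and> (\<exists>x. cball x r \<subseteq> K)}"
  obtain e where e: "e > 0" "cball (barycenter K) e \<subseteq> K"
    using barycenter_in_interior[OF assms] by (meson interior_subset open_contains_cball open_interior order_trans)
  obtain v where v: "v \<in> vertices K" using full_simplex_vertices(3)[OF assms] by fastforce
  have g: "norm (bary_grad K v) > 0" using bary_grad_nonzero[OF assms v] by simp
  have "bdd_above ?R"
  proof (rule bdd_aboveI)
    fix r assume "r \<in> ?R"
    then have "2 * r * norm (bary_grad K v) \<le> 1" using bary_grad_upper[OF assms v] by auto
    then show "r \<le> 1 / (2 * norm (bary_grad K v))" using g by (simp add: field_simps)
  qed
  moreover have "e \<in> ?R" using e by auto
  ultimately have "e \<le> inradius K" unfolding inradius_def by (intro cSup_upper)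
  then show "0 < inradius K" using e by simp
  show "\<exists>a. cball a r \<subseteq> K" if r: "r < inradius K" "0 \<le> r" for r
  proof -
    obtain r' where "r' \<in> ?R" "r < r'"
      using less_cSupE[of r ?R] r(1) \<open>e \<in> ?R\<close> unfolding inradius_def by blast
    moreover have "cball x r \<subseteq> cball x r'" for x :: "real^'d" using \<open>r < r'\<close> by (intro subset_cball) simp
    ultimately show ?thesis by blast
  qed
qed

lemma ball_radius_pos: "0 < ball_radius"
  and inscribed_ball: "K \<in> \<T> \<Longrightarrow> \<exists>a. cball a ball_radius \<subseteq> K"
proof -
  have "mesh_inradius \<T> \<in> inradius ` \<T>" unfolding mesh_inradius_def
    using finite_mesh mesh_nonempty by (intro Min_in) auto
  then have pos: "0 < mesh_inradius \<T>" using inradius_pos(1) element_simplex by auto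
  then show r: "0 < ball_radius" by (simp add: ball_radius_def)
  show "\<exists>a. cball a ball_radius \<subseteq> K" if K: "K \<in> \<T>"
  proof -
    have "mesh_inradius \<T> \<le> inradius K" unfolding mesh_inradius_def using finite_mesh K by (intro Min_le) auto
    then have "ball_radius < inradius K" using pos by (simp add: ball_radius_def)
    then show ?thesis using inradius_pos(2)[OF element_simplex[OF K]] r by simp
  qed
qed

lemma h_le: "h \<le> \<kappa> * ball_radius"
  using quasi_uniform by (simp add: ball_radius_def)

definition center :: "(real^'d) set \<Rightarrow> real^'d" where
  "center K = (SOME a. cball a ball_radius \<subseteq> K)"

lemma center_ball: "K \<in> \<T> \<Longrightarrow> cball (center K) ball_radius \<subseteq> K"
  unfolding center_def by (rule someI_ex[OF inscribed_ball])

lemma center_in: "K \<in> \<T> \<Longrightarrow> center K \<in> K"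
  using center_ball ball_radius_pos by fastforce

lemma element_dist: "K \<in> \<T> \<Longrightarrow> x \<in> K \<Longrightarrow> y \<in> K \<Longrightarrow> dist x y \<le> h"
  using diameter_bounded_bound[of K x y] diameter_le_h[of K]
    compact_imp_bounded[OF simplex_compact_convex(1)[OF element_simplex]] by force

lemma element_subset_ball: "K \<in> \<T> \<Longrightarrow> x \<in> K \<Longrightarrow> K \<subseteq> cball x h"
  using element_dist by auto

lemma element_subset_center_ball: "K \<in> \<T> \<Longrightarrow> K \<subseteq> cball (center K) (\<kappa> * ball_radius)"
  using element_subset_ball[OF _ center_in] h_le by fastforce

lemma two_ball_radius_le_h: "2 * ball_radius \<le> h"
proof -
  obtain K where K: "K \<in> \<T>" using mesh_nonempty by auto
  obtain v where v: "v \<in> vertices K"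
    using full_simplex_vertices(3)[OF element_simplex[OF K]] by fastforce
  have g: "norm (bary_grad K v) > 0" using bary_grad_nonzero[OF element_simplex[OF K] v] by simp
  have "norm (bary_grad K v) * (2 * ball_radius) \<le> 1"
    using bary_grad_upper[OF element_simplex[OF K] v center_ball[OF K]] ball_radius_pos by (simp add: mult_ac)
  also have "1 \<le> norm (bary_grad K v) * diameter K" by (rule bary_grad_lower[OF element_simplex[OF K] v])
  also have "\<dots> \<le> norm (bary_grad K v) * h" using diameter_le_h[OF K] by (intro mult_left_mono) auto
  finally show ?thesis using g by simp
qed

lemma h_pos: "0 < h"
  using two_ball_radius_le_h ball_radius_pos by linarith

lemma h_div_le: "h / \<kappa> \<le> ball_radius"
  using h_le C\<sigma>_pos by (simp add: field_simps)

definition unit_volume :: real where "unit_volume = unit_ball_vol (real CARD('d))"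

lemma unit_volume_pos [simp]: "0 < unit_volume" and unit_volume_nonneg [simp]: "0 \<le> unit_volume"
  by (simp_all add: unit_volume_def)

lemma measure_cball_cart: "0 \<le> r \<Longrightarrow> measure lborel (cball (a::real^'d) r) = unit_volume * r ^ CARD('d)"
  using content_cball[of r a] by (simp add: unit_volume_def)

lemma element_volume_le:
  assumes "K \<in> \<T>" shows "measure lborel K \<le> unit_volume * h ^ CARD('d)"
proof -
  have "measure lborel K \<le> measure lborel (cball (center K) h)"
    using element_subset_ball[OF assms center_in[OF assms]] simplex_compact_convex(1)[OF element_simplex[OF assms]]
    by (intro measure_mono_fmeasurable) (auto intro: borel_compact fmeasurable_compact)
  then show ?thesis using h_pos by (simp add: measure_cball_cart)
qed

lemma ball_volume_ge: "unit_volume * (h / \<kappa>) ^ CARD('d) \<le> unit_volume * ball_radius ^ CARD('d)"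
  using h_div_le h_pos C\<sigma>_pos by (intro mult_left_mono power_mono) auto

lemma element_volume_ge:
  assumes "K \<in> \<T>" shows "unit_volume * (h / \<kappa>) ^ CARD('d) \<le> measure lborel K"
proof -
  have "unit_volume * ball_radius ^ CARD('d) = measure lborel (cball (center K) ball_radius)"
    using ball_radius_pos by (simp add: measure_cball_cart)
  also have "\<dots> \<le> measure lborel K"
    using center_ball[OF assms] simplex_compact_convex(1)[OF element_simplex[OF assms]]
    by (intro measure_mono_fmeasurable) (auto intro: borel_compact fmeasurable_compact)
  finally show ?thesis using ball_volume_ge by linarith
qed

lemma aff_dim_element: "K \<in> \<T> \<Longrightarrow> aff_dim K = int CARD('d)"
  using aff_dim_simplex[OF element_simplex] .

text \<open>A proper face misses the interior, and \<open>K\<close> cannot be contained in \<open>K'\<close>: it would be a proper face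
  of \<open>K'\<close>, hence of smaller dimension.\<close>

lemma interior_disjoint:
  assumes "K \<in> \<T>" "K' \<in> \<T>" "K \<noteq> K'" shows "interior K \<inter> K' = {}"
proof -
  have "K \<inter> K' \<noteq> K"
  proof
    assume "K \<inter> K' = K"
    then have "K face_of K'" using intersection_face[OF assms(2,1)] by (simp add: Int_commute)
    then have "aff_dim K < aff_dim K'"
      using face_of_aff_dim_lt[of K' K] assms simplex_compact_convex(2)[OF element_simplex] by blast
    then show False using aff_dim_element assms by simp
  qed
  then have "(K \<inter> K') \<inter> interior K = {}"
    by (rule face_of_disjoint_interior[OF intersection_face[OF assms(1,2)]])
  then show ?thesis using interior_subset by blast
qed

lemma barycenter_mem_iff:
  "K \<in> \<T> \<Longrightarrow> K' \<in> \<T> \<Longrightarrow> barycenter K \<in> K' \<longleftrightarrow> K = K'"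
  using interior_disjoint[of K K'] barycenter_in_interior[OF element_simplex, of K]
    barycenter_in_simplex[OF element_simplex, of K] by blast

subsection \<open>Faces\<close>

definition face_elements :: "(real^'d) set \<Rightarrow> (real^'d) set set" where
  "face_elements e = {K. K \<in> \<T> \<and> e facet_of K}"

abbreviation faces :: "(real^'d) set set" where "faces \<equiv> mesh_faces \<Omega> \<T>"

lemma face_elements_subset: "face_elements e \<subseteq> \<T>" and finite_face_elements: "finite (face_elements e)"
  using finite_mesh by (auto simp: face_elements_def)

lemma face_elements_nonempty: "e \<in> faces \<Longrightarrow> face_elements e \<noteq> {}"
  by (auto simp: mesh_faces_def interior_faces_def boundary_faces_def face_elements_def)

lemma facet_vertex:
  assumes "K \<in> face_elements e"
  obtains v where "v \<in> vertices K" "e = opposite_facet K v"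
  using assms facet_of_simplex_iff[OF element_simplex] by (auto simp: face_elements_def)

lemma opposite_normals:
  assumes "K \<in> face_elements e" "K' \<in> face_elements e" "K \<noteq> K'"
  shows "outward_normal K' e = - outward_normal K e"
proof -
  obtain v where v: "v \<in> vertices K" "e = opposite_facet K v" using facet_vertex[OF assms(1)] .
  obtain v' where v': "v' \<in> vertices K'" "e = opposite_facet K' v'" using facet_vertex[OF assms(2)] .
  have K: "K \<in> \<T>" "full_simplex K" and K': "K' \<in> \<T>" "full_simplex K'"
    using assms element_simplex by (auto simp: face_elements_def)
  obtain s where s: "s < 0" "bary_grad K' v' = s *\<^sub>R bary_grad K v"
    using shared_facet_opposite_sides[OF K(2) v(1) K'(2) v'(1) _ interior_disjoint[OF K(1) K'(1) assms(3)]] v(2) v'(2) by metis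
  have "outward_normal K' e = - ((s *\<^sub>R bary_grad K v) /\<^sub>R norm (s *\<^sub>R bary_grad K v))"
    using outward_normal_opposite_facet[OF K'(2) v'(1)] v'(2) s(2) by simp
  also have "\<dots> = bary_grad K v /\<^sub>R norm (bary_grad K v)" using s(1) by simp
  also have "\<dots> = - outward_normal K e"
    using outward_normal_opposite_facet[OF K(2) v(1)] v(2) by simp
  finally show ?thesis .
qed

lemma norm_outward_normal:
  assumes "K \<in> face_elements e" shows "norm (outward_normal K e) = 1"
proof -
  obtain v where v: "v \<in> vertices K" "e = opposite_facet K v" using facet_vertex[OF assms] .
  have "full_simplex K" using assms element_simplex by (auto simp: face_elements_def)
  then show ?thesis unfolding v(2) outward_normal_opposite_facet[OF \<open>full_simplex K\<close> v(1)]
    using bary_grad_nonzero[OF _ v(1)] by simp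
qed

text \<open>The normals of two elements on a common face are opposite, which rules out a third element.\<close>

lemma face_elements_cases:
  assumes "e \<in> faces"
  obtains (one) K where "face_elements e = {K}"
  | (two) K K' where "K \<noteq> K'" "face_elements e = {K, K'}" "outward_normal K' e = - outward_normal K e"
proof -
  obtain K where K: "K \<in> face_elements e" using face_elements_nonempty[OF assms] by blast
  show ?thesis
  proof (cases "face_elements e = {K}")
    case True then show ?thesis by (rule one)
  next
    case False
    then obtain K' where K': "K' \<in> face_elements e" "K' \<noteq> K" using K by blast
    have "K'' \<in> {K, K'}" if "K'' \<in> face_elements e" for K''
    proof (rule ccontr)
      assume "K'' \<notin> {K, K'}"
      then have ne: "K \<noteq> K''" "K' \<noteq> K''" "K \<noteq> K'" using K'(2) by blast+
      have "outward_normal K e = - outward_normal K e"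
        using opposite_normals[OF K K'(1) ne(3)] opposite_normals[OF K that ne(1)] opposite_normals[OF K'(1) that ne(2)]
        by (metis minus_minus)
      then have "outward_normal K e = 0" by (simp add: Finite_Cartesian_Product.vec_eq_iff)
      then show False using norm_outward_normal[OF K] by simp
    qed
    then have "face_elements e = {K, K'}" using K K' by blast
    moreover have "K \<noteq> K'" using K'(2) by simp
    ultimately show ?thesis using two opposite_normals[OF K K'(1)] by simp
  qed
qed

lemma card_face_elements: "e \<in> faces \<Longrightarrow> card (face_elements e) \<le> 2"
  by (erule face_elements_cases) (simp_all add: card_insert_if)

text \<open>Let \<open>y\<close> be a relative interior point of the facet that lies inside the domain. Points just outside
  of \<open>K\<close> near \<open>y\<close> belong to the finitely many other elements, so one of these contains \<open>y\<close>. Its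
  intersection with \<open>K\<close> is a proper face of \<open>K\<close> that meets the relative interior of the facet, so it is
  the facet.\<close>

lemma facet_in_faces:
  assumes K: "K \<in> \<T>" and eK: "e facet_of K"
  shows "e \<in> faces"
proof (cases "e \<subseteq> frontier \<Omega>")
  case True then show ?thesis using assms by (auto simp: mesh_faces_def boundary_faces_def)
next
  case False
  have sK: "full_simplex K" by (rule element_simplex[OF K])
  obtain v where v: "v \<in> vertices K" "e = opposite_facet K v"
    using eK facet_of_simplex_iff[OF sK] by auto
  have "open \<Omega>" using domain by (simp add: convex_polyhedral_domain_def)
  obtain x where x: "x \<in> e" "x \<notin> frontier \<Omega>" using False by auto
  have "e \<subseteq> K" using eK by (rule facet_of_imp_subset)
  then have "x \<in> closure \<Omega>" using x(1) K mesh_cover by auto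
  then have "x \<in> \<Omega>" using x(2) \<open>open \<Omega>\<close> by (simp add: frontier_def interior_open)
  have ce: "convex e" using v(2) by (simp add: opposite_facet_def)
  have "x \<in> closure (rel_interior e)"
    using x(1) convex_closure_rel_interior[OF ce] closure_subset by auto
  then obtain y where y: "y \<in> rel_interior e" "y \<in> \<Omega>"
    using \<open>x \<in> \<Omega>\<close> open_Int_closure_eq_empty[OF \<open>open \<Omega>\<close>, of "rel_interior e"] by blast
  have "y \<in> e" using y(1) rel_interior_subset by auto
  obtain \<delta> where \<delta>: "\<delta> > 0" "ball y \<delta> \<subseteq> \<Omega>" using y(2) \<open>open \<Omega>\<close> by (auto simp: open_contains_ball)
  let ?g = "bary_grad K v"
  let ?U = "\<Union>(\<T> - {K})"
  have "y \<in> closure ?U"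
    unfolding closure_approachable
  proof (intro allI impI)
    fix \<epsilon> :: real assume "\<epsilon> > 0"
    define t where "t = min \<delta> \<epsilon> / (2 * norm ?g)"
    have g0: "norm ?g > 0" using bary_grad_nonzero[OF sK v(1)] by simp
    then have t: "t > 0" "t * norm ?g < \<delta>" "t * norm ?g < \<epsilon>" using \<delta>(1) \<open>\<epsilon> > 0\<close> by (auto simp: t_def min_def)
    let ?z = "y - t *\<^sub>R ?g"
    have d: "dist ?z y = t * norm ?g" using t(1) by (simp add: dist_norm)
    have "?z \<in> \<Omega>" using \<delta>(2) d t(2) by (auto simp: dist_commute)
    then have "?z \<in> \<Union>\<T>" using mesh_cover closure_subset by blast
    moreover have "?z \<notin> K"
    proof -
      have "bary_coord K v y = 0" using \<open>y \<in> e\<close> v opposite_facet_eq[OF sK v(1)] by auto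
      then have "bary_coord K v ?z = - (t * (?g \<bullet> ?g))" by (simp add: bary_coord_def inner_diff_right)
      also have "\<dots> < 0" using t(1) g0 by simp
      finally show ?thesis using mem_simplex_iff[OF sK] v(1) by force
    qed
    ultimately show "\<exists>z\<in>?U. dist z y < \<epsilon>" using d t(3) by (intro bexI[of _ ?z]) auto
  qed
  moreover have "closed ?U" using finite_mesh simplex_compact_convex(4)[OF element_simplex] by (intro closed_Union) auto
  ultimately obtain K' where K': "K' \<in> \<T>" "K' \<noteq> K" "y \<in> K'" by auto
  let ?F = "K \<inter> K'"
  have F: "?F face_of K" by (rule intersection_face[OF K K'(1)])
  have eF: "e \<subseteq> ?F"
    by (rule subset_of_face_of[OF F \<open>e \<subseteq> K\<close>]) (use y(1) \<open>y \<in> e\<close> \<open>e \<subseteq> K\<close> K'(3) in blast)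
  have "?F \<noteq> K"
    using barycenter_mem_iff[OF K K'(1)] K'(2) barycenter_in_simplex[OF sK] by blast
  then have "aff_dim ?F < aff_dim K" by (rule face_of_aff_dim_lt[OF simplex_compact_convex(2)[OF sK] F])
  have "e face_of ?F" by (rule face_of_subset[OF facet_of_imp_face_of[OF eK] eF Int_lower1])
  have "aff_dim e = aff_dim K - 1" using eK by (simp add: facet_of_def)
  have "e = ?F"
  proof (rule ccontr)
    assume "e \<noteq> ?F"
    then have "aff_dim e < aff_dim ?F"
      by (rule face_of_aff_dim_lt[OF face_of_imp_convex[OF F] \<open>e face_of ?F\<close>])
    then show False using \<open>aff_dim e = aff_dim K - 1\<close> \<open>aff_dim ?F < aff_dim K\<close> by linarith
  qed
  moreover have "?F face_of K'" using intersection_face[OF K'(1) K] by (simp add: Int_commute)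
  ultimately have "e facet_of K'"
    using eK aff_dim_element[OF K] aff_dim_element[OF K'(1)] by (simp add: facet_of_def)
  then show ?thesis using K K' eK by (auto simp: mesh_faces_def interior_faces_def)
qed

lemma finite_faces: "finite faces"
proof -
  have "faces \<subseteq> (\<Union>K\<in>\<T>. opposite_facet K ` vertices K)"
    using facet_of_simplex_iff[OF element_simplex]
    by (fastforce simp: mesh_faces_def interior_faces_def boundary_faces_def)
  moreover have "finite (\<Union>K\<in>\<T>. opposite_facet K ` vertices K)"
    using finite_mesh full_simplex_vertices(1)[OF element_simplex] by auto
  ultimately show ?thesis by (rule finite_subset)
qed

lemma sum_faces_elements:
  fixes F :: "(real^'d) set \<Rightarrow> (real^'d) set \<Rightarrow> real"
  shows "(\<Sum>e\<in>faces. \<Sum>K\<in>face_elements e. F K e) = (\<Sum>K\<in>\<T>. \<Sum>v\<in>vertices K. F K (opposite_facet K v))"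
proof -
  have "(\<Sum>e\<in>faces. \<Sum>K\<in>face_elements e. F K e) = (\<Sum>K\<in>\<T>. \<Sum>e | e \<in> faces \<and> e facet_of K. F K e)"
    unfolding face_elements_def by (rule sum.swap_restrict[OF finite_faces finite_mesh])
  also have "\<dots> = (\<Sum>K\<in>\<T>. \<Sum>v\<in>vertices K. F K (opposite_facet K v))"
  proof (rule sum.cong[OF refl])
    fix K assume K: "K \<in> \<T>"
    have "{e \<in> faces. e facet_of K} = opposite_facet K ` vertices K"
      using facet_in_faces[OF K] facet_of_simplex_iff[OF element_simplex[OF K]] by auto
    moreover have "inj_on (opposite_facet K) (vertices K)"
      using opposite_facet_inj[OF element_simplex[OF K]] by (auto intro: inj_onI)
    ultimately show "(\<Sum>e | e \<in> faces \<and> e facet_of K. F K e) = (\<Sum>v\<in>vertices K. F K (opposite_facet K v))"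
      by (simp add: sum.reindex)
  qed
  finally show ?thesis .
qed

lemma sum_faces_elements_const:
  "(\<Sum>e\<in>faces. \<Sum>K\<in>face_elements e. F K) = (real CARD('d) + 1) * (\<Sum>K\<in>\<T>. F K)"
  unfolding sum_faces_elements
  by (simp add: full_simplex_vertices(3)[OF element_simplex] sum_distrib_left add.commute cong: sum.cong)

lemma face_subset_element: "K \<in> face_elements e \<Longrightarrow> e \<subseteq> K"
  by (auto simp: face_elements_def dest: facet_of_imp_subset)

lemma face_integrable:
  assumes "e \<in> faces" "continuous_on UNIV (f :: real^'d \<Rightarrow> real)"
  shows "set_integrable (hyperplane_measure (affine hull e)) e f"
proof -
  obtain K where K: "K \<in> face_elements e" using face_elements_nonempty[OF assms(1)] by blast
  obtain v where v: "v \<in> vertices K" "e = opposite_facet K v" using facet_vertex[OF K] .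
  show ?thesis unfolding v(2) using K element_simplex assms(2)
    by (intro set_integrable_facet[OF _ v(1)]) (auto simp: face_elements_def)
qed

lemma face_compact_finite:
  assumes "e \<in> faces"
  shows "compact e" "emeasure (hyperplane_measure (affine hull e)) e < \<infinity>"
proof -
  obtain K where K: "K \<in> face_elements e" using face_elements_nonempty[OF assms(1)] by blast
  obtain v where v: "v \<in> vertices K" "e = opposite_facet K v" using facet_vertex[OF K] .
  have sK: "full_simplex K" using K element_simplex by (auto simp: face_elements_def)
  show "compact e" "emeasure (hyperplane_measure (affine hull e)) e < \<infinity>"
    unfolding v(2) by (rule compact_opposite_facet[OF sK], rule emeasure_facet_finite[OF sK v(1)])
qed

lemma face_diameter:
  assumes "e \<in> faces"
  shows "h / C\<sigma> \<le> diameter e" "diameter e \<le> h" "0 < diameter e"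
proof -
  obtain K where K: "K \<in> face_elements e" using face_elements_nonempty[OF assms(1)] by blast
  obtain v where v: "v \<in> vertices K" "e = opposite_facet K v" using facet_vertex[OF K] .
  have sK: "K \<in> \<T>" "full_simplex K" using K element_simplex by (auto simp: face_elements_def)
  have "2 * ball_radius \<le> diameter e"
    unfolding v(2) using dim ball_radius_pos
    by (intro diameter_opposite_facet_ge[OF sK(2) v(1) center_ball[OF sK(1)]]) auto
  moreover have "h / C\<sigma> = 2 * (h / \<kappa>)" using C\<sigma>_pos by simp
  ultimately show "h / C\<sigma> \<le> diameter e" using h_div_le by linarith
  then show "0 < diameter e" using h_pos C\<sigma>_pos by (meson divide_pos_pos less_le_trans)
  have "diameter e \<le> diameter K"
    using face_subset_element[OF K] simplex_compact_convex(1)[OF sK(2)] compact_imp_bounded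
    by (intro diameter_subset) auto
  then show "diameter e \<le> h" using diameter_le_h[OF sK(1)] by linarith
qed

text \<open>The area of a face is proportional to volume over height, that is, comparable to \<open>h\<^sup>d / h\<close>. The
  bounds are stated for \<open>h\<close> times the area, which avoids the exponent \<open>d - 1\<close>.\<close>

definition area_lower :: real where
  "area_lower = facet_constant TYPE('d) * unit_volume / \<kappa> ^ CARD('d)"

definition area_upper :: real where
  "area_upper = facet_constant TYPE('d) * unit_volume * C\<sigma>"

lemma area_bounds_pos: "0 < area_lower" "0 < area_upper"
  using facet_constant_pos C\<sigma>_pos by (simp_all add: area_lower_def area_upper_def)

lemma face_area:
  assumes "e \<in> faces"
  shows "area_lower * h ^ CARD('d) \<le> h * facet_area e" "h * facet_area e \<le> area_upper * h ^ CARD('d)"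
proof -
  obtain K where K: "K \<in> face_elements e" using face_elements_nonempty[OF assms(1)] by blast
  obtain v where v: "v \<in> vertices K" "e = opposite_facet K v" using facet_vertex[OF K] .
  have sK: "K \<in> \<T>" "full_simplex K" using K element_simplex by (auto simp: face_elements_def)
  let ?g = "norm (bary_grad K v)"
  have A: "facet_area e = facet_constant TYPE('d) * measure lborel K * ?g"
    unfolding v(2) by (rule facet_area_eq[OF sK(2) v(1)])
  have c: "0 \<le> facet_constant TYPE('d)" using facet_constant_pos by simp
  have "1 \<le> ?g * diameter K" by (rule bary_grad_lower[OF sK(2) v(1)])
  also have "\<dots> \<le> ?g * h" using diameter_le_h[OF sK(1)] by (intro mult_left_mono) auto
  finally have gl: "1 \<le> h * ?g" by (simp add: mult.commute)
  have "2 * (h / \<kappa>) * ?g \<le> 2 * ball_radius * ?g" using h_div_le by (intro mult_right_mono) auto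
  also have "\<dots> \<le> 1" using bary_grad_upper[OF sK(2) v(1) center_ball[OF sK(1)]] ball_radius_pos by simp
  finally have gu: "h * ?g \<le> C\<sigma>" using C\<sigma>_pos by (simp add: field_simps)
  have "area_lower * h ^ CARD('d) = facet_constant TYPE('d) * (unit_volume * (h / \<kappa>) ^ CARD('d)) * 1"
    by (simp add: area_lower_def power_divide)
  also have "\<dots> \<le> facet_constant TYPE('d) * measure lborel K * (h * ?g)"
    using element_volume_ge[OF sK(1)] c gl h_pos C\<sigma>_pos by (intro mult_mono mult_left_mono) auto
  finally show "area_lower * h ^ CARD('d) \<le> h * facet_area e" by (simp add: A mult_ac)
  have "facet_constant TYPE('d) * measure lborel K * (h * ?g) \<le> facet_constant TYPE('d) * (unit_volume * h ^ CARD('d)) * C\<sigma>"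
    using element_volume_le[OF sK(1)] c gu h_pos C\<sigma>_pos by (intro mult_mono mult_left_mono) auto
  then show "h * facet_area e \<le> area_upper * h ^ CARD('d)" by (simp add: A area_upper_def mult_ac)
qed

lemma facet_area_nonneg: "0 \<le> facet_area e"
  by (simp add: facet_area_def)

subsection \<open>Patches\<close>

lemma patch_layer_bounds:
  assumes "K \<in> \<T>" "K' \<in> patch_layer \<T> t K"
  shows "K' \<in> \<T> \<and> (\<forall>x\<in>K. \<forall>y\<in>K'. dist x y \<le> (real t + 1) * h)"
  using assms(2)
proof (induction t arbitrary: K')
  case 0 then show ?case using assms(1) element_dist by auto
next
  case (Suc t)
  then obtain K'' where K'': "K'' \<in> patch_layer \<T> t K" "K' \<in> \<T>" "K'' \<inter> K' \<noteq> {}"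
    by (auto simp: neighbours_def)
  then obtain z where z: "z \<in> K''" "z \<in> K'" by blast
  have "dist x y \<le> (real (Suc t) + 1) * h" if "x \<in> K" "y \<in> K'" for x y
  proof -
    have "dist x y \<le> dist x z + dist z y" by (rule dist_triangle)
    also have "\<dots> \<le> (real t + 1) * h + h"
      using Suc.IH[OF K''(1)] that z element_dist[OF K''(2) z(2) that(2)] by (intro add_mono) auto
    finally show ?thesis by (simp add: algebra_simps)
  qed
  then show ?case using K'' by blast
qed

lemma patch_layer_mono_step:
  assumes "K \<in> \<T>" shows "patch_layer \<T> t K \<subseteq> patch_layer \<T> (Suc t) K"
proof
  fix K' assume K': "K' \<in> patch_layer \<T> t K"
  then have "K' \<in> \<T>" using patch_layer_bounds[OF assms] by blast
  then have "K' \<noteq> {}" using simplex_compact_convex(3)[OF element_simplex] by blast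
  then have "K' \<in> neighbours \<T> K'" using \<open>K' \<in> \<T>\<close> by (auto simp: neighbours_def)
  then show "K' \<in> patch_layer \<T> (Suc t) K" using K' by auto
qed

text \<open>Layers grow strictly until they become stationary, so the threshold is reached after at most
  as many layers as its value.\<close>

lemma patch_layer_count:
  assumes "K \<in> \<T>" "\<exists>t. s \<le> card (patch_layer \<T> t K)"
  shows "(LEAST t. s \<le> card (patch_layer \<T> t K)) \<le> s"
proof -
  define \<tau> where "\<tau> = (LEAST t. s \<le> card (patch_layer \<T> t K))"
  have \<tau>: "s \<le> card (patch_layer \<T> \<tau> K)" unfolding \<tau>_def using assms(2) by (rule LeastI_ex)
  have small: "card (patch_layer \<T> t K) < s" if "t < \<tau>" for t
    using not_less_Least[of t "\<lambda>t. s \<le> card (patch_layer \<T> t K)"] that unfolding \<tau>_def by simp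
  have fin: "finite (patch_layer \<T> t K)" for t
    using patch_layer_bounds[OF assms(1)] by (intro finite_subset[OF _ finite_mesh] subsetI) simp
  have strict: "patch_layer \<T> t K \<noteq> patch_layer \<T> (Suc t) K" if "t < \<tau>" for t
  proof
    assume eq: "patch_layer \<T> t K = patch_layer \<T> (Suc t) K"
    have "patch_layer \<T> (t + k) K = patch_layer \<T> t K" for k
    proof (induction k)
      case (Suc k)
      have "patch_layer \<T> (t + Suc k) K = (\<Union>K'\<in>patch_layer \<T> (t + k) K. neighbours \<T> K')" by simp
      also have "\<dots> = patch_layer \<T> (Suc t) K" unfolding Suc.IH by simp
      also have "\<dots> = patch_layer \<T> t K" by (rule eq[symmetric])
      finally show ?case .
    qed simp
    from this[of "\<tau> - t"] have "patch_layer \<T> \<tau> K = patch_layer \<T> t K" using that by simp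
    then show False using small[OF that] \<tau> by simp
  qed
  have grow: "t < card (patch_layer \<T> t K)" if "t \<le> \<tau>" for t
    using that
  proof (induction t)
    case (Suc t)
    have "patch_layer \<T> t K \<subset> patch_layer \<T> (Suc t) K"
      using patch_layer_mono_step[OF assms(1)] strict Suc.prems by (simp add: psubset_eq)
    then have "card (patch_layer \<T> t K) < card (patch_layer \<T> (Suc t) K)"
      using fin by (intro psubset_card_mono)
    then show ?case using Suc by simp
  qed simp
  show ?thesis
  proof (cases \<tau>)
    case (Suc t)
    then have "t < s" using grow[of t] small[of t] by linarith
    then show ?thesis using Suc by (simp add: \<tau>_def)
  qed (simp add: \<tau>_def)
qed

text \<open>The inscribed balls of the elements are disjoint and fill a fixed part of the larger ball.\<close>

lemma card_elements_in_ball: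
  assumes "\<A> \<subseteq> \<T>" "\<And>K. K \<in> \<A> \<Longrightarrow> K \<subseteq> cball y (c * h)" "0 \<le> c"
  shows "real (card \<A>) \<le> (c * \<kappa>) ^ CARD('d)"
proof -
  have fin: "finite \<A>" using assms(1) finite_mesh finite_subset by blast
  let ?B = "\<lambda>K. ball (center K) ball_radius"
  have sub: "?B K \<subseteq> interior K" if "K \<in> \<A>" for K
  proof (rule interior_maximal[OF _ open_ball])
    show "?B K \<subseteq> K" using center_ball[of K] assms(1) that ball_subset_cball by blast
  qed
  have disj: "disjoint_family_on ?B \<A>" unfolding disjoint_family_on_def
  proof (intro ballI impI)
    fix K K' assume "K \<in> \<A>" "K' \<in> \<A>" "K \<noteq> K'"
    then show "?B K \<inter> ?B K' = {}"
      using sub interior_disjoint[of K K'] assms(1) interior_subset by blast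
  qed
  have "real (card \<A>) * (unit_volume * ball_radius ^ CARD('d)) = (\<Sum>K\<in>\<A>. measure lborel (?B K))"
    using ball_radius_pos by (simp add: content_ball unit_volume_def)
  also have "\<dots> = measure lborel (\<Union>K\<in>\<A>. ?B K)"
    using fin disj emeasure_lborel_ball_finite
    by (intro measure_finite_Union[symmetric]) (auto simp: less_top infinity_ennreal_def)
  also have "\<dots> \<le> measure lborel (cball y (c * h))"
  proof (intro measure_mono_fmeasurable)
    show "(\<Union>K\<in>\<A>. ?B K) \<subseteq> cball y (c * h)" using sub assms(2) interior_subset by blast
    show "(\<Union>K\<in>\<A>. ?B K) \<in> sets lborel" by (simp add: open_UN borel_open)
  qed (auto intro: fmeasurable_compact)
  also have "\<dots> = unit_volume * (c * h) ^ CARD('d)" using assms(3) h_pos by (intro measure_cball_cart) simp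
  also have "\<dots> \<le> unit_volume * (c * (\<kappa> * ball_radius)) ^ CARD('d)"
    using h_le h_pos assms(3) by (intro mult_left_mono power_mono) auto
  finally have "real (card \<A>) * (unit_volume * ball_radius ^ CARD('d))
      \<le> (c * \<kappa>) ^ CARD('d) * (unit_volume * ball_radius ^ CARD('d))"
    by (simp add: power_mult_distrib mult_ac)
  moreover have "0 < unit_volume * ball_radius ^ CARD('d)" using ball_radius_pos by simp
  ultimately show ?thesis by (metis mult_le_cancel_right_pos)
qed

text \<open>Bounds the size of a patch as well as the number of patches to which an element belongs, because
  both live in a ball of radius \<open>(s + 1) h\<close>.\<close>

definition patch_bound :: "nat \<Rightarrow> real" where
  "patch_bound s = ((real s + 1) * \<kappa>) ^ CARD('d)"

lemma patch_dist:
  assumes "patches_exist s \<T>" "K \<in> \<T>" "K' \<in> patch s \<T> K"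
  shows "K' \<in> \<T>" "\<And>x y. x \<in> K \<Longrightarrow> y \<in> K' \<Longrightarrow> dist x y \<le> (real s + 1) * h"
proof -
  define \<tau> where "\<tau> = (LEAST t. s \<le> card (patch_layer \<T> t K))"
  have "\<tau> \<le> s" unfolding \<tau>_def using assms by (intro patch_layer_count) (auto simp: patches_exist_def)
  have "K' \<in> patch_layer \<T> \<tau> K" using assms(3) by (simp add: patch_def \<tau>_def)
  from patch_layer_bounds[OF assms(2) this] show "K' \<in> \<T>" by simp
  fix x y assume "x \<in> K" "y \<in> K'"
  then have "dist x y \<le> (real \<tau> + 1) * h" using patch_layer_bounds[OF assms(2) \<open>K' \<in> patch_layer \<T> \<tau> K\<close>] by blast
  also have "\<dots> \<le> (real s + 1) * h" using \<open>\<tau> \<le> s\<close> h_pos by (intro mult_right_mono) auto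
  finally show "dist x y \<le> (real s + 1) * h" .
qed

lemma patch_self: "K \<in> \<T> \<Longrightarrow> K \<in> patch s \<T> K"
proof -
  assume "K \<in> \<T>"
  then have "K \<in> patch_layer \<T> t K" for t
  proof (induction t)
    case (Suc t)
    then show ?case using patch_layer_mono_step[OF \<open>K \<in> \<T>\<close>, of t] by blast
  qed simp
  then show ?thesis by (simp add: patch_def)
qed

lemma finite_patch: "patches_exist s \<T> \<Longrightarrow> K \<in> \<T> \<Longrightarrow> finite (patch s \<T> K)"
  using patch_dist(1) by (intro finite_subset[OF _ finite_mesh] subsetI) simp

lemma card_patch:
  assumes "patches_exist s \<T>" "K \<in> \<T>"
  shows "real (card (patch s \<T> K)) \<le> patch_bound s"
  unfolding patch_bound_def
proof (rule card_elements_in_ball)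
  show "patch s \<T> K \<subseteq> \<T>" using patch_dist(1)[OF assms] by blast
  show "K' \<subseteq> cball (center K) ((real s + 1) * h)" if "K' \<in> patch s \<T> K" for K'
    using patch_dist(2)[OF assms that center_in[OF assms(2)]] by auto
qed simp

lemma card_patches_containing:
  assumes "patches_exist s \<T>" "K' \<in> \<T>"
  shows "real (card {K \<in> \<T>. K' \<in> patch s \<T> K}) \<le> patch_bound s"
  unfolding patch_bound_def
proof (rule card_elements_in_ball)
  show "{K \<in> \<T>. K' \<in> patch s \<T> K} \<subseteq> \<T>" by blast
  show "K \<subseteq> cball (center K') ((real s + 1) * h)" if "K \<in> {K \<in> \<T>. K' \<in> patch s \<T> K}" for K
    using patch_dist(2)[OF assms(1) _ _ _ center_in[OF assms(2)], of K] that by (auto simp: dist_commute)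
qed simp

lemma patch_bound_nonneg: "0 \<le> patch_bound s"
  using C\<sigma>_pos by (simp add: patch_bound_def)

end

section \<open>Patch reconstruction\<close>

locale reconstruction_mesh = quasi_uniform_mesh \<Omega> \<T> C\<sigma>
  for \<Omega> :: "(real^'d::finite) set" and \<T> C\<sigma> +
  fixes m s :: nat
  assumes patches: "patches_exist s \<T>" and unisolvent: "unisolvent m s \<T>"
begin

abbreviation samples :: "(real^'d) set \<Rightarrow> (real^'d) set" where
  "samples K \<equiv> sampling_points s \<T> K"

lemma finite_samples: "K \<in> \<T> \<Longrightarrow> finite (samples K)"
  by (simp add: sampling_points_def finite_patch[OF patches])

lemma barycenter_in_samples: "K \<in> \<T> \<Longrightarrow> barycenter K \<in> samples K"
  by (simp add: sampling_points_def patch_self)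

lemma card_samples_le: "K \<in> \<T> \<Longrightarrow> card (samples K) \<le> card (patch s \<T> K)"
  unfolding sampling_points_def by (rule card_image_le) (rule finite_patch[OF patches])

lemma poly_zero_on_samples:
  assumes "K \<in> \<T>" "p \<in> poly_space m" "\<And>x. x \<in> samples K \<Longrightarrow> p x = 0"
  shows "p = (\<lambda>x. 0)"
proof (rule poly_eq_on_open[OF assms(2) poly_space_const open_interior])
  show "interior K \<noteq> {}" using barycenter_in_interior[OF element_simplex[OF assms(1)]] by auto
  fix x assume "x \<in> interior K"
  then have "x \<in> \<Union>(patch s \<T> K)" using interior_subset patch_self[OF assms(1)] by blast
  then show "p x = 0" using unisolvent assms unfolding unisolvent_def by blast
qed

lemma poly_coeffs_bounded_by_samples:
  assumes K: "K \<in> \<T>"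
  shows "\<exists>\<delta>>0. \<forall>c. \<forall>\<alpha>\<in>multi_indices m. \<delta> * (c \<alpha>)\<^sup>2
    \<le> (\<Sum>x\<in>samples K. (\<Sum>\<alpha>\<in>multi_indices m. c \<alpha> * monomial_fun \<alpha> x)\<^sup>2)"
proof -
  let ?I = "multi_indices m :: ('d \<Rightarrow> nat) set"
  have eq: "(\<Sum>x\<in>samples K. (\<Sum>\<alpha>\<in>?I. c \<alpha> * monomial_fun \<alpha> x)\<^sup>2)
      = (\<Sum>\<alpha>\<in>?I. \<Sum>\<beta>\<in>?I. c \<alpha> * c \<beta> * (\<Sum>x\<in>samples K. monomial_fun \<alpha> x * monomial_fun \<beta> x))" for c
  proof -
    have "(\<Sum>x\<in>samples K. (\<Sum>\<alpha>\<in>?I. c \<alpha> * monomial_fun \<alpha> x)\<^sup>2)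
        = (\<Sum>x\<in>samples K. \<Sum>\<alpha>\<in>?I. \<Sum>\<beta>\<in>?I. c \<alpha> * c \<beta> * (monomial_fun \<alpha> x * monomial_fun \<beta> x))"
      by (simp add: power2_eq_square sum_product mult_ac)
    also have "\<dots> = (\<Sum>\<alpha>\<in>?I. \<Sum>x\<in>samples K. \<Sum>\<beta>\<in>?I. c \<alpha> * c \<beta> * (monomial_fun \<alpha> x * monomial_fun \<beta> x))"
      by (rule sum.swap)
    also have "\<dots> = (\<Sum>\<alpha>\<in>?I. \<Sum>\<beta>\<in>?I. \<Sum>x\<in>samples K. c \<alpha> * c \<beta> * (monomial_fun \<alpha> x * monomial_fun \<beta> x))"
      by (intro sum.cong refl sum.swap)
    finally show ?thesis by (simp add: sum_distrib_left)
  qed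
  show ?thesis unfolding eq
  proof (rule quadratic_form_lower_bound)
    fix c :: "('d \<Rightarrow> nat) \<Rightarrow> real" assume ex: "\<exists>\<alpha>\<in>?I. c \<alpha> \<noteq> 0"
    let ?q = "\<lambda>x. \<Sum>\<alpha>\<in>?I. c \<alpha> * monomial_fun \<alpha> x"
    have "(\<Sum>x\<in>samples K. (?q x)\<^sup>2) \<noteq> 0"
    proof
      assume "(\<Sum>x\<in>samples K. (?q x)\<^sup>2) = 0"
      then have "\<forall>x\<in>samples K. ?q x = 0" using finite_samples[OF K] by (simp add: sum_nonneg_eq_0_iff)
      moreover have "?q \<in> poly_space m" by (auto simp: poly_space_iff)
      ultimately have "?q = (\<lambda>x. 0)" by (intro poly_zero_on_samples[OF K]) auto
      then have "\<And>x. ?q x = 0" by (rule fun_cong)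
      then have "c \<alpha> = 0" if "\<alpha> \<in> ?I" for \<alpha>
        using poly_vanishing_on_open_coeffs[OF open_UNIV _ _ that, of c] by simp
      with ex show False by blast
    qed
    moreover have "0 \<le> (\<Sum>x\<in>samples K. (?q x)\<^sup>2)" by (rule sum_nonneg) simp
    ultimately show "0 < (\<Sum>\<alpha>\<in>?I. \<Sum>\<beta>\<in>?I. c \<alpha> * c \<beta> * (\<Sum>x\<in>samples K. monomial_fun \<alpha> x * monomial_fun \<beta> x))"
      unfolding eq[symmetric] by linarith
  qed simp
qed

subsection \<open>Stability constant\<close>

lemma compact_patch_region: "K \<in> \<T> \<Longrightarrow> compact (\<Union>(patch s \<T> K))"
  using finite_patch[OF patches] patch_dist(1)[OF patches] simplex_compact_convex(1)[OF element_simplex]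
  by (intro compact_Union) auto

lemma abs_le_Max_samples:
  "K \<in> \<T> \<Longrightarrow> x \<in> samples K \<Longrightarrow> \<bar>p x\<bar> \<le> (MAX x\<in>samples K. \<bar>p x :: real\<bar>)"
  using finite_samples by (intro Max_ge) auto

lemma Max_samples_nonneg:
  assumes "K \<in> \<T>" shows "0 \<le> (MAX x\<in>samples K. \<bar>p x :: real\<bar>)"
  using abs_le_Max_samples[OF assms barycenter_in_samples[OF assms], of p] by linarith

text \<open>Shows that the quotients in the definition of \<^const>\<open>Lambda_local\<close> are bounded, so that their supremum
  is an upper bound. The constant depends on the patch in an uncontrolled way.\<close>

lemma poly_bounded_by_samples:
  assumes K: "K \<in> \<T>"
  shows "\<exists>B. \<forall>p\<in>poly_space m. \<forall>x\<in>\<Union>(patch s \<T> K). \<bar>p x\<bar> \<le> B * (MAX x\<in>samples K. \<bar>p x\<bar>)"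
proof -
  let ?I = "multi_indices m :: ('d \<Rightarrow> nat) set" and ?S = "\<Union>(patch s \<T> K)"
  obtain \<delta> where \<delta>: "\<delta> > 0" "\<And>c \<alpha>. \<alpha>\<in>?I \<Longrightarrow> \<delta> * (c \<alpha>)\<^sup>2
    \<le> (\<Sum>x\<in>samples K. (\<Sum>\<alpha>\<in>?I. c \<alpha> * monomial_fun \<alpha> x)\<^sup>2)"
    using poly_coeffs_bounded_by_samples[OF K] by blast
  have "bounded (\<Union>\<alpha>\<in>?I. monomial_fun \<alpha> ` ?S)"
    by (intro bounded_UN ballI compact_imp_bounded compact_continuous_image compact_patch_region[OF K]
        smooth_fun_continuous[OF smooth_fun_monomial]) simp
  then obtain b where b: "\<forall>y\<in>(\<Union>\<alpha>\<in>?I. monomial_fun \<alpha> ` ?S). norm y \<le> b" by (auto simp: bounded_iff)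
  define n where "n = real (card (samples K))"
  have "\<bar>p x\<bar> \<le> (real (card ?I) * (sqrt (n / \<delta>) * \<bar>b\<bar>)) * (MAX x\<in>samples K. \<bar>p x\<bar>)"
    if p: "p \<in> poly_space m" and x: "x \<in> ?S" for p x
  proof -
    obtain c where c: "p = (\<lambda>x. \<Sum>\<alpha>\<in>?I. c \<alpha> * monomial_fun \<alpha> x)" using p by (auto simp: poly_space_iff)
    define M where "M = (MAX x\<in>samples K. \<bar>p x\<bar>)"
    have M0: "0 \<le> M" unfolding M_def by (rule Max_samples_nonneg[OF K])
    have "(\<Sum>y\<in>samples K. (p y)\<^sup>2) \<le> (\<Sum>y\<in>samples K. M\<^sup>2)"
    proof (rule sum_mono)
      fix y assume "y \<in> samples K"
      then have "\<bar>p y\<bar> \<le> \<bar>M\<bar>" using abs_le_Max_samples[OF K, of y p] M0 by (simp add: M_def)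
      then show "(p y)\<^sup>2 \<le> M\<^sup>2" by (simp add: abs_le_square_iff)
    qed
    then have sq: "(\<Sum>y\<in>samples K. (p y)\<^sup>2) \<le> n * M\<^sup>2" by (simp add: n_def)
    have ca: "\<bar>c \<alpha>\<bar> \<le> sqrt (n / \<delta>) * M" if "\<alpha> \<in> ?I" for \<alpha>
    proof -
      have "\<delta> * (c \<alpha>)\<^sup>2 \<le> n * M\<^sup>2" using \<delta>(2)[OF that, of c] sq unfolding c by linarith
      then have "(c \<alpha>)\<^sup>2 \<le> n / \<delta> * M\<^sup>2" using \<delta>(1) by (simp add: field_simps)
      then have "sqrt ((c \<alpha>)\<^sup>2) \<le> sqrt (n / \<delta> * M\<^sup>2)" by (rule real_sqrt_le_mono)
      also have "sqrt (n / \<delta> * M\<^sup>2) = sqrt (n / \<delta>) * M" using M0 by (simp only: real_sqrt_mult real_sqrt_abs abs_of_nonneg)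
      finally show ?thesis by simp
    qed
    have "\<bar>p x\<bar> \<le> (\<Sum>\<alpha>\<in>?I. \<bar>c \<alpha> * monomial_fun \<alpha> x\<bar>)" unfolding c by (rule sum_abs)
    also have "\<dots> \<le> (\<Sum>\<alpha>\<in>?I. (sqrt (n / \<delta>) * M) * \<bar>b\<bar>)"
    proof (rule sum_mono)
      fix \<alpha> assume \<alpha>: "\<alpha> \<in> ?I"
      then have "\<bar>monomial_fun \<alpha> x\<bar> \<le> \<bar>b\<bar>" using b x by force
      then show "\<bar>c \<alpha> * monomial_fun \<alpha> x\<bar> \<le> (sqrt (n / \<delta>) * M) * \<bar>b\<bar>"
        unfolding abs_mult using ca[OF \<alpha>] by (intro mult_mono) auto
    qed
    also have "\<dots> = (real (card ?I) * (sqrt (n / \<delta>) * \<bar>b\<bar>)) * M" by simp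
    finally show ?thesis unfolding M_def .
  qed
  then show ?thesis by blast
qed

lemma poly_le_Lambda_local:
  assumes K: "K \<in> \<T>" and p: "p \<in> poly_space m" and x: "x \<in> \<Union>(patch s \<T> K)"
  shows "\<bar>p x\<bar> \<le> Lambda_local m s \<T> K * (MAX x\<in>samples K. \<bar>p x\<bar>)"
    and "1 \<le> Lambda_local m s \<T> K"
proof -
  let ?S = "\<Union>(patch s \<T> K)"
  let ?M = "\<lambda>p. MAX x\<in>samples K. \<bar>p x :: real\<bar>"
  let ?P = "{p \<in> poly_space m. \<exists>x\<in>?S. p x \<noteq> 0}"
  let ?ratio = "\<lambda>p. (SUP x\<in>?S. \<bar>p x\<bar>) / ?M p"
  obtain B where B: "\<And>p x. p\<in>poly_space m \<Longrightarrow> x\<in>?S \<Longrightarrow> \<bar>p x\<bar> \<le> B * ?M p"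
    using poly_bounded_by_samples[OF K] by blast
  have Mpos: "0 < ?M p" if pP: "p \<in> ?P" for p
  proof -
    obtain y where "y \<in> ?S" "p y \<noteq> 0" using pP by blast
    then have "?M p \<noteq> 0" using B[of p y] pP by auto
    then show ?thesis using Max_samples_nonneg[OF K, of p] by simp
  qed
  have ne: "?S \<noteq> {}" using x by blast
  have "bdd_above (?ratio ` ?P)"
  proof (rule bdd_aboveI2)
    fix p assume p: "p \<in> ?P"
    have "(SUP x\<in>?S. \<bar>p x\<bar>) \<le> B * ?M p" using B p ne by (intro cSUP_least) auto
    then show "?ratio p \<le> B" using Mpos[OF p] by (simp add: field_simps)
  qed
  then have ratio: "?ratio p \<le> Lambda_local m s \<T> K" if "p \<in> ?P" for p
    unfolding Lambda_local_def using that by (intro cSUP_upper)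
  have le_sup: "\<bar>p x\<bar> \<le> (SUP x\<in>?S. \<bar>p x\<bar>)" if "p \<in> poly_space m" "x \<in> ?S" for p x
    using that B by (intro cSUP_upper bdd_aboveI2[of _ _ "B * ?M p"]) auto
  have one: "(\<lambda>x. 1) \<in> ?P" using ne by (auto simp: poly_space_const)
  have "samples K \<noteq> {}" using barycenter_in_samples[OF K] by auto
  then have max1: "(MAX x\<in>samples K. \<bar>1::real\<bar>) = 1" by (simp add: image_constant_conv)
  have sup1: "(SUP x\<in>?S. \<bar>1::real\<bar>) = \<bar>1\<bar>" by (rule cSUP_const[OF ne])
  have "(SUP x\<in>?S. \<bar>1::real\<bar>) / (MAX x\<in>samples K. \<bar>1::real\<bar>) = 1" unfolding max1 sup1 by simp
  then show L1: "1 \<le> Lambda_local m s \<T> K" using ratio[OF one] by (simp only:)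
  show "\<bar>p x\<bar> \<le> Lambda_local m s \<T> K * ?M p"
  proof (cases "p \<in> ?P")
    case True
    then have "(SUP x\<in>?S. \<bar>p x\<bar>) \<le> Lambda_local m s \<T> K * ?M p"
      using ratio[OF True] Mpos[OF True] by (simp add: divide_le_eq)
    then show ?thesis using le_sup[OF p x] by linarith
  next
    case False
    then have "p x = 0" using p x by blast
    then show ?thesis using L1 Max_samples_nonneg[OF K, of p] by simp
  qed
qed

lemma Lambda_local_le_mesh: "K \<in> \<T> \<Longrightarrow> Lambda_local m s \<T> K \<le> Lambda_mesh m s \<T>"
  unfolding Lambda_mesh_def using finite_mesh by (intro Max_ge) auto

lemma Lambda_mesh_ge_1: "1 \<le> Lambda_mesh m s \<T>"
proof -
  obtain K where K: "K \<in> \<T>" using mesh_nonempty by auto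
  then have "barycenter K \<in> \<Union>(patch s \<T> K)"
    using patch_self barycenter_in_simplex[OF element_simplex] by blast
  from poly_le_Lambda_local(2)[OF K poly_space_const this] Lambda_local_le_mesh[OF K] show ?thesis by linarith
qed

lemma Lambda_mesh_le_bar:
  "K \<in> \<T> \<Longrightarrow> 1 + Lambda_mesh m s \<T> * sqrt (real (card (patch s \<T> K))) \<le> Lambda_bar m s \<T>"
  unfolding Lambda_bar_def using finite_mesh by (intro Max_ge) auto

lemma Lambda_bar_ge_1: "1 \<le> Lambda_bar m s \<T>"
proof -
  obtain K where K: "K \<in> \<T>" using mesh_nonempty by auto
  have "0 \<le> Lambda_mesh m s \<T> * sqrt (real (card (patch s \<T> K)))" using Lambda_mesh_ge_1 by simp
  then show ?thesis using Lambda_mesh_le_bar[OF K] by linarith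
qed

subsection \<open>The constrained least-squares problem\<close>

definition fit_error :: "(real^'d) set \<Rightarrow> (real^'d \<Rightarrow> real) \<Rightarrow> (real^'d \<Rightarrow> real) \<Rightarrow> real" where
  "fit_error K v p = (\<Sum>x\<in>samples K. (p x - v x)\<^sup>2)"

abbreviation admissible_fit :: "(real^'d) set \<Rightarrow> (real^'d \<Rightarrow> real) \<Rightarrow> (real^'d \<Rightarrow> real) \<Rightarrow> bool" where
  "admissible_fit K v p \<equiv> p \<in> poly_space m \<and> p (barycenter K) = v (barycenter K)"

text \<open>The sampled values control the coefficients, so the competitors that are at least as good as a
  given one (here the constant with the prescribed central value) form a compact set.\<close>

lemma fit_minimizer_exists:
  assumes K: "K \<in> \<T>"
  shows "\<exists>p. is_arg_min (fit_error K v) (admissible_fit K v) p"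
proof -
  let ?I = "multi_indices m :: ('d \<Rightarrow> nat) set"
  let ?q = "\<lambda>c x. \<Sum>\<alpha>\<in>?I. c \<alpha> * monomial_fun \<alpha> x"
  obtain \<delta> where \<delta>: "\<delta> > 0" "\<And>c \<alpha>. \<alpha>\<in>?I \<Longrightarrow> \<delta> * (c \<alpha>)\<^sup>2 \<le> (\<Sum>x\<in>samples K. (?q c x)\<^sup>2)"
    using poly_coeffs_bounded_by_samples[OF K] by blast
  define E where "E c = fit_error K v (?q c)" for c
  define c0 where "c0 \<alpha> = (if \<alpha> = (\<lambda>_. 0) then v (barycenter K) else 0)" for \<alpha> :: "'d \<Rightarrow> nat"
  have zero_in: "(\<lambda>_. 0) \<in> ?I" by (simp add: multi_indices_def)
  have q0: "?q c0 x = v (barycenter K)" for x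
  proof -
    have "?q c0 x = (\<Sum>\<alpha>\<in>?I. if \<alpha> = (\<lambda>_. 0) then v (barycenter K) else 0)"
      by (intro sum.cong) (auto simp: c0_def monomial_fun_def)
    then show ?thesis using zero_in by simp
  qed
  define R where "R = sqrt ((2 * E c0 + 2 * (\<Sum>x\<in>samples K. (v x)\<^sup>2)) / \<delta>)"
  define S where "S = {c. \<forall>\<alpha>. c \<alpha> \<in> (if \<alpha> \<in> ?I then {-R..R} else {0})} \<inter> {c. ?q c (barycenter K) = v (barycenter K)}"
  have contq: "continuous_on X (\<lambda>c. ?q c x)" for X x
    by (intro continuous_intros continuous_on_subset[OF continuous_on_product_coordinates]) auto
  have cS: "compact S" unfolding S_def
    by (intro compact_Int_closed compact_coefficient_box closed_Collect_eq contq continuous_intros)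
  have cE: "continuous_on S E" unfolding E_def fit_error_def by (intro continuous_intros contq)
  have bound: "\<bar>c \<alpha>\<bar> \<le> R" if "E c \<le> E c0" "\<alpha> \<in> ?I" for c \<alpha>
  proof -
    have "(\<Sum>x\<in>samples K. (?q c x)\<^sup>2) \<le> (\<Sum>x\<in>samples K. 2 * (?q c x - v x)\<^sup>2 + 2 * (v x)\<^sup>2)"
    proof (rule sum_mono)
      fix x
      have "0 \<le> (?q c x - 2 * v x)\<^sup>2" by simp
      then show "(?q c x)\<^sup>2 \<le> 2 * (?q c x - v x)\<^sup>2 + 2 * (v x)\<^sup>2" by (simp add: power2_eq_square algebra_simps)
    qed
    also have "\<dots> = 2 * E c + 2 * (\<Sum>x\<in>samples K. (v x)\<^sup>2)"
      by (simp add: E_def fit_error_def sum.distrib sum_distrib_left)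
    finally have "\<delta> * (c \<alpha>)\<^sup>2 \<le> 2 * E c0 + 2 * (\<Sum>x\<in>samples K. (v x)\<^sup>2)"
      using \<delta>(2)[OF that(2), of c] that(1) by linarith
    then have "(c \<alpha>)\<^sup>2 \<le> (2 * E c0 + 2 * (\<Sum>x\<in>samples K. (v x)\<^sup>2)) / \<delta>" using \<delta>(1) by (simp add: field_simps)
    then have "sqrt ((c \<alpha>)\<^sup>2) \<le> R" unfolding R_def by (rule real_sqrt_le_mono)
    then show ?thesis by simp
  qed
  have "c0 \<alpha> \<in> (if \<alpha> \<in> ?I then {-R..R} else {0})" for \<alpha>
  proof (cases "\<alpha> \<in> ?I")
    case True then show ?thesis using bound[OF order_refl True] by (simp add: abs_le_iff)
  next
    case False
    then have "\<alpha> \<noteq> (\<lambda>_. 0)" using zero_in by blast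
    then show ?thesis using False by (simp add: c0_def)
  qed
  then have "c0 \<in> S" using q0 by (simp add: S_def)
  then obtain c where c: "c \<in> S" "\<And>d. d \<in> S \<Longrightarrow> E c \<le> E d"
    using continuous_attains_inf[OF cS _ cE] by blast
  have "\<not> fit_error K v p < fit_error K v (?q c)" if p: "admissible_fit K v p" for p
  proof -
    obtain d where d: "p = ?q d" using p by (auto simp: poly_space_iff)
    define d' where "d' \<alpha> = (if \<alpha> \<in> ?I then d \<alpha> else 0)" for \<alpha>
    have d': "p = ?q d'" unfolding d d'_def by (intro ext sum.cong) auto
    have "E c \<le> E d'"
    proof (cases "E d' \<le> E c0")
      case True
      have "d' \<alpha> \<in> (if \<alpha> \<in> ?I then {-R..R} else {0})" for \<alpha>
        using bound[OF True, of \<alpha>] by (cases "\<alpha> \<in> ?I") (auto simp: d'_def abs_le_iff)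
      moreover have "?q d' (barycenter K) = v (barycenter K)" using p unfolding d' by blast
      ultimately have "d' \<in> S" by (simp add: S_def)
      then show ?thesis by (rule c(2))
    next
      case False then show ?thesis using c(2)[OF \<open>c0 \<in> S\<close>] by linarith
    qed
    then show ?thesis unfolding d' E_def by simp
  qed
  moreover have "admissible_fit K v (?q c)" using c(1) by (auto simp: S_def poly_space_iff)
  ultimately show ?thesis unfolding is_arg_min_def by blast
qed

text \<open>By the parallelogram law the mean of two minimizers would be strictly better, unless they agree at
  all sampling points.\<close>

lemma fit_minimizer_unique:
  assumes K: "K \<in> \<T>"
    and p: "is_arg_min (fit_error K v) (admissible_fit K v) p"
    and q: "is_arg_min (fit_error K v) (admissible_fit K v) q"
  shows "p = q"
proof -
  have pq: "admissible_fit K v p" "admissible_fit K v q" and eq: "fit_error K v p = fit_error K v q"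
    using p q unfolding is_arg_min_def by (auto simp: not_less intro: antisym)
  let ?r = "\<lambda>x. (1/2) * (p x + q x)"
  have "?r \<in> poly_space m" using pq by (intro poly_space_scale poly_space_add) blast+
  then have "admissible_fit K v ?r" using pq by simp
  then have "fit_error K v p \<le> fit_error K v ?r" using p unfolding is_arg_min_def by (metis not_less)
  also have "fit_error K v ?r = (\<Sum>x\<in>samples K. (p x - v x)\<^sup>2 / 2 + (q x - v x)\<^sup>2 / 2 - (p x - q x)\<^sup>2 / 4)"
    unfolding fit_error_def by (intro sum.cong) (auto simp: power2_eq_square field_simps)
  also have "\<dots> = fit_error K v p - (\<Sum>x\<in>samples K. (p x - q x)\<^sup>2) / 4"
    using eq by (simp add: fit_error_def sum.distrib sum_subtractf sum_divide_distrib[symmetric])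
  finally have "(\<Sum>x\<in>samples K. (p x - q x)\<^sup>2) \<le> 0" by simp
  then have "(\<Sum>x\<in>samples K. (p x - q x)\<^sup>2) = 0" by (intro antisym sum_nonneg) auto
  then have "\<forall>x\<in>samples K. p x - q x = 0" using finite_samples[OF K] by (simp add: sum_nonneg_eq_0_iff)
  then have "(\<lambda>x. p x - q x) = (\<lambda>x. 0)" using pq by (intro poly_zero_on_samples[OF K] poly_space_diff) auto
  then show ?thesis by (metis eq_iff_diff_eq_0 ext)
qed

lemma local_reconstruction_minimizer:
  assumes K: "K \<in> \<T>"
  shows "is_arg_min (fit_error K v) (admissible_fit K v) (local_reconstruction m s \<T> K v)"
proof -
  have "\<exists>!p. is_arg_min (fit_error K v) (admissible_fit K v) p"
    using fit_minimizer_exists[OF K] fit_minimizer_unique[OF K] by blast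
  then show ?thesis unfolding local_reconstruction_def fit_error_def[abs_def] by (rule theI')
qed

subsection \<open>Basis functions\<close>

abbreviation basis :: "(real^'d) set \<Rightarrow> (real^'d) set \<Rightarrow> real^'d \<Rightarrow> real" where
  "basis K' K \<equiv> basis_fun m s \<T> K' K"

lemma basis_minimizer:
  assumes "K \<in> \<T>"
  shows "is_arg_min (fit_error K (indicat_real K')) (admissible_fit K (indicat_real K')) (basis K' K)"
  using local_reconstruction_minimizer[OF assms] by (simp add: basis_fun_def reconstruction_def)

lemma basis_poly: "K \<in> \<T> \<Longrightarrow> basis K' K \<in> poly_space m"
  using basis_minimizer unfolding is_arg_min_def by blast

lemma basis_at_barycenter:
  "K \<in> \<T> \<Longrightarrow> K' \<in> \<T> \<Longrightarrow> basis K' K (barycenter K) = (if K' = K then 1 else 0)"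
  using basis_minimizer[of K K'] barycenter_mem_iff[of K K'] unfolding is_arg_min_def by (auto simp: indicator_def)

text \<open>The data vanish at all sampling points, so the zero polynomial fits them exactly.\<close>

lemma basis_outside_patch:
  assumes K: "K \<in> \<T>" "K' \<in> \<T>" "K' \<notin> patch s \<T> K"
  shows "basis K' K = (\<lambda>x. 0)"
proof -
  have v0: "indicat_real K' x = 0" if "x \<in> samples K" for x
    using that barycenter_mem_iff K patch_dist(1)[OF patches K(1)] by (auto simp: sampling_points_def indicator_def)
  have "admissible_fit K (indicat_real K') (\<lambda>x. 0)"
    using v0[OF barycenter_in_samples[OF K(1)]] by (simp add: poly_space_const)
  then have "fit_error K (indicat_real K') (basis K' K) \<le> fit_error K (indicat_real K') (\<lambda>x. 0)"
    using basis_minimizer[OF K(1)] unfolding is_arg_min_def by (metis not_less)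
  also have "\<dots> = 0" by (simp add: fit_error_def v0)
  finally have "(\<Sum>x\<in>samples K. (basis K' K x)\<^sup>2) \<le> 0" by (simp add: fit_error_def v0)
  then have "(\<Sum>x\<in>samples K. (basis K' K x)\<^sup>2) = 0" by (intro antisym sum_nonneg) auto
  then have "\<forall>x\<in>samples K. basis K' K x = 0" using finite_samples[OF K(1)] by (simp add: sum_nonneg_eq_0_iff)
  then show ?thesis using basis_poly[OF K(1)] by (intro poly_zero_on_samples[OF K(1)]) auto
qed

text \<open>The constant with the prescribed central value competes in the least-squares problem, so the
  residual at each sampling point is at most the square root of the number of points.\<close>

lemma basis_bounded:
  assumes K: "K \<in> \<T>" "x \<in> K"
  shows "\<bar>basis K' K x\<bar> \<le> 2 * Lambda_bar m s \<T>"
proof -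
  let ?v = "indicat_real K'" and ?p = "basis K' K"
  define n where "n = sqrt (real (card (patch s \<T> K)))"
  have "card (patch s \<T> K) \<noteq> 0" using patch_self[OF K(1)] finite_patch[OF patches K(1)] by auto
  then have n1: "1 \<le> n" by (simp add: n_def)
  have "admissible_fit K ?v (\<lambda>x. ?v (barycenter K))" by (simp add: poly_space_const)
  then have "fit_error K ?v ?p \<le> fit_error K ?v (\<lambda>x. ?v (barycenter K))"
    using basis_minimizer[OF K(1)] unfolding is_arg_min_def by (metis not_less)
  also have "\<dots> \<le> (\<Sum>y\<in>samples K. 1)" unfolding fit_error_def by (rule sum_mono) (auto simp: indicator_def)
  also have "\<dots> \<le> n\<^sup>2" using card_samples_le[OF K(1)] by (simp add: n_def)
  finally have E: "fit_error K ?v ?p \<le> n\<^sup>2" .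
  have "\<bar>?p y\<bar> \<le> 2 * n" if y: "y \<in> samples K" for y
  proof -
    have "(?p y - ?v y)\<^sup>2 \<le> fit_error K ?v ?p" unfolding fit_error_def
      using finite_samples[OF K(1)] y by (intro member_le_sum) auto
    then have "(?p y - ?v y)\<^sup>2 \<le> n\<^sup>2" using E by linarith
    then have "\<bar>?p y - ?v y\<bar> \<le> n" using n1 by (simp add: abs_le_square_iff[symmetric])
    moreover have "\<bar>?v y\<bar> \<le> 1" by (simp add: indicator_def)
    ultimately show ?thesis using n1 by linarith
  qed
  then have "(MAX x\<in>samples K. \<bar>?p x\<bar>) \<le> 2 * n"
    using finite_samples[OF K(1)] barycenter_in_samples[OF K(1)] by (intro Max.boundedI) auto
  moreover have "0 \<le> Lambda_local m s \<T> K" and "x \<in> \<Union>(patch s \<T> K)"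
    using poly_le_Lambda_local(2)[OF K(1) poly_space_const, of x] K patch_self by force+
  ultimately have "\<bar>?p x\<bar> \<le> Lambda_local m s \<T> K * (2 * n)"
    using poly_le_Lambda_local(1)[OF K(1) basis_poly[OF K(1)], of x K']
    by (meson mult_left_mono order_trans)
  also have "\<dots> \<le> Lambda_mesh m s \<T> * (2 * n)" using Lambda_local_le_mesh[OF K(1)] n1 by (intro mult_right_mono) auto
  also have "\<dots> \<le> 2 * Lambda_bar m s \<T>" using Lambda_mesh_le_bar[OF K(1)] by (simp add: n_def)
  finally show ?thesis .
qed

end

section \<open>The discontinuous Galerkin form\<close>

lemma continuous_on_matrix_vector_mult:
  fixes A :: "real^'n^'m"
  shows "continuous_on S f \<Longrightarrow> continuous_on S (\<lambda>x. A *v f x)"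
  by (rule continuous_on_compose2[OF matrix_vector_mult_linear_continuous_on[of UNIV A]]) auto

lemma set_integral_inner_bilinear:
  fixes F G :: "'i \<Rightarrow> real^'d \<Rightarrow> real^'d"
  assumes M: "\<And>f :: real^'d \<Rightarrow> real. continuous_on UNIV f \<Longrightarrow> set_integrable M S f"
    and "\<And>i. i \<in> I \<Longrightarrow> continuous_on UNIV (F i)" "\<And>j. j \<in> I \<Longrightarrow> continuous_on UNIV (G j)"
  shows "(LINT x:S|M. (\<Sum>i\<in>I. a i *\<^sub>R F i x) \<bullet> (\<Sum>j\<in>I. b j *\<^sub>R G j x))
    = (\<Sum>i\<in>I. \<Sum>j\<in>I. (a i * b j) * (LINT x:S|M. F i x \<bullet> G j x))"
proof -
  have "(LINT x:S|M. (\<Sum>i\<in>I. a i *\<^sub>R F i x) \<bullet> (\<Sum>j\<in>I. b j *\<^sub>R G j x))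
      = (LINT x:S|M. \<Sum>i\<in>I. \<Sum>j\<in>I. (a i * b j) * (F i x \<bullet> G j x))"
  proof -
    have "(\<Sum>i\<in>I. a i *\<^sub>R F i x) \<bullet> (\<Sum>j\<in>I. b j *\<^sub>R G j x)
        = (\<Sum>i\<in>I. \<Sum>j\<in>I. (a i * b j) * (F i x \<bullet> G j x))" for x
      unfolding inner_sum_left inner_scaleR_left by (intro sum.cong refl) (simp add: inner_sum_right sum_distrib_left mult.assoc)
    then show ?thesis by (simp only:)
  qed
  also have "\<dots> = (\<Sum>i\<in>I. \<Sum>j\<in>I. (a i * b j) * (LINT x:S|M. F i x \<bullet> G j x))"
    by (intro set_integral_quadratic_form M continuous_on_inner assms(2,3))
  finally show ?thesis .
qed

lemma abs_inner_le_mult: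
  fixes x y :: "'a::real_inner"
  assumes "norm x \<le> a" "norm y \<le> b" shows "\<bar>x \<bullet> y\<bar> \<le> a * b"
proof -
  have "\<bar>x \<bullet> y\<bar> \<le> norm x * norm y" by (rule Cauchy_Schwarz_ineq2)
  also have "\<dots> \<le> a * b" using assms by (intro mult_mono order_trans[OF norm_ge_zero]) auto
  finally show ?thesis .
qed

lemma sum_square_le_card_2:
  fixes f :: "'a \<Rightarrow> real"
  assumes "card S \<le> 2"
  shows "(sum f S)\<^sup>2 \<le> 2 * (\<Sum>x\<in>S. (f x)\<^sup>2)"
proof -
  have "(sum f S)\<^sup>2 \<le> (\<Sum>x\<in>S. (f x)\<^sup>2) * real (card S)"
    by (rule sum_squared_le_sum_of_squares)
  also have "\<dots> \<le> (\<Sum>x\<in>S. (f x)\<^sup>2) * 2"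
    using assms by (intro mult_left_mono sum_nonneg) auto
  finally show ?thesis by simp
qed

text \<open>The ellipticity bounds and the constants of the inverse estimates are parameters: every constant
  defined below is an explicit expression in them and in \<open>C\<sigma>\<close>, which makes it visibly independent of
  the mesh.\<close>

locale dg_mesh = quasi_uniform_mesh \<Omega> \<T> C\<sigma>
  for \<Omega> :: "(real^'d::finite) set" and \<T> C\<sigma> +
  fixes m :: nat and A :: "real^'d^'d" and a\<^sub>0 a\<^sub>1 C\<^sub>1 C\<^sub>2 :: real
  assumes A_lower: "\<And>x. a\<^sub>0 * (norm x)\<^sup>2 \<le> x \<bullet> (A *v x)" and a0_pos: "0 < a\<^sub>0"
    and A_upper: "\<And>x. norm (A *v x) \<le> a\<^sub>1 * norm x" and a1_pos: "0 < a\<^sub>1"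
    and C1_pos: "0 < C\<^sub>1" and C2_pos: "0 < C\<^sub>2"
    and inverse_sup: "\<And>p c r M x. p \<in> poly_space m \<Longrightarrow> 0 < r \<Longrightarrow> (\<And>y. y \<in> cball c r \<Longrightarrow> \<bar>p y\<bar> \<le> M)
      \<Longrightarrow> x \<in> cball (c::real^'d) (2 * C\<sigma> * r) \<Longrightarrow> norm (grad p x) \<le> C\<^sub>1 * M / r"
    and inverse_L2: "\<And>p c r x. p \<in> poly_space m \<Longrightarrow> 0 < r \<Longrightarrow> x \<in> cball (c::real^'d) (2 * C\<sigma> * r)
      \<Longrightarrow> r ^ CARD('d) * (norm (grad p x))\<^sup>2 \<le> C\<^sub>2 * (LINT y:cball c r|lborel. (norm (grad p y))\<^sup>2)"
begin

definition broken_poly :: "'d broken_fun \<Rightarrow> bool" where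
  "broken_poly u \<longleftrightarrow> (\<forall>K\<in>\<T>. u K \<in> poly_space m)"

lemma broken_smooth: "broken_poly u \<Longrightarrow> K \<in> \<T> \<Longrightarrow> smooth_fun (u K)"
  by (auto simp: broken_poly_def intro: smooth_fun_poly)

lemma broken_poly_sum:
  "(\<And>i. i \<in> I \<Longrightarrow> broken_poly (U i)) \<Longrightarrow> broken_poly (\<lambda>K x. \<Sum>i\<in>I. c i * U i K x)"
  by (auto simp: broken_poly_def intro!: poly_space_sum poly_space_scale)

lemma jump_eq: "jump \<T> v e x = (\<Sum>K\<in>face_elements e. v K x *\<^sub>R outward_normal K e)"
  by (simp add: jump_def face_elements_def)

definition average_weight :: "(real^'d) set \<Rightarrow> real" where
  "average_weight e = (if e \<in> interior_faces \<T> then 1 / 2 else 1)"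

lemma average_eq:
  "average \<T> (flux A u) e x = average_weight e *\<^sub>R (\<Sum>K\<in>face_elements e. A *v grad (u K) x)"
  by (simp add: average_def face_elements_def flux_def average_weight_def)

lemma continuous_jump: "broken_poly v \<Longrightarrow> continuous_on S (jump \<T> v e)"
  unfolding jump_eq[abs_def] using face_elements_subset
  by (intro continuous_intros smooth_fun_continuous broken_smooth) auto

lemma continuous_flux: "broken_poly u \<Longrightarrow> K \<in> \<T> \<Longrightarrow> continuous_on S (flux A u K)"
  unfolding flux_def by (intro continuous_on_matrix_vector_mult smooth_fun_continuous_grad broken_smooth)

lemma continuous_average: "broken_poly u \<Longrightarrow> continuous_on S (average \<T> (flux A u) e)"
  unfolding average_eq[abs_def] using face_elements_subset
  by (intro continuous_intros continuous_on_matrix_vector_mult smooth_fun_continuous_grad broken_smooth) auto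

lemma element_integrable:
  "K \<in> \<T> \<Longrightarrow> continuous_on UNIV (f :: real^'d \<Rightarrow> real) \<Longrightarrow> set_integrable lborel K f"
  by (rule set_integrable_continuous_on_compact[OF simplex_compact_convex(1)[OF element_simplex]
        continuous_on_subset[OF _ subset_UNIV]])

subsection \<open>Bilinearity\<close>

lemma grad_combination:
  assumes "\<forall>i\<in>I. broken_poly (U i)" "K \<in> \<T>"
  shows "grad (\<lambda>x. \<Sum>i\<in>I. c i * U i K x) x = (\<Sum>i\<in>I. c i *\<^sub>R grad (U i K) x)"
proof -
  have "grad (\<lambda>x. \<Sum>i\<in>I. c i * U i K x) x = (\<Sum>i\<in>I. grad (\<lambda>x. c i * U i K x) x)"
    using assms by (intro grad_sum smooth_fun_mult smooth_fun_const broken_smooth) auto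
  also have "\<dots> = (\<Sum>i\<in>I. c i *\<^sub>R grad (U i K) x)"
    using assms by (intro sum.cong refl grad_scale broken_smooth) auto
  finally show ?thesis .
qed

lemma matrix_vector_sum: "A *v (\<Sum>i\<in>I. c i *\<^sub>R f i) = (\<Sum>i\<in>I. c i *\<^sub>R (A *v f i))"
  using linear_sum[OF matrix_vector_mul_linear[of A], of "\<lambda>i. c i *\<^sub>R f i" I]
    linear_cmul[OF matrix_vector_mul_linear[of A]] by simp

lemma flux_combination:
  assumes "\<forall>i\<in>I. broken_poly (U i)" "K \<in> \<T>"
  shows "flux A (\<lambda>K x. \<Sum>i\<in>I. c i * U i K x) K x = (\<Sum>i\<in>I. c i *\<^sub>R flux A (U i) K x)"
  unfolding flux_def grad_combination[OF assms] matrix_vector_sum ..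

lemma jump_combination:
  "jump \<T> (\<lambda>K x. \<Sum>i\<in>I. c i * U i K x) e x = (\<Sum>i\<in>I. c i *\<^sub>R jump \<T> (U i) e x)"
  unfolding jump_eq scaleR_sum_left scaleR_sum_right by (subst sum.swap) simp

lemma average_combination:
  assumes "\<forall>i\<in>I. broken_poly (U i)"
  shows "average \<T> (flux A (\<lambda>K x. \<Sum>i\<in>I. c i * U i K x)) e x = (\<Sum>i\<in>I. c i *\<^sub>R average \<T> (flux A (U i)) e x)"
proof -
  have "average \<T> (flux A (\<lambda>K x. \<Sum>i\<in>I. c i * U i K x)) e x
      = average_weight e *\<^sub>R (\<Sum>K\<in>face_elements e. \<Sum>i\<in>I. c i *\<^sub>R (A *v grad (U i K) x))"
    unfolding average_eq using face_elements_subset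
    by (intro arg_cong2[of _ _ _ _ scaleR] sum.cong refl) (auto simp: grad_combination[OF assms] matrix_vector_sum subset_iff)
  also have "\<dots> = (\<Sum>i\<in>I. c i *\<^sub>R average \<T> (flux A (U i)) e x)"
    unfolding average_eq scaleR_sum_right by (subst sum.swap) (simp add: mult.commute)
  finally show ?thesis .
qed

lemma dg_form_eq:
  "dg_form A \<theta> \<mu> \<Omega> \<T> u v =
     (\<Sum>K\<in>\<T>. LINT x:K|lborel. flux A u K x \<bullet> grad (v K) x)
   - (\<Sum>e\<in>faces. face_integral e (\<lambda>x. average \<T> (flux A u) e x \<bullet> jump \<T> v e x))
   + \<theta> * (\<Sum>e\<in>faces. face_integral e (\<lambda>x. jump \<T> u e x \<bullet> average \<T> (flux A v) e x))
   + (\<Sum>e\<in>faces. \<mu> / diameter e * face_integral e (\<lambda>x. jump \<T> u e x \<bullet> jump \<T> v e x))"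
  unfolding dg_form_def face_integral_def set_integral_mult_right by (simp add: inner_commute)

text \<open>Interchanges the sum over elements or faces, with weights \<open>z\<close>, and the double sum over indices.\<close>

lemma sum_double_scaled:
  fixes g :: "'k \<Rightarrow> 'i \<Rightarrow> 'i \<Rightarrow> real"
  assumes "\<And>k. k \<in> X \<Longrightarrow> f k = (\<Sum>i\<in>I. \<Sum>j\<in>I. w i j * g k i j)"
  shows "(\<Sum>k\<in>X. z k * f k) = (\<Sum>i\<in>I. \<Sum>j\<in>I. w i j * (\<Sum>k\<in>X. z k * g k i j))"
proof -
  have "(\<Sum>k\<in>X. z k * f k) = (\<Sum>k\<in>X. \<Sum>i\<in>I. \<Sum>j\<in>I. w i j * (z k * g k i j))"
    by (intro sum.cong refl) (simp add: assms sum_distrib_left mult.left_commute)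
  also have "\<dots> = (\<Sum>i\<in>I. \<Sum>k\<in>X. \<Sum>j\<in>I. w i j * (z k * g k i j))" by (rule sum.swap)
  also have "\<dots> = (\<Sum>i\<in>I. \<Sum>j\<in>I. \<Sum>k\<in>X. w i j * (z k * g k i j))" by (intro sum.cong refl sum.swap)
  finally show ?thesis by (simp add: sum_distrib_left)
qed

lemma dg_form_bilinear:
  fixes U :: "'i \<Rightarrow> 'd broken_fun"
  assumes U: "\<forall>i\<in>I. broken_poly (U i)"
  shows "dg_form A \<theta> \<mu> \<Omega> \<T> (\<lambda>K x. \<Sum>i\<in>I. c i * U i K x) (\<lambda>K x. \<Sum>j\<in>I. d j * U j K x)
    = (\<Sum>i\<in>I. \<Sum>j\<in>I. (c i * d j) * dg_form A \<theta> \<mu> \<Omega> \<T> (U i) (U j))"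
proof -
  let ?u = "\<lambda>K x. \<Sum>i\<in>I. c i * U i K x" and ?v = "\<lambda>K x. \<Sum>j\<in>I. d j * U j K x"
  have 1: "(\<Sum>K\<in>\<T>. 1 * (LINT x:K|lborel. flux A ?u K x \<bullet> grad (?v K) x))
      = (\<Sum>i\<in>I. \<Sum>j\<in>I. (c i * d j) * (\<Sum>K\<in>\<T>. 1 * (LINT x:K|lborel. flux A (U i) K x \<bullet> grad (U j K) x)))"
  proof (rule sum_double_scaled)
    fix K assume K: "K \<in> \<T>"
    show "(LINT x:K|lborel. flux A ?u K x \<bullet> grad (?v K) x)
        = (\<Sum>i\<in>I. \<Sum>j\<in>I. (c i * d j) * (LINT x:K|lborel. flux A (U i) K x \<bullet> grad (U j K) x))"
      unfolding flux_combination[OF U K] grad_combination[OF U K]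
      by (intro set_integral_inner_bilinear element_integrable K continuous_flux smooth_fun_continuous_grad broken_smooth bspec[OF U])
  qed
  have 2: "(\<Sum>e\<in>faces. 1 * face_integral e (\<lambda>x. average \<T> (flux A ?u) e x \<bullet> jump \<T> ?v e x))
      = (\<Sum>i\<in>I. \<Sum>j\<in>I. (c i * d j) * (\<Sum>e\<in>faces. 1 * face_integral e (\<lambda>x. average \<T> (flux A (U i)) e x \<bullet> jump \<T> (U j) e x)))"
    unfolding face_integral_def average_combination[OF U] jump_combination
    by (intro sum_double_scaled set_integral_inner_bilinear face_integrable continuous_average continuous_jump bspec[OF U])
  have 3: "(\<Sum>e\<in>faces. 1 * face_integral e (\<lambda>x. jump \<T> ?u e x \<bullet> average \<T> (flux A ?v) e x))
      = (\<Sum>i\<in>I. \<Sum>j\<in>I. (c i * d j) * (\<Sum>e\<in>faces. 1 * face_integral e (\<lambda>x. jump \<T> (U i) e x \<bullet> average \<T> (flux A (U j)) e x)))"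
    unfolding face_integral_def average_combination[OF U] jump_combination
    by (intro sum_double_scaled set_integral_inner_bilinear face_integrable continuous_average continuous_jump bspec[OF U])
  have 4: "(\<Sum>e\<in>faces. \<mu> / diameter e * face_integral e (\<lambda>x. jump \<T> ?u e x \<bullet> jump \<T> ?v e x))
      = (\<Sum>i\<in>I. \<Sum>j\<in>I. (c i * d j) * (\<Sum>e\<in>faces. \<mu> / diameter e * face_integral e (\<lambda>x. jump \<T> (U i) e x \<bullet> jump \<T> (U j) e x)))"
    unfolding face_integral_def jump_combination
    by (intro sum_double_scaled set_integral_inner_bilinear face_integrable continuous_jump bspec[OF U])
  show ?thesis
    unfolding dg_form_eq using 1 2 3 4
    by (simp add: algebra_simps sum.distrib sum_subtractf sum_distrib_left)
qed

subsection \<open>Continuity\<close>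

lemma h_inverse: "1 / ball_radius \<le> \<kappa> / h"
  using h_le ball_radius_pos h_pos by (simp add: field_simps)

lemma grad_bound:
  assumes u: "broken_poly u" and K: "K \<in> \<T>" and M: "\<And>x. x \<in> K \<Longrightarrow> \<bar>u K x\<bar> \<le> M" and x: "x \<in> K"
  shows "norm (grad (u K) x) \<le> C\<^sub>1 * \<kappa> * M / h"
proof -
  have "0 \<le> M" using M[OF x] by linarith
  have "norm (grad (u K) x) \<le> C\<^sub>1 * M / ball_radius"
    using u K x M center_ball[OF K] element_subset_center_ball[OF K]
    by (intro inverse_sup[OF _ ball_radius_pos, of _ "center K"]) (auto simp: broken_poly_def)
  also have "\<dots> = (C\<^sub>1 * M) * (1 / ball_radius)" by simp
  also have "\<dots> \<le> (C\<^sub>1 * M) * (\<kappa> / h)" using h_inverse C1_pos \<open>0 \<le> M\<close> by (intro mult_left_mono) auto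
  finally show ?thesis by (simp add: mult_ac)
qed

lemma face_area_le: "e \<in> faces \<Longrightarrow> facet_area e \<le> area_upper * h ^ CARD('d) / h"
  using face_area(2)[of e] h_pos by (simp add: field_simps)

lemma face_integral_bound:
  assumes "e \<in> faces" "continuous_on UNIV f" "\<And>x. x \<in> e \<Longrightarrow> \<bar>f x\<bar> \<le> B" "0 \<le> B"
  shows "\<bar>face_integral e f\<bar> \<le> B * (area_upper * h ^ CARD('d) / h)"
proof -
  have "\<bar>face_integral e f\<bar> \<le> B * facet_area e"
    unfolding face_integral_def facet_area_def
    by (rule abs_set_integral_le_measure[OF sets_hyperplane_measure face_compact_finite[OF assms(1)] assms(2,3)])
  also have "\<dots> \<le> B * (area_upper * h ^ CARD('d) / h)" using face_area_le[OF assms(1)] assms(4) by (intro mult_left_mono)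
  finally show ?thesis .
qed

lemma norm_average_le:
  "norm (average \<T> (flux A u) e x) \<le> a\<^sub>1 * (\<Sum>K\<in>face_elements e. norm (grad (u K) x))"
proof -
  have "norm (average \<T> (flux A u) e x) \<le> norm (\<Sum>K\<in>face_elements e. A *v grad (u K) x)"
    unfolding average_eq average_weight_def by simp
  also have "\<dots> \<le> (\<Sum>K\<in>face_elements e. a\<^sub>1 * norm (grad (u K) x))" by (rule sum_norm_le) (rule A_upper)
  finally show ?thesis by (simp add: sum_distrib_left)
qed

lemma norm_jump_le:
  "norm (jump \<T> u e x) \<le> (\<Sum>K\<in>face_elements e. \<bar>u K x\<bar>)"
  unfolding jump_eq by (rule sum_norm_le) (simp add: norm_outward_normal)

text \<open>Cauchy-Schwarz over the faces; every element occurs on \<open>d + 1\<close> faces and every face has at most two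
  elements.\<close>

lemma sum_faces_product_le:
  fixes M N :: "(real^'d) set \<Rightarrow> real"
  assumes "\<And>K. 0 \<le> M K" "\<And>K. 0 \<le> N K"
  shows "(\<Sum>e\<in>faces. sum M (face_elements e) * sum N (face_elements e))
    \<le> 2 * (real CARD('d) + 1) * (L2_set M \<T> * L2_set N \<T>)"
proof -
  have L: "L2_set (\<lambda>e. sum M (face_elements e)) faces \<le> sqrt (2 * (real CARD('d) + 1)) * L2_set M \<T>" for M :: "_ \<Rightarrow> real"
  proof -
    have "(\<Sum>e\<in>faces. (sum M (face_elements e))\<^sup>2) \<le> (\<Sum>e\<in>faces. 2 * (\<Sum>K\<in>face_elements e. (M K)\<^sup>2))"
      by (intro sum_mono sum_square_le_card_2 card_face_elements)
    also have "\<dots> = 2 * (real CARD('d) + 1) * (\<Sum>K\<in>\<T>. (M K)\<^sup>2)"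
      unfolding sum_distrib_left[symmetric] sum_faces_elements_const by simp
    finally have "L2_set (\<lambda>e. sum M (face_elements e)) faces \<le> sqrt (2 * (real CARD('d) + 1) * (\<Sum>K\<in>\<T>. (M K)\<^sup>2))"
      unfolding L2_set_def by (rule real_sqrt_le_mono)
    also have "\<dots> = sqrt (2 * (real CARD('d) + 1)) * L2_set M \<T>" unfolding L2_set_def by (rule real_sqrt_mult)
    finally show ?thesis .
  qed
  have "(\<Sum>e\<in>faces. sum M (face_elements e) * sum N (face_elements e))
      = (\<Sum>e\<in>faces. \<bar>sum M (face_elements e)\<bar> * \<bar>sum N (face_elements e)\<bar>)"
    using assms by (intro sum.cong) (simp_all add: sum_nonneg)
  also have "\<dots> \<le> L2_set (\<lambda>e. sum M (face_elements e)) faces * L2_set (\<lambda>e. sum N (face_elements e)) faces"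
    by (rule L2_set_mult_ineq)
  also have "\<dots> \<le> (sqrt (2 * (real CARD('d) + 1)) * L2_set M \<T>) * (sqrt (2 * (real CARD('d) + 1)) * L2_set N \<T>)"
    by (intro mult_mono L) (auto simp: L2_set_nonneg)
  also have "\<dots> = (sqrt (2 * (real CARD('d) + 1)))\<^sup>2 * (L2_set M \<T> * L2_set N \<T>)" by (simp only: power2_eq_square mult_ac)
  finally show ?thesis by simp
qed

definition continuity_constant :: "real \<Rightarrow> real" where
  "continuity_constant \<mu> = a\<^sub>1 * (C\<^sub>1 * \<kappa>)\<^sup>2 * unit_volume
     + 2 * (real CARD('d) + 1) * area_upper * (2 * a\<^sub>1 * C\<^sub>1 * \<kappa> + \<mu> * C\<sigma>)"

lemma continuity_constant_pos: "0 < \<mu> \<Longrightarrow> 0 < continuity_constant \<mu>"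
  unfolding continuity_constant_def using a1_pos C1_pos C\<sigma>_pos area_bounds_pos
  by (intro add_pos_pos mult_pos_pos) (auto intro!: add_pos_pos)

text \<open>The functions enter only through bounds \<open>M\<close> and \<open>N\<close> for their maxima on each element. Each gradient
  costs a factor \<open>1 / h\<close> by the inverse estimate; in the penalty term the two powers of \<open>h\<close> come from
  the weight and from the ratio of the face area to \<open>h\<^sup>d\<close>.\<close>

lemma dg_form_continuous:
  assumes u: "broken_poly u" "\<And>K x. K \<in> \<T> \<Longrightarrow> x \<in> K \<Longrightarrow> \<bar>u K x\<bar> \<le> M K" "\<And>K. 0 \<le> M K"
    and v: "broken_poly v" "\<And>K x. K \<in> \<T> \<Longrightarrow> x \<in> K \<Longrightarrow> \<bar>v K x\<bar> \<le> N K" "\<And>K. 0 \<le> N K"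
    and \<theta>: "\<bar>\<theta>\<bar> \<le> 1" and \<mu>: "0 < \<mu>"
  shows "\<bar>dg_form A \<theta> \<mu> \<Omega> \<T> u v\<bar> \<le> continuity_constant \<mu> * h ^ CARD('d) / h\<^sup>2 * (L2_set M \<T> * L2_set N \<T>)"
proof -
  let ?H = "h ^ CARD('d)" and ?LL = "L2_set M \<T> * L2_set N \<T>"
  let ?G = "C\<^sub>1 * \<kappa>"
  let ?SM = "\<lambda>e. sum M (face_elements e)" and ?SN = "\<lambda>e. sum N (face_elements e)"
  have G: "?G \<ge> 0" using C1_pos C\<sigma>_pos by simp
  have H: "?H \<ge> 0" using h_pos by simp
  have au: "0 \<le> area_upper" using area_bounds_pos by simp
  have gu: "norm (grad (u K) x) \<le> ?G * M K / h" if "K \<in> \<T>" "x \<in> K" for K x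
    using grad_bound[OF u(1) that(1) _ that(2)] u(2) that(1) by blast
  have gv: "norm (grad (v K) x) \<le> ?G * N K / h" if "K \<in> \<T>" "x \<in> K" for K x
    using grad_bound[OF v(1) that(1) _ that(2)] v(2) that(1) by blast
  have T1: "\<bar>\<Sum>K\<in>\<T>. LINT x:K|lborel. flux A u K x \<bullet> grad (v K) x\<bar> \<le> a\<^sub>1 * ?G\<^sup>2 * unit_volume * ?H / h\<^sup>2 * ?LL"
  proof -
    have "\<bar>LINT x:K|lborel. flux A u K x \<bullet> grad (v K) x\<bar> \<le> a\<^sub>1 * ?G\<^sup>2 * unit_volume * ?H / h\<^sup>2 * (\<bar>M K\<bar> * \<bar>N K\<bar>)"
      if K: "K \<in> \<T>" for K
    proof -
      have "\<bar>LINT x:K|lborel. flux A u K x \<bullet> grad (v K) x\<bar> \<le> ((a\<^sub>1 * (?G * M K / h)) * (?G * N K / h)) * measure lborel K"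
      proof (rule abs_set_integral_le_measure)
        show cK: "compact K" by (rule simplex_compact_convex(1)[OF element_simplex[OF K]])
        then show "emeasure lborel K < \<infinity>" by (rule emeasure_compact_finite)
        show "continuous_on UNIV (\<lambda>x. flux A u K x \<bullet> grad (v K) x)"
          by (intro continuous_on_inner continuous_flux smooth_fun_continuous_grad broken_smooth u(1) v(1) K)
        fix x assume x: "x \<in> K"
        have "\<bar>flux A u K x \<bullet> grad (v K) x\<bar> \<le> norm (flux A u K x) * norm (grad (v K) x)" by (rule Cauchy_Schwarz_ineq2)
        also have "norm (flux A u K x) \<le> a\<^sub>1 * norm (grad (u K) x)" unfolding flux_def by (rule A_upper)
        also have "(a\<^sub>1 * norm (grad (u K) x)) * norm (grad (v K) x) \<le> (a\<^sub>1 * (?G * M K / h)) * (?G * N K / h)"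
          using gu[OF K x] gv[OF K x] a1_pos G h_pos u(3) by (intro mult_mono mult_left_mono) auto
        finally show "\<bar>flux A u K x \<bullet> grad (v K) x\<bar> \<le> (a\<^sub>1 * (?G * M K / h)) * (?G * N K / h)"
          by (simp add: mult_right_mono)
      qed simp
      also have "\<dots> \<le> ((a\<^sub>1 * (?G * M K / h)) * (?G * N K / h)) * (unit_volume * ?H)"
        using a1_pos C1_pos C\<sigma>_pos h_pos u(3) v(3)
        by (intro mult_left_mono element_volume_le[OF K] mult_nonneg_nonneg divide_nonneg_pos) auto
      also have "\<dots> = a\<^sub>1 * ?G\<^sup>2 * unit_volume * ?H / h\<^sup>2 * (\<bar>M K\<bar> * \<bar>N K\<bar>)"
        using u(3) v(3) h_pos by (simp add: power2_eq_square field_simps)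
      finally show ?thesis .
    qed
    then have "\<bar>\<Sum>K\<in>\<T>. LINT x:K|lborel. flux A u K x \<bullet> grad (v K) x\<bar>
        \<le> (\<Sum>K\<in>\<T>. a\<^sub>1 * ?G\<^sup>2 * unit_volume * ?H / h\<^sup>2 * (\<bar>M K\<bar> * \<bar>N K\<bar>))"
      by (intro order_trans[OF sum_abs] sum_mono)
    also have "\<dots> = a\<^sub>1 * ?G\<^sup>2 * unit_volume * ?H / h\<^sup>2 * (\<Sum>K\<in>\<T>. \<bar>M K\<bar> * \<bar>N K\<bar>)" by (rule sum_distrib_left[symmetric])
    also have "\<dots> \<le> a\<^sub>1 * ?G\<^sup>2 * unit_volume * ?H / h\<^sup>2 * ?LL"
      using a1_pos H by (intro mult_left_mono L2_set_mult_ineq) auto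
    finally show ?thesis .
  qed
  have face_sum: "\<bar>\<Sum>e\<in>faces. f e\<bar> \<le> 2 * (real CARD('d) + 1) * area_upper * c * ?H / h\<^sup>2 * ?LL"
    if f: "\<And>e. e \<in> faces \<Longrightarrow> \<bar>f e\<bar> \<le> area_upper * c * ?H / h\<^sup>2 * (?SM e * ?SN e)" and c: "0 \<le> c" for f c
  proof -
    have "\<bar>\<Sum>e\<in>faces. f e\<bar> \<le> (\<Sum>e\<in>faces. area_upper * c * ?H / h\<^sup>2 * (?SM e * ?SN e))"
      by (intro order_trans[OF sum_abs] sum_mono f)
    also have "\<dots> = area_upper * c * ?H / h\<^sup>2 * (\<Sum>e\<in>faces. ?SM e * ?SN e)" by (rule sum_distrib_left[symmetric])
    also have "\<dots> \<le> area_upper * c * ?H / h\<^sup>2 * (2 * (real CARD('d) + 1) * ?LL)"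
      using au c H by (intro mult_left_mono sum_faces_product_le u(3) v(3)) auto
    finally show ?thesis by (simp add: mult_ac)
  qed
  have in_el: "x \<in> K" "K \<in> \<T>" if "x \<in> e" "K \<in> face_elements e" for x K e
    using that face_subset_element face_elements_subset by blast+
  have avg_u: "norm (average \<T> (flux A u) e x) \<le> a\<^sub>1 * (?G / h * ?SM e)" if "x \<in> e" for e x
  proof -
    have "(\<Sum>K\<in>face_elements e. norm (grad (u K) x)) \<le> (\<Sum>K\<in>face_elements e. ?G / h * M K)"
      using gu in_el[OF that] by (intro sum_mono) (metis times_divide_eq_left)
    also have "\<dots> = ?G / h * sum M (face_elements e)" by (rule sum_distrib_left[symmetric])
    finally have "a\<^sub>1 * (\<Sum>K\<in>face_elements e. norm (grad (u K) x)) \<le> a\<^sub>1 * (?G / h * sum M (face_elements e))"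
      using a1_pos by (intro mult_left_mono) auto
    then show ?thesis using norm_average_le[of u e x] by linarith
  qed
  have avg_v: "norm (average \<T> (flux A v) e x) \<le> a\<^sub>1 * (?G / h * ?SN e)" if "x \<in> e" for e x
  proof -
    have "(\<Sum>K\<in>face_elements e. norm (grad (v K) x)) \<le> (\<Sum>K\<in>face_elements e. ?G / h * N K)"
      using gv in_el[OF that] by (intro sum_mono) (metis times_divide_eq_left)
    also have "\<dots> = ?G / h * sum N (face_elements e)" by (rule sum_distrib_left[symmetric])
    finally have "a\<^sub>1 * (\<Sum>K\<in>face_elements e. norm (grad (v K) x)) \<le> a\<^sub>1 * (?G / h * sum N (face_elements e))"
      using a1_pos by (intro mult_left_mono) auto
    then show ?thesis using norm_average_le[of v e x] by linarith
  qed
  have jump_u: "norm (jump \<T> u e x) \<le> ?SM e" if "x \<in> e" for e x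
    using norm_jump_le[of u e x] sum_mono[of "face_elements e" "\<lambda>K. \<bar>u K x\<bar>" M] u(2) in_el[OF that] by force
  have jump_v: "norm (jump \<T> v e x) \<le> ?SN e" if "x \<in> e" for e x
    using norm_jump_le[of v e x] sum_mono[of "face_elements e" "\<lambda>K. \<bar>v K x\<bar>" N] v(2) in_el[OF that] by force
  have SM: "0 \<le> ?SM e" and SN: "0 \<le> ?SN e" for e using u(3) v(3) by (auto intro: sum_nonneg)
  have T2: "\<bar>\<Sum>e\<in>faces. face_integral e (\<lambda>x. average \<T> (flux A u) e x \<bullet> jump \<T> v e x)\<bar>
      \<le> 2 * (real CARD('d) + 1) * area_upper * (a\<^sub>1 * ?G) * ?H / h\<^sup>2 * ?LL"
  proof (rule face_sum)
    fix e assume e: "e \<in> faces"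
    have "\<bar>face_integral e (\<lambda>x. average \<T> (flux A u) e x \<bullet> jump \<T> v e x)\<bar>
        \<le> (a\<^sub>1 * (?G / h * ?SM e) * ?SN e) * (area_upper * ?H / h)"
    proof (rule face_integral_bound[OF e])
      show "continuous_on UNIV (\<lambda>x. average \<T> (flux A u) e x \<bullet> jump \<T> v e x)"
        by (intro continuous_on_inner continuous_average continuous_jump u(1) v(1))
      show "0 \<le> a\<^sub>1 * (?G / h * ?SM e) * ?SN e" using a1_pos G h_pos SM SN by simp
      show "\<bar>average \<T> (flux A u) e x \<bullet> jump \<T> v e x\<bar> \<le> a\<^sub>1 * (?G / h * ?SM e) * ?SN e" if "x \<in> e" for x
        by (rule abs_inner_le_mult[OF avg_u[OF that] jump_v[OF that]])
    qed
    then show "\<bar>face_integral e (\<lambda>x. average \<T> (flux A u) e x \<bullet> jump \<T> v e x)\<bar>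
        \<le> area_upper * (a\<^sub>1 * ?G) * ?H / h\<^sup>2 * (?SM e * ?SN e)"
      by (simp add: power2_eq_square mult_ac)
  qed (use a1_pos G in simp)
  have T3: "\<bar>\<Sum>e\<in>faces. face_integral e (\<lambda>x. jump \<T> u e x \<bullet> average \<T> (flux A v) e x)\<bar>
      \<le> 2 * (real CARD('d) + 1) * area_upper * (a\<^sub>1 * ?G) * ?H / h\<^sup>2 * ?LL"
  proof (rule face_sum)
    fix e assume e: "e \<in> faces"
    have "\<bar>face_integral e (\<lambda>x. jump \<T> u e x \<bullet> average \<T> (flux A v) e x)\<bar>
        \<le> (?SM e * (a\<^sub>1 * (?G / h * ?SN e))) * (area_upper * ?H / h)"
    proof (rule face_integral_bound[OF e])
      show "continuous_on UNIV (\<lambda>x. jump \<T> u e x \<bullet> average \<T> (flux A v) e x)"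
        by (intro continuous_on_inner continuous_average continuous_jump u(1) v(1))
      show "0 \<le> ?SM e * (a\<^sub>1 * (?G / h * ?SN e))" using a1_pos G h_pos SM SN by simp
      show "\<bar>jump \<T> u e x \<bullet> average \<T> (flux A v) e x\<bar> \<le> ?SM e * (a\<^sub>1 * (?G / h * ?SN e))" if "x \<in> e" for x
        by (rule abs_inner_le_mult[OF jump_u[OF that] avg_v[OF that]])
    qed
    then show "\<bar>face_integral e (\<lambda>x. jump \<T> u e x \<bullet> average \<T> (flux A v) e x)\<bar>
        \<le> area_upper * (a\<^sub>1 * ?G) * ?H / h\<^sup>2 * (?SM e * ?SN e)"
      by (simp add: power2_eq_square mult_ac)
  qed (use a1_pos G in simp)
  have T4: "\<bar>\<Sum>e\<in>faces. \<mu> / diameter e * face_integral e (\<lambda>x. jump \<T> u e x \<bullet> jump \<T> v e x)\<bar>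
      \<le> 2 * (real CARD('d) + 1) * area_upper * (\<mu> * C\<sigma>) * ?H / h\<^sup>2 * ?LL"
  proof (rule face_sum)
    fix e assume e: "e \<in> faces"
    have I: "\<bar>face_integral e (\<lambda>x. jump \<T> u e x \<bullet> jump \<T> v e x)\<bar> \<le> (?SM e * ?SN e) * (area_upper * ?H / h)"
    proof (rule face_integral_bound[OF e])
      show "continuous_on UNIV (\<lambda>x. jump \<T> u e x \<bullet> jump \<T> v e x)"
        by (intro continuous_on_inner continuous_jump u(1) v(1))
      show "0 \<le> ?SM e * ?SN e" using SM SN by simp
      show "\<bar>jump \<T> u e x \<bullet> jump \<T> v e x\<bar> \<le> ?SM e * ?SN e" if "x \<in> e" for x
        by (rule abs_inner_le_mult[OF jump_u[OF that] jump_v[OF that]])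
    qed
    have "\<mu> / diameter e \<le> \<mu> * C\<sigma> / h"
      using face_diameter(1,3)[OF e] h_pos C\<sigma>_pos \<mu> by (simp add: field_simps)
    then have "\<bar>\<mu> / diameter e\<bar> * \<bar>face_integral e (\<lambda>x. jump \<T> u e x \<bullet> jump \<T> v e x)\<bar>
        \<le> (\<mu> * C\<sigma> / h) * ((?SM e * ?SN e) * (area_upper * ?H / h))"
      using I \<mu> face_diameter(3)[OF e] C\<sigma>_pos h_pos by (intro mult_mono) auto
    then show "\<bar>\<mu> / diameter e * face_integral e (\<lambda>x. jump \<T> u e x \<bullet> jump \<T> v e x)\<bar>
        \<le> area_upper * (\<mu> * C\<sigma>) * ?H / h\<^sup>2 * (?SM e * ?SN e)"
      unfolding abs_mult by (simp add: power2_eq_square mult_ac)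
  qed (use \<mu> C\<sigma>_pos in simp)
  define X1 where "X1 = (\<Sum>K\<in>\<T>. LINT x:K|lborel. flux A u K x \<bullet> grad (v K) x)"
  define X2 where "X2 = (\<Sum>e\<in>faces. face_integral e (\<lambda>x. average \<T> (flux A u) e x \<bullet> jump \<T> v e x))"
  define X3 where "X3 = (\<Sum>e\<in>faces. face_integral e (\<lambda>x. jump \<T> u e x \<bullet> average \<T> (flux A v) e x))"
  define X4 where "X4 = (\<Sum>e\<in>faces. \<mu> / diameter e * face_integral e (\<lambda>x. jump \<T> u e x \<bullet> jump \<T> v e x))"
  have "\<bar>\<theta> * X3\<bar> \<le> \<bar>X3\<bar>" using \<theta> by (simp add: abs_mult mult_left_le_one_le)
  then have "\<bar>X1 - X2 + \<theta> * X3 + X4\<bar> \<le> \<bar>X1\<bar> + \<bar>X2\<bar> + \<bar>X3\<bar> + \<bar>X4\<bar>" by linarith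
  also have "\<dots> \<le> a\<^sub>1 * ?G\<^sup>2 * unit_volume * ?H / h\<^sup>2 * ?LL
      + 2 * (real CARD('d) + 1) * area_upper * (a\<^sub>1 * ?G) * ?H / h\<^sup>2 * ?LL
      + 2 * (real CARD('d) + 1) * area_upper * (a\<^sub>1 * ?G) * ?H / h\<^sup>2 * ?LL
      + 2 * (real CARD('d) + 1) * area_upper * (\<mu> * C\<sigma>) * ?H / h\<^sup>2 * ?LL"
    unfolding X1_def X2_def X3_def X4_def by (intro add_mono T1 T2 T3 T4)
  also have "\<dots> = continuity_constant \<mu> * ?H / h\<^sup>2 * ?LL"
    unfolding continuity_constant_def by (simp add: divide_inverse algebra_simps)
  finally show ?thesis unfolding dg_form_eq X1_def X2_def X3_def X4_def .
qed

subsection \<open>Coercivity in the energy norm\<close>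

definition element_energy :: "'d broken_fun \<Rightarrow> (real^'d) set \<Rightarrow> real" where
  "element_energy u K = (LINT x:K|lborel. (norm (grad (u K) x))\<^sup>2)"

definition jump_energy :: "'d broken_fun \<Rightarrow> (real^'d) set \<Rightarrow> real" where
  "jump_energy u e = face_integral e (\<lambda>x. (norm (jump \<T> u e x))\<^sup>2)"

lemma element_energy_nonneg: "0 \<le> element_energy u K"
  unfolding element_energy_def set_lebesgue_integral_def by (rule Bochner_Integration.integral_nonneg) simp

lemma jump_energy_nonneg: "0 \<le> jump_energy u e"
  unfolding jump_energy_def face_integral_def set_lebesgue_integral_def
  by (rule Bochner_Integration.integral_nonneg) simp

definition gradient_constant :: real where "gradient_constant = \<kappa> ^ CARD('d) * C\<^sub>2"

lemma C3_pos: "0 < gradient_constant"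
  using C\<sigma>_pos C2_pos by (simp add: gradient_constant_def)

lemma grad_le_energy:
  assumes u: "broken_poly u" and K: "K \<in> \<T>" and x: "x \<in> K"
  shows "h ^ CARD('d) * (norm (grad (u K) x))\<^sup>2 \<le> gradient_constant * element_energy u K"
proof -
  have sm: "smooth_fun (u K)" by (rule broken_smooth[OF u K])
  have cont: "continuous_on UNIV (\<lambda>x. (norm (grad (u K) x))\<^sup>2)"
    by (intro continuous_intros smooth_fun_continuous_grad[OF sm])
  have "(LINT y:cball (center K) ball_radius|lborel. (norm (grad (u K) y))\<^sup>2) \<le> element_energy u K"
    unfolding element_energy_def
    by (intro set_integral_mono_domain element_integrable K cont center_ball[OF K]
        set_integrable_continuous_on_compact compact_cball continuous_on_subset[OF cont] subset_UNIV) simp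
  moreover have "ball_radius ^ CARD('d) * (norm (grad (u K) x))\<^sup>2
      \<le> C\<^sub>2 * (LINT y:cball (center K) ball_radius|lborel. (norm (grad (u K) y))\<^sup>2)"
    using u K x element_subset_center_ball[OF K]
    by (intro inverse_L2[OF _ ball_radius_pos]) (auto simp: broken_poly_def)
  ultimately have 1: "ball_radius ^ CARD('d) * (norm (grad (u K) x))\<^sup>2 \<le> C\<^sub>2 * element_energy u K"
    using C2_pos by (meson mult_left_mono less_imp_le order_trans)
  have "h ^ CARD('d) * (norm (grad (u K) x))\<^sup>2 \<le> (\<kappa> * ball_radius) ^ CARD('d) * (norm (grad (u K) x))\<^sup>2"
    using h_le h_pos by (intro mult_right_mono power_mono) auto
  also have "\<dots> = \<kappa> ^ CARD('d) * (ball_radius ^ CARD('d) * (norm (grad (u K) x))\<^sup>2)"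
    by (simp add: power_mult_distrib mult_ac)
  also have "\<dots> \<le> \<kappa> ^ CARD('d) * (C\<^sub>2 * element_energy u K)"
    using 1 C\<sigma>_pos by (intro mult_left_mono) auto
  finally show ?thesis by (simp add: gradient_constant_def mult.assoc)
qed

text \<open>Chosen such that the gradient part of the consistency term, summed over all faces, is at most half of
  the energy provided by the ellipticity of \<open>A\<close>.\<close>

definition penalty_threshold :: real where
  "penalty_threshold = 8 * a\<^sub>1\<^sup>2 * gradient_constant * area_upper * (real CARD('d) + 1) / a\<^sub>0"

text \<open>Young's inequality with weights \<open>2 h_e / \<mu>\<close> and \<open>\<mu> / (2 h_e)\<close>; the first part is absorbed by the
  gradient term through the inverse estimate, the second by half of the penalty.\<close>

lemma consistency_term_bound:
  assumes u: "broken_poly u" and e: "e \<in> faces" and \<mu>: "0 < \<mu>"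
  shows "2 * face_integral e (\<lambda>x. average \<T> (flux A u) e x \<bullet> jump \<T> u e x)
    \<le> 4 * a\<^sub>1\<^sup>2 * gradient_constant * area_upper / \<mu> * (\<Sum>K\<in>face_elements e. element_energy u K)
      + \<mu> / (2 * diameter e) * jump_energy u e"
proof -
  let ?M = "hyperplane_measure (affine hull e)" and ?H = "h ^ CARD('d)"
  let ?a = "\<lambda>x. average \<T> (flux A u) e x" and ?j = "\<lambda>x. jump \<T> u e x" and ?d = "diameter e"
  let ?E = "\<Sum>K\<in>face_elements e. element_energy u K"
  have d: "0 < ?d" "?d \<le> h" using face_diameter[OF e] by auto
  have Hp: "0 < ?H" using h_pos by simp
  have E0: "0 \<le> ?E" by (intro sum_nonneg element_energy_nonneg)
  have C3: "0 \<le> gradient_constant" using C3_pos by simp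
  have avg: "(norm (?a x))\<^sup>2 \<le> 2 * a\<^sub>1\<^sup>2 * gradient_constant / ?H * ?E" if x: "x \<in> e" for x
  proof -
    have "(norm (?a x))\<^sup>2 \<le> (a\<^sub>1 * (\<Sum>K\<in>face_elements e. norm (grad (u K) x)))\<^sup>2"
      by (rule power_mono[OF norm_average_le]) simp
    also have "\<dots> = a\<^sub>1\<^sup>2 * (\<Sum>K\<in>face_elements e. norm (grad (u K) x))\<^sup>2" by (rule power_mult_distrib)
    also have "\<dots> \<le> a\<^sub>1\<^sup>2 * (2 * (\<Sum>K\<in>face_elements e. (norm (grad (u K) x))\<^sup>2))"
      by (intro mult_left_mono sum_square_le_card_2 card_face_elements[OF e]) simp
    also have "\<dots> \<le> a\<^sub>1\<^sup>2 * (2 * (\<Sum>K\<in>face_elements e. gradient_constant / ?H * element_energy u K))"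
    proof (intro mult_left_mono sum_mono)
      fix K assume "K \<in> face_elements e"
      then have "?H * (norm (grad (u K) x))\<^sup>2 \<le> gradient_constant * element_energy u K"
        using grad_le_energy[OF u, of K x] x face_subset_element face_elements_subset by blast
      then show "(norm (grad (u K) x))\<^sup>2 \<le> gradient_constant / ?H * element_energy u K"
        using Hp by (simp add: field_simps)
    qed auto
    also have "\<dots> = 2 * a\<^sub>1\<^sup>2 * gradient_constant / ?H * ?E" unfolding sum_distrib_left[symmetric] by simp
    finally show ?thesis .
  qed
  have ca: "continuous_on UNIV ?a" and cj: "continuous_on UNIV ?j"
    by (rule continuous_average[OF u], rule continuous_jump[OF u])
  have young: "2 * (?a x \<bullet> ?j x) \<le> 2 * ?d / \<mu> * (norm (?a x))\<^sup>2 + \<mu> / (2 * ?d) * (norm (?j x))\<^sup>2" for x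
  proof -
    let ?t = "2 * ?d / \<mu>"
    have t: "?t > 0" using d \<mu> by simp
    have "2 * (?a x \<bullet> ?j x) \<le> 2 * (norm (?a x) * norm (?j x))" using norm_cauchy_schwarz[of "?a x" "?j x"] by simp
    also have "\<dots> \<le> ?t * (norm (?a x))\<^sup>2 + 1 / ?t * (norm (?j x))\<^sup>2"
    proof -
      have scale: "2 * (p * q) \<le> t * p\<^sup>2 + 1 / t * q\<^sup>2" if "0 < t" for p q t :: real
      proof -
        have "0 \<le> (t * p - q)\<^sup>2 / t" by (rule divide_nonneg_pos[OF zero_le_power2 that])
        also have "\<dots> = t * p\<^sup>2 + 1 / t * q\<^sup>2 - 2 * (p * q)" using that by (simp add: power2_eq_square field_simps)
        finally show ?thesis by simp
      qed
      show ?thesis by (rule scale[OF t])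
    qed
    finally show ?thesis by simp
  qed
  have "2 * face_integral e (\<lambda>x. ?a x \<bullet> ?j x) = (LINT x:e|?M. 2 * (?a x \<bullet> ?j x))"
    by (simp add: face_integral_def)
  also have "\<dots> \<le> (LINT x:e|?M. 2 * ?d / \<mu> * (norm (?a x))\<^sup>2 + \<mu> / (2 * ?d) * (norm (?j x))\<^sup>2)"
    using young by (intro set_integral_mono face_integrable[OF e] continuous_intros ca cj) auto
  also have "\<dots> = (LINT x:e|?M. 2 * ?d / \<mu> * (norm (?a x))\<^sup>2) + (LINT x:e|?M. \<mu> / (2 * ?d) * (norm (?j x))\<^sup>2)"
    by (intro set_integral_add face_integrable[OF e] continuous_intros ca cj)
  also have "\<dots> = 2 * ?d / \<mu> * (LINT x:e|?M. (norm (?a x))\<^sup>2) + \<mu> / (2 * ?d) * jump_energy u e"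
    by (simp only: set_integral_mult_right jump_energy_def face_integral_def)
  also have "2 * ?d / \<mu> * (LINT x:e|?M. (norm (?a x))\<^sup>2) \<le> 2 * h / \<mu> * ((2 * a\<^sub>1\<^sup>2 * gradient_constant / ?H * ?E) * facet_area e)"
  proof (intro mult_mono)
    show "(LINT x:e|?M. (norm (?a x))\<^sup>2) \<le> (2 * a\<^sub>1\<^sup>2 * gradient_constant / ?H * ?E) * facet_area e"
      unfolding facet_area_def
      by (intro set_integral_le_measure[OF sets_hyperplane_measure face_compact_finite[OF e]] continuous_intros ca avg)
    show "0 \<le> (LINT x:e|?M. (norm (?a x))\<^sup>2)"
      unfolding set_lebesgue_integral_def by (rule Bochner_Integration.integral_nonneg) simp
    show "2 * ?d / \<mu> \<le> 2 * h / \<mu>" using d \<mu> by (simp add: divide_right_mono)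
    show "0 \<le> 2 * h / \<mu>" using h_pos \<mu> by simp
  qed
  also have "2 * h / \<mu> * ((2 * a\<^sub>1\<^sup>2 * gradient_constant / ?H * ?E) * facet_area e)
      = (4 * a\<^sub>1\<^sup>2 * gradient_constant / \<mu> / ?H * ?E) * (h * facet_area e)" by simp
  also have "\<dots> \<le> (4 * a\<^sub>1\<^sup>2 * gradient_constant / \<mu> / ?H * ?E) * (area_upper * ?H)"
    using face_area(2)[OF e] E0 C3 \<mu> Hp by (intro mult_left_mono) auto
  also have "\<dots> = 4 * a\<^sub>1\<^sup>2 * gradient_constant * area_upper / \<mu> * ?E" using h_pos by simp
  finally show ?thesis by simp
qed

lemma dg_form_coercive_energy:
  assumes u: "broken_poly u" and \<mu>: "0 < \<mu>" and \<theta>: "\<theta> = 1 \<or> (\<theta> = -1 \<and> penalty_threshold \<le> \<mu>)"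
  shows "a\<^sub>0 / 2 * (\<Sum>K\<in>\<T>. element_energy u K) + \<mu> / 2 * (\<Sum>e\<in>faces. jump_energy u e / diameter e)
    \<le> dg_form A \<theta> \<mu> \<Omega> \<T> u u"
proof -
  let ?E = "\<Sum>K\<in>\<T>. element_energy u K" and ?J = "\<Sum>e\<in>faces. jump_energy u e / diameter e"
  let ?X = "\<Sum>e\<in>faces. face_integral e (\<lambda>x. average \<T> (flux A u) e x \<bullet> jump \<T> u e x)"
  let ?V = "\<Sum>K\<in>\<T>. LINT x:K|lborel. flux A u K x \<bullet> grad (u K) x"
  have E0: "0 \<le> ?E" by (intro sum_nonneg element_energy_nonneg)
  have J0: "0 \<le> ?J" using face_diameter(3) jump_energy_nonneg by (intro sum_nonneg divide_nonneg_pos)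
  have V: "a\<^sub>0 * ?E \<le> ?V" unfolding sum_distrib_left
  proof (rule sum_mono)
    fix K assume K: "K \<in> \<T>"
    have "a\<^sub>0 * element_energy u K = (LINT x:K|lborel. a\<^sub>0 * (norm (grad (u K) x))\<^sup>2)"
      by (simp add: element_energy_def)
    also have "\<dots> \<le> (LINT x:K|lborel. flux A u K x \<bullet> grad (u K) x)"
      using A_lower K u
      by (intro set_integral_mono element_integrable K continuous_intros continuous_flux smooth_fun_continuous_grad broken_smooth u)
         (auto simp: flux_def inner_commute)
    finally show "a\<^sub>0 * element_energy u K \<le> (LINT x:K|lborel. flux A u K x \<bullet> grad (u K) x)" .
  qed
  have P: "(\<Sum>e\<in>faces. \<mu> / diameter e * face_integral e (\<lambda>x. jump \<T> u e x \<bullet> jump \<T> u e x)) = \<mu> * ?J"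
    by (simp add: sum_distrib_left jump_energy_def power2_norm_eq_inner)
  have form: "dg_form A \<theta> \<mu> \<Omega> \<T> u u = ?V - ?X + \<theta> * ?X + \<mu> * ?J"
    unfolding dg_form_eq P by (simp add: inner_commute)
  from \<theta> show ?thesis
  proof
    assume "\<theta> = 1"
    then have "dg_form A \<theta> \<mu> \<Omega> \<T> u u = ?V + \<mu> * ?J" using form by simp
    moreover have "a\<^sub>0 / 2 * ?E \<le> a\<^sub>0 * ?E" "\<mu> / 2 * ?J \<le> \<mu> * ?J" using E0 J0 a0_pos \<mu> by (auto intro!: mult_right_mono)
    ultimately show ?thesis using V by linarith
  next
    assume \<theta>: "\<theta> = -1 \<and> penalty_threshold \<le> \<mu>"
    have "2 * ?X \<le> (\<Sum>e\<in>faces. 4 * a\<^sub>1\<^sup>2 * gradient_constant * area_upper / \<mu> * (\<Sum>K\<in>face_elements e. element_energy u K)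
        + \<mu> / 2 * (jump_energy u e / diameter e))"
      unfolding sum_distrib_left using consistency_term_bound[OF u _ \<mu>]
      by (intro sum_mono) (simp add: sum_distrib_left)
    also have "\<dots> = 4 * a\<^sub>1\<^sup>2 * gradient_constant * area_upper / \<mu> * ((real CARD('d) + 1) * ?E) + \<mu> / 2 * ?J"
      unfolding sum.distrib sum_distrib_left[symmetric] sum_faces_elements_const ..
    also have "4 * a\<^sub>1\<^sup>2 * gradient_constant * area_upper / \<mu> * ((real CARD('d) + 1) * ?E) = (a\<^sub>0 / 2 * ?E) * (penalty_threshold / \<mu>)"
      using a0_pos \<mu> by (simp add: penalty_threshold_def field_simps)
    also have "\<dots> \<le> (a\<^sub>0 / 2 * ?E) * 1" using \<theta> \<mu> a0_pos E0 by (intro mult_left_mono) auto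
    finally have "2 * ?X \<le> a\<^sub>0 / 2 * ?E + \<mu> / 2 * ?J" by simp
    then show ?thesis using form \<theta> V by simp
  qed
qed

end

section \<open>A discrete Poincare inequality\<close>

definition face_point :: "(real^'d) set \<Rightarrow> real^'d" where
  "face_point e = (SOME y. y \<in> e)"

context quasi_uniform_mesh begin

lemma face_point_in: "e \<noteq> {} \<Longrightarrow> face_point e \<in> e"
  unfolding face_point_def by (rule someI_ex) auto

text \<open>The volume of a simplex is the signed sum of the volumes of the cones that join its facets to the
  origin; the signed height of such a cone is the value of \<open>n \<bullet> y\<close> on the facet. In barycentric
  coordinates this says that the offsets, which are the coordinates of the origin, add up to one.\<close>

lemma signed_cone_volumes:
  assumes K: "K \<in> \<T>"
  shows "(\<Sum>v\<in>vertices K. facet_area (opposite_facet K v)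
            * (outward_normal K (opposite_facet K v) \<bullet> face_point (opposite_facet K v)))
    = facet_constant TYPE('d) * measure lborel K"
proof -
  have sK: "full_simplex K" by (rule element_simplex[OF K])
  let ?c = "facet_constant TYPE('d) * measure lborel K"
  have "facet_area (opposite_facet K v) * (outward_normal K (opposite_facet K v) \<bullet> face_point (opposite_facet K v))
      = ?c * bary_offset K v" if v: "v \<in> vertices K" for v
  proof -
    let ?e = "opposite_facet K v" and ?g = "bary_grad K v"
    have g: "norm ?g > 0" using bary_grad_nonzero[OF sK v] by simp
    have "?e \<noteq> {}" using facet_of_simplex_iff[OF sK, of ?e] v by (auto simp: facet_of_def)
    then have "face_point ?e \<in> ?e" by (rule face_point_in)
    then have "bary_coord K v (face_point ?e) = 0" using opposite_facet_eq[OF sK v] by auto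
    then have gp: "?g \<bullet> face_point ?e = - bary_offset K v" by (simp add: bary_coord_def)
    have "outward_normal K ?e \<bullet> face_point ?e = bary_offset K v / norm ?g"
      unfolding outward_normal_opposite_facet[OF sK v] using gp by (simp add: divide_inverse)
    then show ?thesis unfolding facet_area_eq[OF sK v] using g by simp
  qed
  then have "(\<Sum>v\<in>vertices K. facet_area (opposite_facet K v)
            * (outward_normal K (opposite_facet K v) \<bullet> face_point (opposite_facet K v)))
      = (\<Sum>v\<in>vertices K. ?c * bary_offset K v)" by (intro sum.cong refl)
  also have "\<dots> = ?c" unfolding sum_distrib_left[symmetric] bary_offset_sum[OF sK] by simp
  finally show ?thesis .
qed

definition face_jump :: "((real^'d) set \<Rightarrow> real) \<Rightarrow> (real^'d) set \<Rightarrow> real" where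
  "face_jump \<nu> e = norm (\<Sum>K\<in>face_elements e. \<nu> K *\<^sub>R outward_normal K e)"

text \<open>On an interior face the two normals are opposite, so the contributions of the two elements
  combine to \<open>\<nu>\<^sub>+\<^sup>2 - \<nu>\<^sub>-\<^sup>2 = (\<nu>\<^sub>+ - \<nu>\<^sub>-) (\<nu>\<^sub>+ + \<nu>\<^sub>-)\<close>.\<close>

lemma face_flux_le_jump:
  assumes e: "e \<in> faces" and y: "norm y \<le> R"
  shows "(\<Sum>K\<in>face_elements e. (\<nu> K)\<^sup>2 * (outward_normal K e \<bullet> y))
    \<le> R * (face_jump \<nu> e * (\<Sum>K\<in>face_elements e. \<bar>\<nu> K\<bar>))"
proof -
  have ny: "\<bar>outward_normal K e \<bullet> y\<bar> \<le> R" if "K \<in> face_elements e" for K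
    using abs_inner_le_mult[of "outward_normal K e" 1 y R] norm_outward_normal[OF that] y by simp
  have R: "0 \<le> R" using y norm_ge_zero order_trans by blast
  show ?thesis
  proof (rule face_elements_cases[OF e])
    fix K assume fe: "face_elements e = {K}"
    have n1: "norm (outward_normal K e) = 1" using norm_outward_normal[of K e] fe by simp
    have "(\<nu> K)\<^sup>2 * (outward_normal K e \<bullet> y) \<le> (\<nu> K)\<^sup>2 * R"
      using ny[of K] fe by (intro mult_left_mono) auto
    then show ?thesis using n1 by (simp add: fe face_jump_def power2_eq_square mult_ac)
  next
    fix K K' assume ne: "K \<noteq> K'" and fe: "face_elements e = {K, K'}" and op: "outward_normal K' e = - outward_normal K e"
    have n1: "norm (outward_normal K e) = 1" using norm_outward_normal[of K e] fe by simp
    have "(\<Sum>K\<in>face_elements e. (\<nu> K)\<^sup>2 * (outward_normal K e \<bullet> y))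
        = ((\<nu> K - \<nu> K') * (\<nu> K + \<nu> K')) * (outward_normal K e \<bullet> y)"
      unfolding fe using ne op by (simp add: power2_eq_square algebra_simps)
    also have "\<dots> \<le> \<bar>((\<nu> K - \<nu> K') * (\<nu> K + \<nu> K')) * (outward_normal K e \<bullet> y)\<bar>" by (rule abs_ge_self)
    also have "\<dots> = (\<bar>\<nu> K - \<nu> K'\<bar> * \<bar>\<nu> K + \<nu> K'\<bar>) * \<bar>outward_normal K e \<bullet> y\<bar>" by (simp add: abs_mult)
    also have "\<dots> \<le> (\<bar>\<nu> K - \<nu> K'\<bar> * (\<bar>\<nu> K\<bar> + \<bar>\<nu> K'\<bar>)) * R"
      using ny[of K] fe by (intro mult_mono mult_left_mono abs_triangle_ineq) auto
    finally have "(\<Sum>K\<in>face_elements e. (\<nu> K)\<^sup>2 * (outward_normal K e \<bullet> y))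
        \<le> (\<bar>\<nu> K - \<nu> K'\<bar> * (\<bar>\<nu> K\<bar> + \<bar>\<nu> K'\<bar>)) * R" .
    moreover have "face_jump \<nu> e = \<bar>\<nu> K - \<nu> K'\<bar>"
    proof -
      have "(\<Sum>K\<in>face_elements e. \<nu> K *\<^sub>R outward_normal K e) = (\<nu> K - \<nu> K') *\<^sub>R outward_normal K e"
        unfolding fe using ne op by (simp add: scaleR_diff_left)
      then show ?thesis unfolding face_jump_def using n1 by simp
    qed
    moreover have "(\<Sum>K\<in>face_elements e. \<bar>\<nu> K\<bar>) = \<bar>\<nu> K\<bar> + \<bar>\<nu> K'\<bar>" unfolding fe using ne by simp
    ultimately show ?thesis by (simp only: mult_ac)
  qed
qed

definition poincare_constant :: "real \<Rightarrow> real" where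
  "poincare_constant R = 2 * R\<^sup>2 * (real CARD('d) + 1) * area_upper / area_lower\<^sup>2"

text \<open>Summing the signed cones weighted with \<open>\<nu>\<^sup>2\<close> and collecting the terms face by face bounds the
  weighted square sum by products of jumps and values. Young's inequality separates them, with the
  weight \<open>\<eta>\<close> chosen such that the values take up half of the left-hand side.\<close>

lemma discrete_poincare:
  assumes R: "\<And>x. x \<in> \<Union>\<T> \<Longrightarrow> norm x \<le> R"
  shows "h * h ^ CARD('d) * (\<Sum>K\<in>\<T>. (\<nu> K)\<^sup>2)
    \<le> poincare_constant R * (\<Sum>e\<in>faces. facet_area e * (face_jump \<nu> e)\<^sup>2)"
proof -
  let ?H = "h ^ CARD('d)" and ?D = "real CARD('d) + 1" and ?N = "\<Sum>K\<in>\<T>. (\<nu> K)\<^sup>2"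
  let ?S = "\<Sum>e\<in>faces. facet_area e * (face_jump \<nu> e)\<^sup>2"
  let ?q = "\<lambda>e. \<Sum>K\<in>face_elements e. \<bar>\<nu> K\<bar>"
  note au = area_bounds_pos
  have Hp: "?H > 0" using h_pos by simp
  have N0: "?N \<ge> 0" by (rule sum_nonneg) simp
  define \<eta> where "\<eta> = area_lower * h / (4 * ?D * area_upper)"
  have D: "?D > 0" by simp
  have \<eta>: "\<eta> > 0" using au h_pos by (simp add: \<eta>_def)
  have "area_lower * ?H * ?N = (\<Sum>K\<in>\<T>. (\<nu> K)\<^sup>2 * (area_lower * ?H))" by (simp add: sum_distrib_left mult_ac)
  also have "\<dots> \<le> (\<Sum>K\<in>\<T>. (\<nu> K)\<^sup>2 * (facet_constant TYPE('d) * measure lborel K))"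
  proof (intro sum_mono mult_left_mono)
    fix K assume "K \<in> \<T>"
    then show "area_lower * ?H \<le> facet_constant TYPE('d) * measure lborel K"
      using mult_left_mono[OF element_volume_ge less_imp_le[OF facet_constant_pos], of K]
      by (simp add: area_lower_def power_divide)
  qed simp
  also have "\<dots> = (\<Sum>K\<in>\<T>. \<Sum>v\<in>vertices K. (\<nu> K)\<^sup>2 * (facet_area (opposite_facet K v)
            * (outward_normal K (opposite_facet K v) \<bullet> face_point (opposite_facet K v))))"
    by (intro sum.cong refl) (simp only: signed_cone_volumes[symmetric] sum_distrib_left)
  also have "\<dots> = (\<Sum>e\<in>faces. \<Sum>K\<in>face_elements e. (\<nu> K)\<^sup>2 * (facet_area e * (outward_normal K e \<bullet> face_point e)))"
    by (rule sum_faces_elements[symmetric])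
  also have "\<dots> = (\<Sum>e\<in>faces. facet_area e * (\<Sum>K\<in>face_elements e. (\<nu> K)\<^sup>2 * (outward_normal K e \<bullet> face_point e)))"
    by (simp add: sum_distrib_left mult_ac)
  also have "\<dots> \<le> (\<Sum>e\<in>faces. facet_area e * (2 * \<eta> * (\<Sum>K\<in>face_elements e. (\<nu> K)\<^sup>2) + R\<^sup>2 / (4 * \<eta>) * (face_jump \<nu> e)\<^sup>2))"
  proof (intro sum_mono mult_left_mono facet_area_nonneg)
    fix e assume e: "e \<in> faces"
    obtain K where K: "K \<in> face_elements e" using face_elements_nonempty[OF e] by blast
    then have "e \<noteq> {}" by (auto simp: face_elements_def facet_of_def)
    then have "face_point e \<in> \<Union>\<T>"
      using face_point_in[of e] face_subset_element[OF K] face_elements_subset K by blast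
    then have "(\<Sum>K\<in>face_elements e. (\<nu> K)\<^sup>2 * (outward_normal K e \<bullet> face_point e)) \<le> R * (face_jump \<nu> e * ?q e)"
      by (intro face_flux_le_jump[OF e] R)
    also have "\<dots> \<le> \<eta> * (?q e)\<^sup>2 + R\<^sup>2 / (4 * \<eta>) * (face_jump \<nu> e)\<^sup>2"
    proof -
      have "0 \<le> (2 * \<eta> * ?q e - R * face_jump \<nu> e)\<^sup>2 / (4 * \<eta>)"
        using \<eta> by (intro divide_nonneg_pos zero_le_power2) simp
      also have "\<dots> = \<eta> * (?q e)\<^sup>2 + R\<^sup>2 / (4 * \<eta>) * (face_jump \<nu> e)\<^sup>2 - R * (face_jump \<nu> e * ?q e)"
        using \<eta> by (simp add: power2_eq_square field_simps)
      finally show ?thesis by simp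
    qed
    also have "\<eta> * (?q e)\<^sup>2 \<le> 2 * \<eta> * (\<Sum>K\<in>face_elements e. (\<nu> K)\<^sup>2)"
    proof -
      have "(?q e)\<^sup>2 \<le> 2 * (\<Sum>K\<in>face_elements e. \<bar>\<nu> K\<bar>\<^sup>2)"
        by (rule sum_square_le_card_2[OF card_face_elements[OF e]])
      from mult_left_mono[OF this less_imp_le[OF \<eta>]] show ?thesis by simp
    qed
    finally show "(\<Sum>K\<in>face_elements e. (\<nu> K)\<^sup>2 * (outward_normal K e \<bullet> face_point e))
        \<le> 2 * \<eta> * (\<Sum>K\<in>face_elements e. (\<nu> K)\<^sup>2) + R\<^sup>2 / (4 * \<eta>) * (face_jump \<nu> e)\<^sup>2" by simp
  qed
  also have "\<dots> = 2 * \<eta> * (\<Sum>e\<in>faces. facet_area e * (\<Sum>K\<in>face_elements e. (\<nu> K)\<^sup>2)) + R\<^sup>2 / (4 * \<eta>) * ?S"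
    by (simp add: sum.distrib sum_distrib_left algebra_simps)
  also have "2 * \<eta> * (\<Sum>e\<in>faces. facet_area e * (\<Sum>K\<in>face_elements e. (\<nu> K)\<^sup>2)) \<le> area_lower * ?H / 2 * ?N"
  proof -
    have "facet_area e \<le> area_upper * ?H / h" if "e \<in> faces" for e
      using face_area(2)[OF that] h_pos by (simp add: field_simps)
    then have "(\<Sum>e\<in>faces. facet_area e * (\<Sum>K\<in>face_elements e. (\<nu> K)\<^sup>2))
        \<le> (\<Sum>e\<in>faces. area_upper * ?H / h * (\<Sum>K\<in>face_elements e. (\<nu> K)\<^sup>2))"
      by (intro sum_mono mult_right_mono sum_nonneg) auto
    also have "\<dots> = area_upper * ?H / h * (?D * ?N)"
      unfolding sum_distrib_left[symmetric] sum_faces_elements_const ..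
    finally have "2 * \<eta> * (\<Sum>e\<in>faces. facet_area e * (\<Sum>K\<in>face_elements e. (\<nu> K)\<^sup>2))
        \<le> 2 * \<eta> * (area_upper * ?H / h * (?D * ?N))" using \<eta> by (intro mult_left_mono) auto
    also have "\<dots> = area_lower * ?H / 2 * ?N"
    proof -
      have "2 * (area_lower * h / (4 * D * area_upper)) * (area_upper * ?H / h * (D * ?N)) = area_lower * ?H / 2 * ?N"
        if "0 < D" for D using that au h_pos by simp
      from this[OF D] show ?thesis unfolding \<eta>_def .
    qed
    finally show ?thesis .
  qed
  finally have main: "area_lower * ?H / 2 * ?N \<le> R\<^sup>2 / (4 * \<eta>) * ?S" by simp
  have "h * ?H * ?N = 2 * h / area_lower * (area_lower * ?H / 2 * ?N)" using au by simp
  also have "\<dots> \<le> 2 * h / area_lower * (R\<^sup>2 / (4 * \<eta>) * ?S)" using main au h_pos by (intro mult_left_mono) auto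
  also have "\<dots> = poincare_constant R * ?S"
  proof -
    have "2 * h / area_lower * (R\<^sup>2 / (4 * (area_lower * h / (4 * D * area_upper))) * ?S)
        = 2 * R\<^sup>2 * D * area_upper / area_lower\<^sup>2 * ?S"
      if "0 < D" for D using that au h_pos by (simp add: power2_eq_square)
    from this[OF D] show ?thesis unfolding \<eta>_def poincare_constant_def .
  qed
  finally show ?thesis .
qed

end

context dg_mesh begin

text \<open>The jump of the central values differs from the jump of the traces by the variation of the
  polynomials over their elements, which the inverse estimate bounds by the gradient energy.\<close>

lemma central_jump_le_energy:
  assumes u: "broken_poly u" and e: "e \<in> faces"
  shows "facet_area e * (face_jump (\<lambda>K. u K (barycenter K)) e)\<^sup>2
    \<le> 2 * jump_energy u e + 4 * h * gradient_constant * area_upper * (\<Sum>K\<in>face_elements e. element_energy u K)"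
proof -
  let ?M = "hyperplane_measure (affine hull e)" and ?H = "h ^ CARD('d)"
  let ?\<nu> = "\<lambda>K. u K (barycenter K)" and ?j = "\<lambda>x. jump \<T> u e x"
  let ?\<delta> = "face_jump ?\<nu> e" and ?E = "\<Sum>K\<in>face_elements e. element_energy u K"
  have Hp: "?H > 0" using h_pos by simp
  define G where "G K = sqrt (gradient_constant * element_energy u K / ?H)" for K
  have G2: "(G K)\<^sup>2 = gradient_constant * element_energy u K / ?H" for K
    unfolding G_def using C3_pos Hp element_energy_nonneg[of u K] by simp
  have G0: "0 \<le> G K" for K unfolding G_def using C3_pos Hp element_energy_nonneg[of u K] by simp
  define B where "B = 4 * h\<^sup>2 * (gradient_constant / ?H * ?E)"
  have pt: "?\<delta>\<^sup>2 - 2 * (norm (?j x))\<^sup>2 \<le> B" if x: "x \<in> e" for x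
  proof -
    have var: "norm ((?\<nu> K - u K x) *\<^sub>R outward_normal K e) \<le> h * G K" if K: "K \<in> face_elements e" for K
    proof -
      have KT: "K \<in> \<T>" "x \<in> K" using K x face_elements_subset face_subset_element by blast+
      have bK: "barycenter K \<in> K" by (rule barycenter_in_simplex[OF element_simplex[OF KT(1)]])
      have "\<bar>u K (barycenter K) - u K x\<bar> \<le> G K * dist (barycenter K) x"
      proof (rule grad_bound_imp_Lipschitz[OF broken_smooth[OF u KT(1)] simplex_compact_convex(2)[OF element_simplex[OF KT(1)]] _ bK KT(2)])
        fix z assume "z \<in> K"
        then have "(norm (grad (u K) z))\<^sup>2 \<le> gradient_constant * element_energy u K / ?H"
          using grad_le_energy[OF u KT(1), of z] Hp by (simp add: field_simps)
        then show "norm (grad (u K) z) \<le> G K" unfolding G_def by (rule real_le_rsqrt)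
      qed
      also have "\<dots> \<le> G K * h" using element_dist[OF KT(1) bK KT(2)] G0 by (intro mult_left_mono)
      finally show ?thesis using norm_outward_normal[OF K] by (simp add: mult.commute)
    qed
    have "(\<Sum>K\<in>face_elements e. ?\<nu> K *\<^sub>R outward_normal K e)
        = ?j x + (\<Sum>K\<in>face_elements e. (?\<nu> K - u K x) *\<^sub>R outward_normal K e)"
      unfolding jump_eq by (simp add: scaleR_diff_left sum_subtractf)
    then have "?\<delta> \<le> norm (?j x) + norm (\<Sum>K\<in>face_elements e. (?\<nu> K - u K x) *\<^sub>R outward_normal K e)"
      unfolding face_jump_def by (simp add: norm_triangle_ineq)
    also have "\<dots> \<le> norm (?j x) + (\<Sum>K\<in>face_elements e. h * G K)"
      by (intro add_left_mono sum_norm_le var)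
    finally have "?\<delta>\<^sup>2 \<le> (norm (?j x) + (\<Sum>K\<in>face_elements e. h * G K))\<^sup>2"
      by (rule power_mono) (simp add: face_jump_def)
    also have "\<dots> \<le> 2 * (norm (?j x))\<^sup>2 + 2 * (\<Sum>K\<in>face_elements e. h * G K)\<^sup>2"
    proof -
      have "(a + b)\<^sup>2 \<le> 2 * a\<^sup>2 + 2 * b\<^sup>2" for a b :: real
        using zero_le_power2[of "a - b"] by (simp add: power2_eq_square algebra_simps)
      then show ?thesis .
    qed
    also have "(\<Sum>K\<in>face_elements e. h * G K)\<^sup>2 \<le> 2 * (\<Sum>K\<in>face_elements e. (h * G K)\<^sup>2)"
      by (rule sum_square_le_card_2[OF card_face_elements[OF e]])
    also have "2 * (2 * (\<Sum>K\<in>face_elements e. (h * G K)\<^sup>2)) = B"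
      unfolding B_def power_mult_distrib G2 by (simp add: sum_distrib_left mult.assoc)
    finally show ?thesis by simp
  qed
  have cj: "continuous_on UNIV ?j" by (rule continuous_jump[OF u])
  have fin: "emeasure ?M e < \<infinity>" and "compact e" using face_compact_finite[OF e] by auto
  then have "e \<in> sets ?M" by (simp add: borel_compact)
  have "facet_area e * ?\<delta>\<^sup>2 - 2 * jump_energy u e = (LINT x:e|?M. ?\<delta>\<^sup>2) - (LINT x:e|?M. 2 * (norm (?j x))\<^sup>2)"
    using fin \<open>e \<in> sets ?M\<close> by (simp add: set_integral_const facet_area_def jump_energy_def face_integral_def)
  also have "\<dots> = (LINT x:e|?M. ?\<delta>\<^sup>2 - 2 * (norm (?j x))\<^sup>2)"
    by (intro set_integral_diff(2)[symmetric] face_integrable[OF e] continuous_intros cj)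
  also have "\<dots> \<le> B * facet_area e"
    unfolding facet_area_def
    by (intro set_integral_le_measure[OF sets_hyperplane_measure \<open>compact e\<close> fin] continuous_intros cj pt)
  also have "\<dots> = (4 * h * (gradient_constant / ?H * ?E)) * (h * facet_area e)"
    by (simp add: B_def power2_eq_square)
  also have "\<dots> \<le> (4 * h * (gradient_constant / ?H * ?E)) * (area_upper * ?H)"
    using face_area(2)[OF e] h_pos C3_pos Hp
    by (intro mult_left_mono mult_nonneg_nonneg sum_nonneg element_energy_nonneg divide_nonneg_pos) auto
  also have "\<dots> = 4 * h * gradient_constant * area_upper * ?E" using h_pos by simp
  finally show ?thesis by simp
qed

definition stability_constant :: "real \<Rightarrow> real" where
  "stability_constant R = poincare_constant R * (2 + 4 * gradient_constant * area_upper * (real CARD('d) + 1))"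

lemma stability_constant_pos: "0 < R \<Longrightarrow> 0 < stability_constant R"
  unfolding stability_constant_def poincare_constant_def using area_bounds_pos C3_pos
  by (intro mult_pos_pos divide_pos_pos add_pos_pos) auto

lemma central_values_le_energy:
  assumes u: "broken_poly u" and R: "\<And>x. x \<in> \<Union>\<T> \<Longrightarrow> norm x \<le> R" "0 < R"
  shows "h ^ CARD('d) * (\<Sum>K\<in>\<T>. (u K (barycenter K))\<^sup>2)
    \<le> stability_constant R * ((\<Sum>K\<in>\<T>. element_energy u K) + (\<Sum>e\<in>faces. jump_energy u e / diameter e))"
proof -
  let ?H = "h ^ CARD('d)" and ?N = "\<Sum>K\<in>\<T>. (u K (barycenter K))\<^sup>2"
  let ?E = "\<Sum>K\<in>\<T>. element_energy u K" and ?J = "\<Sum>e\<in>faces. jump_energy u e / diameter e"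
  let ?c = "4 * gradient_constant * area_upper * (real CARD('d) + 1)"
  have P0: "0 \<le> poincare_constant R"
    unfolding poincare_constant_def using area_bounds_pos by (intro divide_nonneg_pos mult_nonneg_nonneg) auto
  have E0: "0 \<le> ?E" by (intro sum_nonneg element_energy_nonneg)
  have J0: "0 \<le> ?J" using face_diameter(3) jump_energy_nonneg by (intro sum_nonneg divide_nonneg_pos)
  have c0: "0 \<le> ?c" using C3_pos area_bounds_pos by simp
  have jle: "jump_energy u e \<le> h * (jump_energy u e / diameter e)" if "e \<in> faces" for e
    using mult_right_mono[OF face_diameter(2)[OF that] jump_energy_nonneg[of u e]] face_diameter(3)[OF that]
    by (simp add: field_simps)
  have "(\<Sum>e\<in>faces. facet_area e * (face_jump (\<lambda>K. u K (barycenter K)) e)\<^sup>2)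
      \<le> (\<Sum>e\<in>faces. 2 * h * (jump_energy u e / diameter e)
            + 4 * h * gradient_constant * area_upper * (\<Sum>K\<in>face_elements e. element_energy u K))"
    using central_jump_le_energy[OF u] jle by (intro sum_mono) force
  also have "\<dots> = h * (2 * ?J + ?c * ?E)"
    unfolding sum.distrib sum_distrib_left[symmetric] sum_faces_elements_const by (simp add: algebra_simps)
  also have "\<dots> \<le> h * ((2 + ?c) * (?E + ?J))"
  proof (rule mult_left_mono)
    have "0 \<le> 2 * ?E + ?c * ?J" using E0 mult_nonneg_nonneg[OF c0 J0] by linarith
    then show "2 * ?J + ?c * ?E \<le> (2 + ?c) * (?E + ?J)" by (simp only: distrib_left distrib_right)
  qed (use h_pos in simp)
  finally have "poincare_constant R * (\<Sum>e\<in>faces. facet_area e * (face_jump (\<lambda>K. u K (barycenter K)) e)\<^sup>2)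
      \<le> poincare_constant R * (h * ((2 + ?c) * (?E + ?J)))" by (intro mult_left_mono P0)
  moreover have "h * ?H * ?N \<le> poincare_constant R * (\<Sum>e\<in>faces. facet_area e * (face_jump (\<lambda>K. u K (barycenter K)) e)\<^sup>2)"
    by (rule discrete_poincare[OF R(1)])
  ultimately have "h * (?H * ?N) \<le> h * (stability_constant R * (?E + ?J))"
    unfolding stability_constant_def by (simp only: mult_ac)
  then show ?thesis using h_pos by simp
qed

definition coercivity_constant :: "real \<Rightarrow> real \<Rightarrow> real" where
  "coercivity_constant R \<mu> = min a\<^sub>0 \<mu> / (2 * stability_constant R)"

lemma coercivity_constant_pos: "0 < R \<Longrightarrow> 0 < \<mu> \<Longrightarrow> 0 < coercivity_constant R \<mu>"
  unfolding coercivity_constant_def using stability_constant_pos a0_pos by simp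

lemma dg_form_coercive:
  assumes u: "broken_poly u" and R: "\<And>x. x \<in> \<Union>\<T> \<Longrightarrow> norm x \<le> R" "0 < R"
    and \<mu>: "0 < \<mu>" and \<theta>: "\<theta> = 1 \<or> (\<theta> = -1 \<and> penalty_threshold \<le> \<mu>)"
  shows "coercivity_constant R \<mu> * h ^ CARD('d) * (\<Sum>K\<in>\<T>. (u K (barycenter K))\<^sup>2) \<le> dg_form A \<theta> \<mu> \<Omega> \<T> u u"
proof -
  let ?H = "h ^ CARD('d)" and ?N = "\<Sum>K\<in>\<T>. (u K (barycenter K))\<^sup>2"
  let ?E = "\<Sum>K\<in>\<T>. element_energy u K" and ?J = "\<Sum>e\<in>faces. jump_energy u e / diameter e"
  have E0: "0 \<le> ?E" by (intro sum_nonneg element_energy_nonneg)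
  have J0: "0 \<le> ?J" using face_diameter(3) jump_energy_nonneg by (intro sum_nonneg divide_nonneg_pos)
  have s: "0 < stability_constant R" by (rule stability_constant_pos[OF R(2)])
  have cc: "0 \<le> coercivity_constant R \<mu>" using coercivity_constant_pos[OF R(2) \<mu>] by simp
  have "coercivity_constant R \<mu> * (?H * ?N) \<le> coercivity_constant R \<mu> * (stability_constant R * (?E + ?J))"
    by (intro mult_left_mono cc central_values_le_energy[OF u R])
  also have "\<dots> = min a\<^sub>0 \<mu> / 2 * ?E + min a\<^sub>0 \<mu> / 2 * ?J"
    using s by (simp add: coercivity_constant_def algebra_simps)
  also have "\<dots> \<le> a\<^sub>0 / 2 * ?E + \<mu> / 2 * ?J" using E0 J0 by (intro add_mono mult_right_mono) auto
  also have "\<dots> \<le> dg_form A \<theta> \<mu> \<Omega> \<T> u u" by (rule dg_form_coercive_energy[OF u \<mu> \<theta>])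
  finally show ?thesis by (simp add: mult.assoc)
qed

end

section \<open>The stiffness matrix\<close>

locale stiffness_mesh = dg_mesh \<Omega> \<T> C\<sigma> m A a\<^sub>0 a\<^sub>1 C\<^sub>1 C\<^sub>2 + reconstruction_mesh \<Omega> \<T> C\<sigma> m s
  for \<Omega> :: "(real^'d::finite) set" and \<T> C\<sigma> m A a\<^sub>0 a\<^sub>1 C\<^sub>1 C\<^sub>2 s
begin

definition reconstructed :: "((real^'d) set \<Rightarrow> real) \<Rightarrow> 'd broken_fun" where
  "reconstructed \<xi> = (\<lambda>K x. \<Sum>K'\<in>\<T>. \<xi> K' * basis_fun m s \<T> K' K x)"

lemma broken_basis: "broken_poly (basis_fun m s \<T> K')"
  by (simp add: broken_poly_def basis_poly)

lemma broken_reconstructed: "broken_poly (reconstructed \<xi>)"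
  unfolding reconstructed_def by (rule broken_poly_sum) (rule broken_basis)

lemma reconstructed_at_barycenter:
  assumes "K \<in> \<T>" shows "reconstructed \<xi> K (barycenter K) = \<xi> K"
proof -
  have "reconstructed \<xi> K (barycenter K) = (\<Sum>K'\<in>\<T>. if K' = K then \<xi> K' else 0)"
    unfolding reconstructed_def using assms by (intro sum.cong) (auto simp: basis_at_barycenter)
  then show ?thesis using assms finite_mesh by simp
qed

definition local_bound :: "((real^'d) set \<Rightarrow> real) \<Rightarrow> (real^'d) set \<Rightarrow> real" where
  "local_bound \<xi> K = 2 * Lambda_bar m s \<T> * (\<Sum>K'\<in>\<T> \<inter> patch s \<T> K. \<bar>\<xi> K'\<bar>)"

lemma local_bound_nonneg: "0 \<le> local_bound \<xi> K"
  unfolding local_bound_def using Lambda_bar_ge_1 by (intro mult_nonneg_nonneg sum_nonneg) auto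

lemma reconstructed_le_local_bound:
  assumes K: "K \<in> \<T>" "x \<in> K"
  shows "\<bar>reconstructed \<xi> K x\<bar> \<le> local_bound \<xi> K"
proof -
  have "reconstructed \<xi> K x = (\<Sum>K'\<in>\<T> \<inter> patch s \<T> K. \<xi> K' * basis_fun m s \<T> K' K x)"
    unfolding reconstructed_def using finite_mesh basis_outside_patch[OF K(1)]
    by (intro sum.mono_neutral_right) auto
  also have "\<bar>\<dots>\<bar> \<le> (\<Sum>K'\<in>\<T> \<inter> patch s \<T> K. 2 * Lambda_bar m s \<T> * \<bar>\<xi> K'\<bar>)"
  proof (intro order_trans[OF sum_abs] sum_mono)
    fix K' show "\<bar>\<xi> K' * basis_fun m s \<T> K' K x\<bar> \<le> 2 * Lambda_bar m s \<T> * \<bar>\<xi> K'\<bar>"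
      unfolding abs_mult using mult_left_mono[OF basis_bounded[OF K, of K'], of "\<bar>\<xi> K'\<bar>"] by (simp add: mult.commute)
  qed
  finally show ?thesis by (simp add: local_bound_def sum_distrib_left)
qed

text \<open>Both the number of elements in a patch and the number of patches that contain a given element
  are bounded.\<close>

lemma L2_local_bound: "L2_set (local_bound \<xi>) \<T> \<le> 2 * Lambda_bar m s \<T> * patch_bound s * L2_set \<xi> \<T>"
proof -
  let ?P = "patch_bound s" and ?L = "2 * Lambda_bar m s \<T>"
  have L0: "0 \<le> ?L" using Lambda_bar_ge_1 by simp
  have "(\<Sum>K\<in>\<T>. (\<Sum>K'\<in>\<T> \<inter> patch s \<T> K. \<bar>\<xi> K'\<bar>)\<^sup>2) \<le> (\<Sum>K\<in>\<T>. ?P * (\<Sum>K'\<in>\<T> \<inter> patch s \<T> K. (\<xi> K')\<^sup>2))"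
  proof (rule sum_mono)
    fix K assume K: "K \<in> \<T>"
    have "(\<Sum>K'\<in>\<T> \<inter> patch s \<T> K. \<bar>\<xi> K'\<bar>)\<^sup>2 \<le> (\<Sum>K'\<in>\<T> \<inter> patch s \<T> K. \<bar>\<xi> K'\<bar>\<^sup>2) * real (card (\<T> \<inter> patch s \<T> K))"
      by (rule sum_squared_le_sum_of_squares)
    also have "\<dots> \<le> (\<Sum>K'\<in>\<T> \<inter> patch s \<T> K. \<bar>\<xi> K'\<bar>\<^sup>2) * ?P"
    proof (intro mult_left_mono sum_nonneg)
      have "card (\<T> \<inter> patch s \<T> K) \<le> card (patch s \<T> K)"
        using finite_patch[OF patches K] by (intro card_mono) auto
      then show "real (card (\<T> \<inter> patch s \<T> K)) \<le> ?P" using card_patch[OF patches K] by simp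
    qed simp
    finally show "(\<Sum>K'\<in>\<T> \<inter> patch s \<T> K. \<bar>\<xi> K'\<bar>)\<^sup>2 \<le> ?P * (\<Sum>K'\<in>\<T> \<inter> patch s \<T> K. (\<xi> K')\<^sup>2)"
      by (simp add: mult.commute)
  qed
  also have "\<dots> = ?P * (\<Sum>K\<in>\<T>. \<Sum>K' | K' \<in> \<T> \<and> K' \<in> patch s \<T> K. (\<xi> K')\<^sup>2)"
    by (simp add: sum_distrib_left Int_def)
  also have "(\<Sum>K\<in>\<T>. \<Sum>K' | K' \<in> \<T> \<and> K' \<in> patch s \<T> K. (\<xi> K')\<^sup>2)
      = (\<Sum>K'\<in>\<T>. \<Sum>K | K \<in> \<T> \<and> K' \<in> patch s \<T> K. (\<xi> K')\<^sup>2)"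
    by (rule sum.swap_restrict[OF finite_mesh finite_mesh])
  also have "\<dots> = (\<Sum>K'\<in>\<T>. real (card {K \<in> \<T>. K' \<in> patch s \<T> K}) * (\<xi> K')\<^sup>2)" by simp
  also have "?P * \<dots> \<le> ?P * (\<Sum>K'\<in>\<T>. ?P * (\<xi> K')\<^sup>2)"
    by (intro mult_left_mono sum_mono mult_right_mono card_patches_containing[OF patches] patch_bound_nonneg) auto
  also have "\<dots> = ?P\<^sup>2 * (\<Sum>K\<in>\<T>. (\<xi> K)\<^sup>2)" by (simp add: sum_distrib_left[symmetric] power2_eq_square)
  finally have "(\<Sum>K\<in>\<T>. (\<Sum>K'\<in>\<T> \<inter> patch s \<T> K. \<bar>\<xi> K'\<bar>)\<^sup>2) \<le> ?P\<^sup>2 * (\<Sum>K\<in>\<T>. (\<xi> K)\<^sup>2)" .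
  then have "L2_set (\<lambda>K. \<Sum>K'\<in>\<T> \<inter> patch s \<T> K. \<bar>\<xi> K'\<bar>) \<T> \<le> sqrt (?P\<^sup>2 * (\<Sum>K\<in>\<T>. (\<xi> K)\<^sup>2))"
    unfolding L2_set_def by (rule real_sqrt_le_mono)
  also have "\<dots> = ?P * L2_set \<xi> \<T>"
    unfolding L2_set_def using patch_bound_nonneg[of s] by (simp add: real_sqrt_mult)
  finally have "?L * L2_set (\<lambda>K. \<Sum>K'\<in>\<T> \<inter> patch s \<T> K. \<bar>\<xi> K'\<bar>) \<T> \<le> ?L * (?P * L2_set \<xi> \<T>)"
    using L0 by (rule mult_left_mono)
  moreover have "?L * L2_set (\<lambda>K. \<Sum>K'\<in>\<T> \<inter> patch s \<T> K. \<bar>\<xi> K'\<bar>) \<T> = L2_set (local_bound \<xi>) \<T>"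
    unfolding local_bound_def[abs_def] using L0 by (rule L2_set_right_distrib)
  ultimately show ?thesis by (simp only: mult_ac)
qed

lemma reconstructed_form_bound:
  assumes "\<bar>\<theta>\<bar> \<le> 1" "0 < \<mu>"
  shows "\<bar>dg_form A \<theta> \<mu> \<Omega> \<T> (reconstructed \<xi>) (reconstructed \<zeta>)\<bar>
    \<le> continuity_constant \<mu> * (2 * patch_bound s)\<^sup>2 * h ^ CARD('d) / h\<^sup>2 * (Lambda_bar m s \<T>)\<^sup>2 * (L2_set \<xi> \<T> * L2_set \<zeta> \<T>)"
proof -
  let ?P = "patch_bound s" and ?L = "Lambda_bar m s \<T>" and ?c = "continuity_constant \<mu> * h ^ CARD('d) / h\<^sup>2"
  have c: "0 \<le> ?c" using continuity_constant_pos[OF assms(2)] h_pos by simp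
  have nn: "0 \<le> 2 * ?L * ?P * L2_set \<xi> \<T>"
    using Lambda_bar_ge_1 patch_bound_nonneg by (intro mult_nonneg_nonneg L2_set_nonneg) auto
  have "\<bar>dg_form A \<theta> \<mu> \<Omega> \<T> (reconstructed \<xi>) (reconstructed \<zeta>)\<bar> \<le> ?c * (L2_set (local_bound \<xi>) \<T> * L2_set (local_bound \<zeta>) \<T>)"
    by (intro dg_form_continuous broken_reconstructed reconstructed_le_local_bound local_bound_nonneg assms)
  also have "\<dots> \<le> ?c * ((2 * ?L * ?P * L2_set \<xi> \<T>) * (2 * ?L * ?P * L2_set \<zeta> \<T>))"
    by (intro mult_left_mono mult_mono L2_local_bound c nn L2_set_nonneg)
  also have "\<dots> = continuity_constant \<mu> * (2 * ?P)\<^sup>2 * h ^ CARD('d) / h\<^sup>2 * ?L\<^sup>2 * (L2_set \<xi> \<T> * L2_set \<zeta> \<T>)"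
    by (simp add: power2_eq_square)
  finally show ?thesis .
qed

lemma reconstructed_form_eq:
  "dg_form A \<theta> \<mu> \<Omega> \<T> (reconstructed \<xi>) (reconstructed \<zeta>)
    = (\<Sum>K\<in>\<T>. \<Sum>K'\<in>\<T>. (\<xi> K * \<zeta> K') * dg_form A \<theta> \<mu> \<Omega> \<T> (basis_fun m s \<T> K) (basis_fun m s \<T> K'))"
  unfolding reconstructed_def by (rule dg_form_bilinear) (simp add: broken_basis)

lemma reconstructed_form_coercive:
  assumes "\<And>x. x \<in> \<Union>\<T> \<Longrightarrow> norm x \<le> R" "0 < R" "0 < \<mu>" "\<theta> = 1 \<or> (\<theta> = -1 \<and> penalty_threshold \<le> \<mu>)"
  shows "coercivity_constant R \<mu> * h ^ CARD('d) * (L2_set \<xi> \<T>)\<^sup>2 \<le> dg_form A \<theta> \<mu> \<Omega> \<T> (reconstructed \<xi>) (reconstructed \<xi>)"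
proof -
  have "(L2_set \<xi> \<T>)\<^sup>2 = (\<Sum>K\<in>\<T>. (reconstructed \<xi> K (barycenter K))\<^sup>2)"
    by (simp add: L2_set_def sum_nonneg reconstructed_at_barycenter cong: sum.cong)
  then show ?thesis using dg_form_coercive[OF broken_reconstructed assms, of \<xi>] by simp
qed

end

section \<open>Condition numbers\<close>

lemma vec_norm2_eq_L2_set: "x \<in> carrier_vec n \<Longrightarrow> vec_norm2 x = L2_set (vec_index x) {..<n}"
  by (simp add: vec_norm2_def L2_set_def scalar_prod_def power2_eq_square lessThan_atLeast0)

lemma scalar_prod_le_vec_norm2:
  assumes "x \<in> carrier_vec n" "y \<in> carrier_vec n"
  shows "scalar_prod x y \<le> vec_norm2 x * vec_norm2 y"
proof -
  have "scalar_prod x y = (\<Sum>i<n. vec_index x i * vec_index y i)"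
    using assms by (simp add: scalar_prod_def lessThan_atLeast0)
  also have "\<dots> \<le> (\<Sum>i<n. \<bar>vec_index x i\<bar> * \<bar>vec_index y i\<bar>)"
    by (intro sum_mono) (metis abs_ge_self abs_mult)
  also have "\<dots> \<le> vec_norm2 x * vec_norm2 y"
    unfolding vec_norm2_eq_L2_set[OF assms(1)] vec_norm2_eq_L2_set[OF assms(2)] by (rule L2_set_mult_ineq)
  finally show ?thesis .
qed

lemma scalar_prod_self: "x \<in> carrier_vec n \<Longrightarrow> scalar_prod x x = (vec_norm2 (x :: real Matrix.vec))\<^sup>2"
  by (simp add: vec_norm2_def scalar_prod_def sum_nonneg)

lemma vec_norm2_nonneg: "0 \<le> vec_norm2 x"
  by (simp add: vec_norm2_def scalar_prod_def sum_nonneg)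

lemma vec_norm2_eq_0: "x \<in> carrier_vec n \<Longrightarrow> vec_norm2 x = 0 \<Longrightarrow> x = 0\<^sub>v n"
  by (auto simp: vec_norm2_eq_L2_set L2_set_eq_0_iff)

lemma mat_norm2_le:
  assumes B: "B \<in> carrier_mat n n" and n: "0 < n"
    and le: "\<And>x. x \<in> carrier_vec n \<Longrightarrow> vec_norm2 x = 1 \<Longrightarrow> vec_norm2 (B *\<^sub>v x) \<le> \<beta>"
  shows "mat_norm2 B \<le> \<beta>" "0 \<le> mat_norm2 B"
proof -
  let ?S = "{vec_norm2 (B *\<^sub>v x) |x. x \<in> carrier_vec (dim_col B) \<and> vec_norm2 x = 1}"
  have "vec_norm2 (unit_vec n 0 :: real Matrix.vec) = 1"
    unfolding vec_norm2_def using n by simp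
  then have ne: "vec_norm2 (B *\<^sub>v unit_vec n 0) \<in> ?S" using B by auto
  have ub: "\<And>y. y \<in> ?S \<Longrightarrow> y \<le> \<beta>" using le B by auto
  show "mat_norm2 B \<le> \<beta>" unfolding mat_norm2_def using ne by (intro cSup_least ub) auto
  have "vec_norm2 (B *\<^sub>v unit_vec n 0) \<le> mat_norm2 B"
    unfolding mat_norm2_def using ub by (intro cSup_upper[OF ne] bdd_aboveI[of _ \<beta>]) auto
  then show "0 \<le> mat_norm2 B" using vec_norm2_nonneg order_trans by blast
qed

text \<open>Testing \<open>B x\<close> with itself bounds the norm of \<open>B\<close>, and testing \<open>B z = y\<close> with \<open>z\<close> bounds the norm of
  the inverse.\<close>

lemma condition_number_le:
  fixes B :: "real mat"
  assumes B: "B \<in> carrier_mat n n" and n: "0 < n"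
    and upper: "\<And>x y. x \<in> carrier_vec n \<Longrightarrow> y \<in> carrier_vec n \<Longrightarrow>
      \<bar>scalar_prod x (B *\<^sub>v y)\<bar> \<le> \<beta> * (vec_norm2 x * vec_norm2 y)"
    and lower: "\<And>x. x \<in> carrier_vec n \<Longrightarrow> \<alpha> * (vec_norm2 x)\<^sup>2 \<le> scalar_prod x (B *\<^sub>v x)"
    and \<alpha>: "0 < \<alpha>" and \<beta>: "0 \<le> \<beta>"
  shows "invertible_mat B \<and> condition_number B \<le> \<beta> / \<alpha>"
proof -
  have "Determinant.det B \<noteq> 0"
  proof
    assume "Determinant.det B = 0"
    then obtain v where v: "v \<in> carrier_vec n" "v \<noteq> 0\<^sub>v n" "B *\<^sub>v v = 0\<^sub>v n"
      using det_0_iff_vec_prod_zero_field[OF B] by blast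
    then have "\<alpha> * (vec_norm2 v)\<^sup>2 \<le> 0" using lower[OF v(1)] by simp
    then have "vec_norm2 v = 0" using \<alpha> by (simp add: mult_le_0_iff)
    then show False using vec_norm2_eq_0[OF v(1)] v(2) by simp
  qed
  then have unit: "B \<in> Units (ring_mat TYPE(real) n ())" by (rule det_non_zero_imp_unit[OF B])
  then obtain Bi where Bi: "mat_inverse B = Some Bi"
    using mat_inverse(1)[OF B, of "()"] by (cases "mat_inverse B") auto
  have inv: "B * Bi = 1\<^sub>m n" "Bi * B = 1\<^sub>m n" "Bi \<in> carrier_mat n n"
    using mat_inverse(2)[OF B Bi] by auto
  have invertible: "invertible_mat B"
    unfolding invertible_mat_def inverts_mat_def using inv B by (auto intro!: exI[of _ Bi])
  have B_le: "vec_norm2 (B *\<^sub>v x) \<le> \<beta>" if x: "x \<in> carrier_vec n" "vec_norm2 x = 1" for x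
  proof -
    have Bx: "B *\<^sub>v x \<in> carrier_vec n" using B x by simp
    have "(vec_norm2 (B *\<^sub>v x))\<^sup>2 \<le> \<beta> * vec_norm2 (B *\<^sub>v x)"
      using upper[OF Bx x(1)] x(2) by (simp add: scalar_prod_self[OF Bx])
    then show ?thesis
      using \<beta> vec_norm2_nonneg[of "B *\<^sub>v x"] by (cases "vec_norm2 (B *\<^sub>v x) = 0") (simp_all add: power2_eq_square)
  qed
  have Bi_le: "vec_norm2 (Bi *\<^sub>v y) \<le> 1 / \<alpha>" if y: "y \<in> carrier_vec n" "vec_norm2 y = 1" for y
  proof -
    let ?z = "Bi *\<^sub>v y"
    have z: "?z \<in> carrier_vec n" using inv(3) y by simp
    have "B *\<^sub>v ?z = y" using assoc_mult_mat_vec[OF B inv(3) y(1)] inv(1) y(1) by simp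
    then have "\<alpha> * (vec_norm2 ?z)\<^sup>2 \<le> vec_norm2 ?z"
      using lower[OF z] scalar_prod_le_vec_norm2[OF z y(1)] y(2) by simp
    then show ?thesis
      using \<alpha> vec_norm2_nonneg[of ?z] by (cases "vec_norm2 ?z = 0") (simp_all add: power2_eq_square field_simps)
  qed
  have "condition_number B = mat_norm2 B * mat_norm2 Bi" by (simp add: condition_number_def Bi)
  also have "\<dots> \<le> \<beta> * (1 / \<alpha>)" using \<beta> by (intro mult_mono mat_norm2_le[OF B n B_le] mat_norm2_le[OF inv(3) n Bi_le])
  finally show ?thesis using invertible by simp
qed

context stiffness_mesh begin

text \<open>The powers \<open>h\<^sup>d\<close> of the upper and the lower bound cancel.\<close>

lemma stiffness_matrix_condition:
  assumes Ks: "bij_betw Ks {..<card \<T>} \<T>"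
    and R: "\<And>x. x \<in> \<Union>\<T> \<Longrightarrow> norm x \<le> R" "0 < R"
    and \<mu>: "0 < \<mu>" and \<theta>: "\<theta> = 1 \<or> (\<theta> = -1 \<and> penalty_threshold \<le> \<mu>)"
  shows "invertible_mat (stiffness_matrix m s A \<theta> \<mu> \<Omega> \<T> Ks) \<and>
    condition_number (stiffness_matrix m s A \<theta> \<mu> \<Omega> \<T> Ks)
      \<le> continuity_constant \<mu> * (2 * patch_bound s)\<^sup>2 / coercivity_constant R \<mu>
          * (Lambda_bar m s \<T>)\<^sup>2 * h powi (-2)"
proof -
  let ?n = "card \<T>" and ?B = "stiffness_matrix m s A \<theta> \<mu> \<Omega> \<T> Ks" and ?H = "h ^ CARD('d)"
  let ?\<beta> = "continuity_constant \<mu> * (2 * patch_bound s)\<^sup>2 * ?H / h\<^sup>2 * (Lambda_bar m s \<T>)\<^sup>2"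
  let ?\<alpha> = "coercivity_constant R \<mu> * ?H"
  let ?a = "\<lambda>K K'. dg_form A \<theta> \<mu> \<Omega> \<T> (basis_fun m s \<T> K) (basis_fun m s \<T> K')"
  have B: "?B \<in> carrier_mat ?n ?n" by (simp add: stiffness_matrix_def)
  have n: "0 < ?n" using mesh_nonempty finite_mesh by (simp add: card_gt_0_iff)
  have c: "0 < continuity_constant \<mu>" "0 < coercivity_constant R \<mu>"
    using continuity_constant_pos[OF \<mu>] coercivity_constant_pos[OF R(2) \<mu>] .
  have Hp: "0 < ?H" using h_pos by simp
  define idx where "idx K = inv_into {..<?n} Ks K" for K
  have idx: "idx (Ks i) = i" if "i < ?n" for i
    unfolding idx_def using Ks that by (intro inv_into_f_f) (auto simp: bij_betw_def)
  have reindex: "(\<Sum>K\<in>\<T>. f K) = (\<Sum>i<?n. f (Ks i))" for f :: "_ \<Rightarrow> real"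
    using sum.reindex_bij_betw[OF Ks, of f] by simp
  have norm: "vec_norm2 x = L2_set (\<lambda>K. vec_index x (idx K)) \<T>" if "x \<in> carrier_vec ?n" for x
    unfolding vec_norm2_eq_L2_set[OF that] L2_set_def reindex
    by (intro arg_cong[of _ _ sqrt] sum.cong refl) (simp add: idx)
  have form: "scalar_prod x (?B *\<^sub>v y)
      = dg_form A \<theta> \<mu> \<Omega> \<T> (reconstructed (\<lambda>K. vec_index x (idx K))) (reconstructed (\<lambda>K. vec_index y (idx K)))"
    if x: "x \<in> carrier_vec ?n" and y: "y \<in> carrier_vec ?n" for x y
  proof -
    have entry: "vec_index (?B *\<^sub>v y) i = (\<Sum>j<?n. ?a (Ks i) (Ks j) * vec_index y j)" if "i < ?n" for i
      using that B y by (simp add: scalar_prod_def lessThan_atLeast0 stiffness_matrix_def)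
    have "scalar_prod x (?B *\<^sub>v y) = (\<Sum>i<?n. vec_index x i * vec_index (?B *\<^sub>v y) i)"
      using B by (simp add: scalar_prod_def lessThan_atLeast0)
    also have "\<dots> = (\<Sum>i<?n. \<Sum>j<?n. (vec_index x i * vec_index y j) * ?a (Ks i) (Ks j))"
      by (intro sum.cong refl) (simp add: entry sum_distrib_left mult_ac)
    also have "\<dots> = (\<Sum>K\<in>\<T>. \<Sum>K'\<in>\<T>. (vec_index x (idx K) * vec_index y (idx K')) * ?a K K')"
      unfolding reindex by (intro sum.cong refl) (simp add: idx)
    finally show ?thesis unfolding reconstructed_form_eq .
  qed
  have abs\<theta>: "\<bar>\<theta>\<bar> \<le> 1" using \<theta> by auto
  have "invertible_mat ?B \<and> condition_number ?B \<le> ?\<beta> / ?\<alpha>"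
  proof (rule condition_number_le[OF B n])
    fix x y :: "real Matrix.vec" assume xy: "x \<in> carrier_vec ?n" "y \<in> carrier_vec ?n"
    show "\<bar>scalar_prod x (?B *\<^sub>v y)\<bar> \<le> ?\<beta> * (vec_norm2 x * vec_norm2 y)"
      unfolding form[OF xy] norm[OF xy(1)] norm[OF xy(2)] by (rule reconstructed_form_bound[OF abs\<theta> \<mu>])
  next
    fix x :: "real Matrix.vec" assume x: "x \<in> carrier_vec ?n"
    show "?\<alpha> * (vec_norm2 x)\<^sup>2 \<le> scalar_prod x (?B *\<^sub>v x)"
      unfolding form[OF x x] norm[OF x] by (rule reconstructed_form_coercive[OF R \<mu> \<theta>])
  next
    show "0 < ?\<alpha>" "0 \<le> ?\<beta>" using c Hp h_pos by simp_all
  qed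
  moreover have "?\<beta> / ?\<alpha> = continuity_constant \<mu> * (2 * patch_bound s)\<^sup>2 / coercivity_constant R \<mu>
          * (Lambda_bar m s \<T>)\<^sup>2 * h powi (-2)"
    using c h_pos by (simp add: power_int_minus field_simps)
  ultimately show ?thesis by simp
qed

end

section \<open>The condition number estimate\<close>

lemma spd_matrix_bounds:
  fixes A :: "real^'d^'d"
  assumes "spd_matrix A"
  shows "\<exists>a\<^sub>0>0. \<forall>x. a\<^sub>0 * (norm x)\<^sup>2 \<le> x \<bullet> (A *v x)"
    and "\<exists>a\<^sub>1>0. \<forall>x. norm (A *v x) \<le> a\<^sub>1 * norm x"
proof -
  have cont: "continuous_on (sphere 0 1) (\<lambda>x. x \<bullet> (A *v x))"
    by (intro continuous_on_inner continuous_on_id continuous_on_matrix_vector_mult)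
  have "axis undefined 1 \<in> sphere (0 :: real^'d) 1" by simp
  then obtain y where y: "y \<in> sphere 0 1" "\<And>x. x \<in> sphere 0 1 \<Longrightarrow> y \<bullet> (A *v y) \<le> x \<bullet> (A *v x)"
    using continuous_attains_inf[OF compact_sphere _ cont] by blast
  have "y \<noteq> 0" using y(1) by auto
  then have pos: "0 < y \<bullet> (A *v y)" using assms by (simp add: spd_matrix_def)
  have "y \<bullet> (A *v y) * (norm x)\<^sup>2 \<le> x \<bullet> (A *v x)" for x
  proof (cases "x = 0")
    case False
    have "y \<bullet> (A *v y) \<le> (x /\<^sub>R norm x) \<bullet> (A *v (x /\<^sub>R norm x))" using False by (intro y(2)) simp
    also have "\<dots> = (x \<bullet> (A *v x)) / (norm x)\<^sup>2"
      by (simp add: linear_cmul[OF matrix_vector_mul_linear] power2_eq_square divide_inverse)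
    finally show ?thesis using False by (simp add: field_simps)
  qed simp
  then show "\<exists>a\<^sub>0>0. \<forall>x. a\<^sub>0 * (norm x)\<^sup>2 \<le> x \<bullet> (A *v x)" using pos by blast
  show "\<exists>a\<^sub>1>0. \<forall>x. norm (A *v x) \<le> a\<^sub>1 * norm x"
    using bounded_linear.pos_bounded[OF matrix_vector_mul_bounded_linear[of A]] by (simp add: mult.commute)
qed

theorem theorem2:
  fixes A :: "real^'d^'d" and m :: nat and C\<sigma> \<theta> :: real
  assumes "CARD('d) = 2 \<or> CARD('d) = 3"
    and "1 \<le> m"
    and "0 < C\<sigma>"
    and "spd_matrix A"
    and "\<theta> \<in> {-1, 1}"
  shows "\<exists>\<mu>\<^sub>0>0. \<forall>(\<Omega> :: (real^'d) set) (s :: nat) (\<mu> :: real).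
           convex_polyhedral_domain \<Omega> \<and> (if \<theta> = 1 then 0 < \<mu> else \<mu>\<^sub>0 \<le> \<mu>) \<longrightarrow>
           (\<exists>C>0. \<forall>(\<T> :: (real^'d) set set) (Ks :: nat \<Rightarrow> (real^'d) set).
              admissible_mesh m s C\<sigma> \<Omega> \<T> \<and> bij_betw Ks {..<card \<T>} \<T> \<longrightarrow>
              invertible_mat (stiffness_matrix m s A \<theta> \<mu> \<Omega> \<T> Ks) \<and>
              condition_number (stiffness_matrix m s A \<theta> \<mu> \<Omega> \<T> Ks)
                \<le> C * (Lambda_bar m s \<T>)\<^sup>2 * mesh_size \<T> powi (-2))"
proof -
  obtain a\<^sub>0 where a0: "0 < a\<^sub>0" "\<And>x. a\<^sub>0 * (norm x)\<^sup>2 \<le> x \<bullet> (A *v x)"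
    using spd_matrix_bounds(1)[OF assms(4)] by blast
  obtain a\<^sub>1 where a1: "0 < a\<^sub>1" "\<And>x. norm (A *v x) \<le> a\<^sub>1 * norm x"
    using spd_matrix_bounds(2)[OF assms(4)] by blast
  obtain C\<^sub>1 where C1: "0 < C\<^sub>1" and C1': "\<And>p c r M x. p \<in> poly_space m \<Longrightarrow> 0 < r \<Longrightarrow> (\<And>y. y \<in> cball c r \<Longrightarrow> \<bar>p y\<bar> \<le> M)
      \<Longrightarrow> x \<in> cball (c::real^'d) (2 * C\<sigma> * r) \<Longrightarrow> norm (grad p x) \<le> C\<^sub>1 * M / r"
    using grad_le_sup_on_ball[where 'd='d and m=m and \<kappa>="2 * C\<sigma>"] by blast
  obtain C\<^sub>2 where C2: "0 < C\<^sub>2" and C2': "\<And>p c r x. p \<in> poly_space m \<Longrightarrow> 0 < r \<Longrightarrow> x \<in> cball (c::real^'d) (2 * C\<sigma> * r)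
      \<Longrightarrow> r ^ CARD('d) * (norm (grad p x))\<^sup>2 \<le> C\<^sub>2 * (LINT y:cball c r|lborel. (norm (grad p y))\<^sup>2)"
    using grad_le_L2_on_ball[where 'd='d and m=m and \<kappa>="2 * C\<sigma>"] by blast
  \<comment> \<open>The maximum with one makes the threshold, and below the constant, positive for trivial reasons, also
    for domains without admissible meshes.\<close>
  let ?\<mu> = "max 1 (dg_mesh.penalty_threshold TYPE('d) C\<sigma> a\<^sub>0 a\<^sub>1 C\<^sub>2)"
  show ?thesis
  proof (rule exI[of _ ?\<mu>], intro conjI allI impI)
    show "0 < ?\<mu>" by simp
  next
    fix \<Omega> :: "(real^'d) set" and s :: nat and \<mu> :: real
    assume H: "convex_polyhedral_domain \<Omega> \<and> (if \<theta> = 1 then 0 < \<mu> else ?\<mu> \<le> \<mu>)"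
    then have "bounded (closure \<Omega>)" by (simp add: convex_polyhedral_domain_def bounded_closure)
    then obtain R where R: "0 < R" "\<And>x. x \<in> closure \<Omega> \<Longrightarrow> norm x \<le> R" by (auto simp: bounded_pos)
    let ?K = "dg_mesh.continuity_constant TYPE('d) C\<sigma> a\<^sub>1 C\<^sub>1 \<mu> * (2 * quasi_uniform_mesh.patch_bound TYPE('d) C\<sigma> s)\<^sup>2
      / dg_mesh.coercivity_constant TYPE('d) C\<sigma> a\<^sub>0 C\<^sub>2 R \<mu>"
    have \<mu>: "0 < \<mu>" using H by (auto split: if_splits)
    show "\<exists>C>0. \<forall>(\<T> :: (real^'d) set set) (Ks :: nat \<Rightarrow> (real^'d) set).
              admissible_mesh m s C\<sigma> \<Omega> \<T> \<and> bij_betw Ks {..<card \<T>} \<T> \<longrightarrow>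
              invertible_mat (stiffness_matrix m s A \<theta> \<mu> \<Omega> \<T> Ks) \<and>
              condition_number (stiffness_matrix m s A \<theta> \<mu> \<Omega> \<T> Ks)
                \<le> C * (Lambda_bar m s \<T>)\<^sup>2 * mesh_size \<T> powi (-2)"
    proof (intro exI[of _ "max 1 ?K"] conjI[of "0 < max 1 ?K"] allI impI)
      show "0 < max 1 ?K" by simp
    next
      fix \<T> :: "(real^'d) set set" and Ks
      assume M: "admissible_mesh m s C\<sigma> \<Omega> \<T> \<and> bij_betw Ks {..<card \<T>} \<T>"
      interpret stiffness_mesh \<Omega> \<T> C\<sigma> m A a\<^sub>0 a\<^sub>1 C\<^sub>1 C\<^sub>2 s
      proof
        show "convex_polyhedral_domain \<Omega>" using H by simp
        show "simplicial_mesh \<Omega> \<T>" "mesh_size \<T> \<le> C\<sigma> * mesh_inradius \<T>"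
          "patches_exist s \<T>" "unisolvent m s \<T>" using M by (simp_all add: admissible_mesh_def)
      qed (fact assms(1) assms(3) a0 a1 C1 C2 C1' C2')+
      have \<theta>: "\<theta> = 1 \<or> (\<theta> = -1 \<and> penalty_threshold \<le> \<mu>)"
        using assms(5) H by (auto split: if_splits)
      have Rm: "norm x \<le> R" if "x \<in> \<Union>\<T>" for x using that R(2) mesh_cover by simp
      have *: "invertible_mat (stiffness_matrix m s A \<theta> \<mu> \<Omega> \<T> Ks) \<and>
          condition_number (stiffness_matrix m s A \<theta> \<mu> \<Omega> \<T> Ks)
            \<le> ?K * (Lambda_bar m s \<T>)\<^sup>2 * mesh_size \<T> powi (-2)"
        by (rule stiffness_matrix_condition[OF conjunct2[OF M] Rm R(1) \<mu> \<theta>])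
      have "?K * (Lambda_bar m s \<T>)\<^sup>2 * mesh_size \<T> powi (-2) \<le> max 1 ?K * (Lambda_bar m s \<T>)\<^sup>2 * mesh_size \<T> powi (-2)"
        using h_pos by (intro mult_right_mono) auto
      then show "invertible_mat (stiffness_matrix m s A \<theta> \<mu> \<Omega> \<T> Ks) \<and>
          condition_number (stiffness_matrix m s A \<theta> \<mu> \<Omega> \<T> Ks)
            \<le> max 1 ?K * (Lambda_bar m s \<T>)\<^sup>2 * mesh_size \<T> powi (-2)"
        by (rule conjI[OF conjunct1[OF *] order_trans[OF conjunct2[OF *]]])
    qed
  qed
qed

end
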